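(* Let $\lambda_n$ ($n<\omega$) be regular or finite cardinals with $2^{\lambda_n}<\lambda_{n+1}$, $\lambda=\sum_{n<\omega}\lambda_n\geq\aleph_0$; let $\mu_n$ ($n<\omega$) be cardinals with $\lambda=\sum_n\mu_n$, $\mu_{n+1}\geq\lambda_n$, $\beth_3(\mu_n)<\lambda_n$; let $\mu$ be a cardinal with $\lambda\leq\mu<2^\lambda$ and $\mathrm{cov}(\mu,\lambda_n^+,\lambda_n^+,\mu_n^+)\leq\mu$ for all $n$. Let $T$ be the family of open sets of a topological space $\Omega$, with a base $B$ of cardinality $\leq\mu$, and suppose $|T|\geq 2^\lambda$. (1) Then there are pairwise distinct points $x_\eta\in\Omega$ for $\eta\in\bigcup_{n<\omega}\prod_{l<n}\mu_l$ such that, letting $Z=\{x_\eta:\eta\in\bigcup_{n<\omega}\prod_{l<n}\mu_l\}$, one of the following holds: (a) there are $U_\eta\in T$ for $\eta\in\prod_{l<\omega}\mu_l$ with $U_\eta\cap Z=\{x_\nu\in Z:(\exists n<\lg(\nu))(\nu\restriction n=\eta\restriction n \wedge \nu(n)<\eta(n))\}$; (b) there are $U_\eta\in T$ for $\eta\in\prod_{l<\omega}\mu_l$ with $U_\eta\cap Z=\{x_\nu\in Z:(\exists n<\lg(\nu))(\nu\restriction n=\eta\restriction n\wedge \nu(n)>\eta(n))\}$; (c) there are $U_\eta\in T$ for $\eta\in\prod_{l<\omega}\mu_l$ with $U_\eta\cap Z=\{x_\nu\in Z:\neg(\nu\triangleleft\eta)\}$. (2) If in addition $\lambda=\aleph_0$,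 then there are pairwise distinct $x_q\in\Omega$ for $q\in\mathbb{Q}$ such that for every real $r$ there is an open set $U\in T$ with $U\cap\{x_q:q\in\mathbb{Q}\}=\{x_q:q\in\mathbb{Q},\ q<r\}$.
   Context: $\beth_3(\kappa)=2^{2^{2^\kappa}}$. A base $B$ of $T$ is a subfamily of $T$ closed under finite intersections such that every member of $T$ is a union of members of $B$. $\mathrm{cov}(\mu,\lambda^+,\lambda^+,\kappa)$ is the minimal cardinality of a family $P$ of subsets of $\mu$, each of cardinality $\leq\lambda$, such that every $a\subseteq\mu$ with $|a|\leq\lambda$ is included in $\bigcup_{i<\alpha}a_i$ for some $\alpha<\kappa$ and $a_i\in P$. $\prod_{l<n}\mu_l$ is the set of sequences $\eta$ of length $n$ with $\eta(l)<\mu_l$ (similarly for $n=\omega$); $\lg(\nu)$ is the length of $\nu$, $\nu\restriction n$ its initial segment of length $n$, and $\nu\triangleleft\eta$ means $\nu$ is a proper initial segment of $\eta$. *)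

theory Defs
  imports "HOL-Analysis.Analysis"
begin

text \<open>
  A cardinal is a relation \<open>r\<close> with \<open>Card_order r\<close>, that is, an initial well-order.  The elements
  of \<open>Field r\<close> stand for the ordinals below the cardinal, and \<open>underS r a\<close> is the set of ordinals
  below the ordinal \<open>a\<close>.  Finite cardinals, including zero, are allowed.
\<close>

unbundle cardinal_syntax

definition beth3 :: "'k rel \<Rightarrow> ((('k \<Rightarrow> bool) \<Rightarrow> bool) \<Rightarrow> bool) rel" where
  "beth3 r = ctwo ^c (ctwo ^c (ctwo ^c r))"

definition covering_family :: "'k rel \<Rightarrow> 'l rel \<Rightarrow> 'i rel \<Rightarrow> 'k set set \<Rightarrow> bool" where
  "covering_family m l k P \<longleftrightarrow>
     (\<forall>a\<in>P. a \<subseteq> Field m \<and> |a| \<le>o l) \<and>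
     (\<forall>a. a \<subseteq> Field m \<and> |a| \<le>o l \<longrightarrow>
        (\<exists>\<alpha>\<in>Field k. \<exists>A. (\<forall>i\<in>underS k \<alpha>. A i \<in> P) \<and> a \<subseteq> (\<Union>i\<in>underS k \<alpha>. A i)))"

text \<open>
  \<open>is_cov m l k c\<close> says that the cardinal \<open>c\<close> is $\mathrm{cov}(m, l^+, l^+, k)$.  It is a relation
  because there need not be any covering family when \<open>k\<close> is at most one.
\<close>

definition is_cov :: "'k rel \<Rightarrow> 'l rel \<Rightarrow> 'i rel \<Rightarrow> 'c rel \<Rightarrow> bool" where
  "is_cov m l k c \<longleftrightarrow>
     (\<exists>P. covering_family m l k P \<and> c =o |P| ) \<and>
     (\<forall>P. covering_family m l k P \<longrightarrow> c \<le>o |P| )"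

text \<open>Unlike for the usual notion of a base, closure under finite intersections is part of it.\<close>

definition is_base :: "'a topology \<Rightarrow> 'a set set \<Rightarrow> bool" where
  "is_base X B \<longleftrightarrow>
     (\<forall>U\<in>B. openin X U) \<and>
     (\<forall>U\<in>B. \<forall>V\<in>B. U \<inter> V \<in> B) \<and>
     (\<forall>U. openin X U \<longrightarrow> (\<exists>C\<subseteq>B. U = \<Union>C))"

definition fin_seqs :: "(nat \<Rightarrow> 'k rel) \<Rightarrow> 'k list set" where
  "fin_seqs m = {\<nu>. \<forall>l<length \<nu>. \<nu> ! l \<in> Field (m l)}"

definition inf_seqs :: "(nat \<Rightarrow> 'k rel) \<Rightarrow> (nat \<Rightarrow> 'k) set" where
  "inf_seqs m = {\<eta>. \<forall>l. \<eta> l \<in> Field (m l)}"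

definition restr :: "(nat \<Rightarrow> 'k) \<Rightarrow> nat \<Rightarrow> 'k list" where
  "restr \<eta> n = map \<eta> [0..<n]"

definition initial_seg :: "'k list \<Rightarrow> (nat \<Rightarrow> 'k) \<Rightarrow> bool" where
  "initial_seg \<nu> \<eta> \<longleftrightarrow> \<nu> = restr \<eta> (length \<nu>)"

end

theory Submission
  imports Defs "HOL-Library.Equipollence"
begin

text \<open>
  Call a set of points small if the open sets leave at most \<open>\<lambda>\<close> traces on it.  Two kinds of
  structure give the configurations.

  A product consists of \<open>\<lambda>\<^sub>n\<close> points on each level \<open>n\<close>, such that every choice of one index per
  level is realised by an open set that cuts each level in one of the three linear patterns
  (initial segment, final segment, complement of a point).  Embedding the sequences of length \<open>m\<close>,
  ordered lexicographically, into a suitable level yields (a), (b) or (c).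

  A chain \<open>K\<close> of filters in the base \<open>B\<close>, all of whose nonempty cylinders are large, contains long
  increasing or decreasing sequences everywhere, and a tree of nested cylinders yields (a) or (b).

  If no product exists, then the small sets form an ideal that is determined locally, and there is
  no infinite split sequence of non-small pieces.  Hence every set is detected by finitely many
  irreducible sets, the filters of irreducible sets are numerous, and a split argument makes them
  linearly ordered on some cylinder.  This settles spaces with a base of size \<open>\<lambda>\<close>.  In general, if
  there are more than \<open>\<mu>\<close> neighbourhood filters of points, the same argument applies to them.
  Otherwise the covering numbers permit to separate \<open>\<lambda>\<^sub>n\<close> large classes of open sets by \<open>\<lambda>\<^sub>n\<close>
  pairs (point, basic neighbourhood); iterating along a tree leaves a subspace of size \<open>\<lambda>\<close> with a
  base of size \<open>\<lambda>\<close> that has more than \<open>\<lambda>\<close> open sets.  For \<open>\<lambda> = \<aleph>\<^sub>0\<close> the ideal \<open>{{}}\<close> is used: either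
  there is an infinite discrete subspace, or a chain of more than \<open>\<mu>\<close> filters, into which the
  rationals embed.
\<close>

section \<open>Cardinality\<close>

text \<open>The obstacle is that having few traces is not visibly a local property: a union of
  \<lambda> sets with few traces each could carry up to \<open>2^\<lambda>\<close> traces. Countable
  cofinality repairs this. A base of size \<lambda> is an increasing union of pieces of size
  \<lambda>_n, and the part of an open set generated by the n-th piece takes at most
  \<open>2^(\<lambda>_n)\<close>, hence fewer than \<lambda>, values. Such types can be fixed by a
  pigeonhole without losing largeness, and a failure of locality lines them up into a product. Fixed
  losses (three exponentials for a pattern, one for a countable union) are absorbed by shifting the
  level. A base of size \<mu> has no such decomposition. Its substitute is a covering family: \<mu>
  sets of conditions, each of which sorts the open sets into at most
  \<open>2^(\<lambda>_n) \<le> \<mu>\<close> types, so that all small types can be discarded in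
  advance, while any \<lambda>_n conditions lie in \<mu>_n members. The gap between \<mu>_n and
  \<lambda>_n pays for a homogeneous sequence that puts the conditions of many pairs into one
  member.\<close>

lemma lepoll_iff_ordLeq: "A \<lesssim> B \<longleftrightarrow> |A| \<le>o |B|"
  unfolding lepoll_def by (rule card_of_ordLeq)

lemma not_lepoll_iff: "\<not> A \<lesssim> B \<longleftrightarrow> B \<prec> A"
proof
  assume "\<not> A \<lesssim> B"
  then have "B \<lesssim> A"
    by (metis lepoll_iff_ordLeq card_of_Well_order not_ordLeq_iff_ordLess ordLess_imp_ordLeq)
  with \<open>\<not> A \<lesssim> B\<close> show "B \<prec> A" by (meson lepoll_iff_leqpoll eqpoll_imp_lepoll eqpoll_sym)
qed (meson lesspoll_trans1 lesspoll_not_refl)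

lemma lepoll_cases: "A \<lesssim> B \<or> B \<prec> A"
  using not_lepoll_iff by blast

lemma UN_lepoll:
  assumes "infinite B" "I \<lesssim> B" "\<And>i. i \<in> I \<Longrightarrow> A i \<lesssim> B"
  shows "(\<Union>i\<in>I. A i) \<lesssim> B"
  using assms card_of_UNION_ordLeq_infinite unfolding lepoll_iff_ordLeq by blast

lemma Sigma_lepoll:
  assumes "infinite B" "I \<lesssim> B" "\<And>i. i \<in> I \<Longrightarrow> A i \<lesssim> B"
  shows "(SIGMA i:I. A i) \<lesssim> B"
  using assms card_of_Sigma_ordLeq_infinite unfolding lepoll_iff_ordLeq by blast

lemma Times_lepoll: "infinite B \<Longrightarrow> A \<lesssim> B \<Longrightarrow> C \<lesssim> B \<Longrightarrow> A \<times> C \<lesssim> B"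
  by (rule Sigma_lepoll)

lemma nat_lepoll: "infinite B \<Longrightarrow> (A :: nat set) \<lesssim> B"
  by (meson infinite_le_lepoll lepoll_trans subset_UNIV subset_imp_lepoll)

lemma Un_lepoll: assumes "infinite B" "A \<lesssim> B" "C \<lesssim> B" shows "A \<union> C \<lesssim> B"
proof -
  have "(\<Union>b\<in>(UNIV::bool set). if b then A else C) \<lesssim> B"
    using assms by (intro UN_lepoll) (auto intro: finite_lepoll_infinite)
  moreover have "(\<Union>b\<in>(UNIV::bool set). if b then A else C) = A \<union> C" by (auto split: if_splits)
  ultimately show ?thesis by simp
qed

lemma finite_lepoll: "infinite B \<Longrightarrow> finite A \<Longrightarrow> A \<lesssim> B"
  by (simp add: finite_lepoll_infinite)

lemma lists_lepoll:
  assumes "infinite B" "A \<lesssim> B"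
  shows "lists A \<lesssim> B"
proof -
  have len: "{xs \<in> lists A. length xs = n} \<lesssim> B" for n
  proof (induction n)
    case 0
    have "{xs \<in> lists A. length xs = 0} \<subseteq> {[]}" by auto
    then show ?case using assms(1) by (meson finite.emptyI finite.insertI finite_lepoll finite_subset)
  next
    case (Suc n)
    have "{xs \<in> lists A. length xs = Suc n} \<subseteq> (\<lambda>(x, xs). x # xs) ` (A \<times> {xs \<in> lists A. length xs = n})"
      by (auto simp: length_Suc_conv image_iff)
    then show ?case
      using Times_lepoll[OF assms(1,2) Suc] by (meson lepoll_trans subset_image_lepoll)
  qed
  have "lists A = (\<Union>n. {xs \<in> lists A. length xs = n})" by auto
  also have "\<dots> \<lesssim> B" using assms(1) len by (intro UN_lepoll nat_lepoll)
  finally show ?thesis .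
qed

lemma finite_subsets_lepoll:
  assumes "infinite B" "A \<lesssim> B"
  shows "{S. S \<subseteq> A \<and> finite S} \<lesssim> B"
proof -
  have "{S. S \<subseteq> A \<and> finite S} \<subseteq> set ` lists A"
  proof
    fix S assume "S \<in> {S. S \<subseteq> A \<and> finite S}"
    moreover obtain xs where "set xs = S" using calculation finite_list by blast
    ultimately show "S \<in> set ` lists A" by auto
  qed
  then show ?thesis using lists_lepoll[OF assms] by (meson lepoll_trans subset_image_lepoll)
qed

lemma Pow_lepoll_mono: assumes "A \<lesssim> B" shows "Pow A \<lesssim> Pow B"
proof -
  obtain f where "inj_on f A" "f ` A \<subseteq> B" using assms unfolding lepoll_def by blast
  then show ?thesis unfolding lepoll_def
    by (intro exI[of _ "image f"]) (auto intro: inj_on_image_Pow)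
qed

text \<open>\<open>g w\<close> depends only on the coordinates \<open>f i w\<close>, so it is
  recovered from the graph of \<open>i \<mapsto> h i (f i w)\<close>. Coding by a set of pairs
  avoids default values outside \<open>I\<close>.\<close>

lemma funs_lepoll:
  assumes "\<And>w w'. w \<in> P \<Longrightarrow> w' \<in> P \<Longrightarrow> (\<And>i. i \<in> I \<Longrightarrow> f i w = f i w') \<Longrightarrow> g w = g w'"
    and "\<And>i w. i \<in> I \<Longrightarrow> w \<in> P \<Longrightarrow> f i w \<in> K i" "\<And>i. i \<in> I \<Longrightarrow> K i \<lesssim> K'"
  shows "g ` P \<lesssim> Pow (I \<times> K')"
proof -
  have "\<exists>h. inj_on h (K i) \<and> h ` K i \<subseteq> K'" if "i \<in> I" for i
    using assms(3)[OF that] unfolding lepoll_def .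
  then obtain h where h: "\<And>i. i \<in> I \<Longrightarrow> inj_on (h i) (K i) \<and> h i ` K i \<subseteq> K'" by metis
  define code where "code = (\<lambda>w. {(i, h i (f i w)) | i. i \<in> I})"
  have "g w = g w'" if "w \<in> P" "w' \<in> P" "code w = code w'" for w w'
  proof (rule assms(1)[OF that(1,2)])
    fix i assume i: "i \<in> I"
    then have "(i, h i (f i w)) \<in> code w'" using that(3) unfolding code_def by auto
    then have "h i (f i w) = h i (f i w')" unfolding code_def by auto
    then show "f i w = f i w'" using h[OF i] assms(2)[OF i] that(1,2) by (meson inj_onD)
  qed
  then have "\<exists>k. \<forall>w\<in>P. k (code w) = g w"
    by (intro exI[of _ "\<lambda>c. g (SOME w. w \<in> P \<and> code w = c)"]) (metis (mono_tags, lifting) someI)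
  then obtain k where "\<forall>w\<in>P. k (code w) = g w" ..
  then have "g ` P \<subseteq> k ` (code ` P)" by force
  moreover have "code ` P \<subseteq> Pow (I \<times> K')" using h assms(2) unfolding code_def by fastforce
  ultimately show ?thesis by (meson lepoll_trans subset_image_lepoll subset_imp_lepoll)
qed

text \<open>The left-hand side has the shape of the node count of a ramification: a level together
  with the coloured levels below it.\<close>

lemma infinite_Pow_times:
  assumes "infinite A" "C \<lesssim> A" shows "A \<times> Pow (A \<times> C) \<lesssim> Pow A"
proof (rule Times_lepoll)
  show "infinite (Pow A)" using assms(1) by simp
  show "A \<lesssim> Pow A" by (rule lepoll_Pow_self)
  show "Pow (A \<times> C) \<lesssim> Pow A" using assms by (intro Pow_lepoll_mono Times_lepoll) auto
qed

section \<open>Ramification\<close>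

lemma well_order_wf: "Well_order r \<Longrightarrow> wf (r - Id)"
  unfolding well_order_on_def by blast

lemma underS_trans:
  "Well_order r \<Longrightarrow> k \<in> underS r j \<Longrightarrow> j \<in> underS r i \<Longrightarrow> k \<in> underS r i"
  unfolding well_order_on_def linear_order_on_def partial_order_on_def preorder_on_def
    antisym_def trans_def underS_def by blast

lemma underS_total:
  "Well_order r \<Longrightarrow> i \<in> Field r \<Longrightarrow> j \<in> Field r \<Longrightarrow> i = j \<or> i \<in> underS r j \<or> j \<in> underS r i"
  unfolding well_order_on_def linear_order_on_def total_on_def underS_def by auto

lemma underS_asym: "Well_order r \<Longrightarrow> i \<in> underS r j \<Longrightarrow> j \<notin> underS r i"
  unfolding well_order_on_def linear_order_on_def partial_order_on_def antisym_def underS_def by auto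

lemma underS_Field': "i \<in> underS r j \<Longrightarrow> i \<in> Field r \<and> j \<in> Field r"
  unfolding underS_def Field_def by auto

definition below :: "'i rel \<Rightarrow> ('i \<Rightarrow> 'x) \<Rightarrow> 'i \<Rightarrow> 'i \<Rightarrow> 'x" where
  "below r p i = (\<lambda>j. if j \<in> underS r i then p j else undefined)"

lemma below_cut: "below r p i = cut p (r - Id) i"
  unfolding below_def cut_def underS_def by auto

text \<open>An element \<open>w\<close> walks down the tree of nodes: at level \<open>i\<close> it sees the point chosen by
  \<open>sel\<close> at the node reached so far and continues according to the colour of that point.  A node
  is determined by the colours alone, so a set larger than the set of nodes contains an element
  that is never stopped.\<close>

lemma ramification:
  fixes r :: "'i rel" and A :: "'w set" and C :: "'c set"
    and sel :: "'i \<Rightarrow> ('i \<Rightarrow> 'x \<times> 'c) \<Rightarrow> 'x" and col :: "'x \<Rightarrow> 'w \<Rightarrow> 'c"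
  assumes wo: "Well_order r"
    and big: "\<not> A \<lesssim> Field r \<times> Pow (Field r \<times> C)"
    and col: "\<And>x w. w \<in> A \<Longrightarrow> col x w \<in> C"
    and uniq: "\<And>i s w w'. i \<in> Field r \<Longrightarrow> w \<in> A \<Longrightarrow> w' \<in> A \<Longrightarrow>
      (\<And>j. j \<in> underS r i \<Longrightarrow> snd (s j) = col (fst (s j)) w \<and> snd (s j) = col (fst (s j)) w') \<Longrightarrow>
      stop i s w \<Longrightarrow> stop i s w' \<Longrightarrow> w = w'"
  shows "\<exists>w\<in>A. \<exists>p. \<forall>i\<in>Field r. fst (p i) = sel i (below r p i) \<and> snd (p i) = col (fst (p i)) w \<and>
    \<not> stop i (below r p i) w"
proof (rule ccontr)
  assume contra: "\<not> ?thesis"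
  define p where "p w = wfrec (r - Id) (\<lambda>s i. (sel i s, col (sel i s) w))" for w
  have p: "p w i = (sel i (below r (p w) i), col (fst (p w i)) w)" for w i
  proof -
    have "p w i = (sel i (below r (p w) i), col (sel i (below r (p w) i)) w)"
      unfolding below_cut by (subst p_def, subst wfrec[OF well_order_wf[OF wo]]) (simp add: p_def)
    then show ?thesis by simp
  qed
  have pfst: "fst (p w i) = sel i (below r (p w) i)" and psnd: "snd (p w i) = col (fst (p w i)) w" for w i
    using arg_cong[OF p, of fst w i] arg_cong[OF p, of snd w i] by (simp_all only: fst_conv snd_conv)
  have "\<exists>i\<in>Field r. stop i (below r (p w) i) w" if "w \<in> A" for w
    using contra that pfst[of w] psnd[of w] by blast
  then obtain lev where lev: "\<And>w. w \<in> A \<Longrightarrow> lev w \<in> Field r \<and> stop (lev w) (below r (p w) (lev w)) w"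
    by metis
  define code where "code w = (lev w, {(j, snd (p w j)) | j. j \<in> underS r (lev w)})" for w
  have "inj_on code A"
  proof (rule inj_onI)
    fix w w' assume w: "w \<in> A" "w' \<in> A" "code w = code w'"
    have l: "lev w = lev w'" using w(3) unfolding code_def by simp
    have c: "snd (p w j) = snd (p w' j)" if "j \<in> underS r (lev w)" for j
    proof -
      have "(j, snd (p w j)) \<in> snd (code w')" using w(3) that unfolding code_def by auto
      then show ?thesis unfolding code_def by auto
    qed
    \<comment> \<open>By induction the colours determine the path, because the point at level
      \<open>j\<close> is \<open>sel\<close> of the path below \<open>j\<close>.\<close>
    have eq: "j \<in> underS r (lev w) \<longrightarrow> p w j = p w' j" for j
    proof (induction j rule: wf_induct_rule[OF well_order_wf[OF wo]])
      case (1 j)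
      have "below r (p w) j = below r (p w') j" if j: "j \<in> underS r (lev w)"
        using 1 j underS_trans[OF wo _ j] by (auto simp: below_def underS_def)
      then show ?case using c[of j] pfst[of w j] pfst[of w' j] by (simp add: prod_eq_iff)
    qed
    have s: "below r (p w') (lev w) = below r (p w) (lev w)"
      unfolding below_def using eq by auto
    show "w = w'"
    proof (rule uniq)
      show "lev w \<in> Field r" "stop (lev w) (below r (p w) (lev w)) w" using lev w by auto
      show "stop (lev w) (below r (p w) (lev w)) w'" using lev[OF w(2)] l s by auto
      fix j assume j: "j \<in> underS r (lev w)"
      then show "snd (below r (p w) (lev w) j) = col (fst (below r (p w) (lev w) j)) w \<and>
          snd (below r (p w) (lev w) j) = col (fst (below r (p w) (lev w) j)) w'"
        using eq psnd[of w j] psnd[of w' j] unfolding below_def by simp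
    qed (use w in auto)
  qed
  moreover have "code ` A \<subseteq> Field r \<times> Pow (Field r \<times> C)"
  proof
    fix z assume "z \<in> code ` A"
    then obtain w where w: "w \<in> A" "z = code w" by blast
    have "snd (p w j) \<in> C" for j using psnd[of w j] col[OF w(1)] by simp
    then show "z \<in> Field r \<times> Pow (Field r \<times> C)"
      using lev[OF w(1)] w(2) underS_Field'[of _ r "lev w"] unfolding code_def by auto
  qed
  ultimately show False using big unfolding lepoll_def by blast
qed

text \<open>Erdos-Rado argument: an element stops when it is the chosen element of its class. The
  survivor \<open>w\<close> acts as a common end point, and every choice imitates the colours of
  \<open>w\<close> over the earlier ones, so the colour of a pair depends on its smaller index
  only.\<close>

lemma end_homogeneous:
  assumes wo: "Well_order r" and big: "\<not> A \<lesssim> Field r \<times> Pow (Field r \<times> C)"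
    and f: "\<And>x y. y \<in> A \<Longrightarrow> f x y \<in> C"
  shows "\<exists>x g. (\<forall>i\<in>Field r. x i \<in> A \<and> g i \<in> C) \<and>
    (\<forall>j\<in>Field r. \<forall>i\<in>underS r j. x i \<noteq> x j \<and> f (x i) (x j) = g i)"
proof -
  define cl where "cl i s = {a\<in>A. \<forall>j\<in>underS r i. a \<noteq> fst (s j) \<and> snd (s j) = f (fst (s j)) a}" for i s
  define sel where "sel i s = (SOME a. a \<in> cl i s)" for i s
  obtain w p where w: "w \<in> A" and p: "\<And>i. i \<in> Field r \<Longrightarrow>
      fst (p i) = sel i (below r p i) \<and> snd (p i) = f (fst (p i)) w \<and> \<not> (w = sel i (below r p i))"
    using ramification[OF wo big, of f "\<lambda>i s w. w = sel i s" sel] f by blast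
  have pfst: "fst (p i) = sel i (below r p i)" and psnd: "snd (p i) = f (fst (p i)) w"
    and pne: "w \<noteq> fst (p i)" if "i \<in> Field r" for i
    using p[OF that] by auto
  have cl: "w \<in> cl i (below r p i)" if "i \<in> Field r" for i
    unfolding cl_def using w psnd pne underS_Field'[of _ r i] by (auto simp: below_def)
  have sel: "fst (p i) \<in> cl i (below r p i)" if "i \<in> Field r" for i
    using someI[of "\<lambda>a. a \<in> cl i (below r p i)", OF cl[OF that]] unfolding pfst[OF that] sel_def .
  show ?thesis
  proof (intro exI conjI ballI)
    fix i assume i: "i \<in> Field r"
    show "fst (p i) \<in> A" using sel[OF i] unfolding cl_def by blast
    show "snd (p i) \<in> C" using psnd[OF i] f[OF w] by simp
  next
    fix j i assume ij: "j \<in> Field r" "i \<in> underS r j"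
    have "fst (p j) \<noteq> fst (below r p j i) \<and> snd (below r p j i) = f (fst (below r p j i)) (fst (p j))"
      using sel[OF ij(1)] ij(2) unfolding cl_def by blast
    then show "fst (p i) \<noteq> fst (p j)" "f (fst (p i)) (fst (p j)) = snd (p i)"
      using ij(2) by (auto simp: below_def)
  qed
qed

text \<open>Here an element stops when its class is a singleton. Otherwise two members of the class
  differ at some point \<open>y i\<close>; \<open>W i\<close> is taken from the side opposite to the
  survivor, while all later members side with the survivor.\<close>

lemma one_sided_sequence:
  fixes r :: "'i rel" and \<F> :: "'a set set"
  assumes wo: "Well_order r" and big: "\<not> \<F> \<lesssim> Field r \<times> Pow (Field r \<times> (UNIV :: bool set))"
  shows "\<exists>y W. (\<forall>i\<in>Field r. W i \<in> \<F> \<and> y i \<in> \<Union>\<F>) \<and>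
    (\<forall>j\<in>Field r. \<forall>i\<in>underS r j. (y i \<in> W i) \<noteq> (y i \<in> W j))"
proof -
  define cl where "cl i s = {W\<in>\<F>. \<forall>j\<in>underS r i. snd (s j) = (fst (s j) \<in> W)}"
    for i :: 'i and s :: "'i \<Rightarrow> 'a \<times> bool"
  define sel where "sel i s = (SOME y. \<exists>U\<in>cl i s. \<exists>V\<in>cl i s. y \<in> U \<and> y \<notin> V)" for i s
  obtain W p where W: "W \<in> \<F>" and p: "\<And>i. i \<in> Field r \<Longrightarrow>
      fst (p i) = sel i (below r p i) \<and> snd (p i) = (fst (p i) \<in> W) \<and> \<not> (cl i (below r p i) \<subseteq> {W})"
  proof -
    have "\<exists>W\<in>\<F>. \<exists>p. \<forall>i\<in>Field r. fst (p i) = sel i (below r p i) \<and> snd (p i) = (fst (p i) \<in> W) \<and>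
      \<not> (cl i (below r p i) \<subseteq> {W})"
    proof (rule ramification[OF wo big])
      fix i :: 'i and s :: "'i \<Rightarrow> 'a \<times> bool" and W W'
      assume "W \<in> \<F>" "W' \<in> \<F>" "cl i s \<subseteq> {W}" "cl i s \<subseteq> {W'}"
        "\<And>j. j \<in> underS r i \<Longrightarrow> snd (s j) = (fst (s j) \<in> W) \<and> snd (s j) = (fst (s j) \<in> W')"
      moreover from this have "W \<in> cl i s" unfolding cl_def by simp
      ultimately show "W = W'" by blast
    qed simp
    then show ?thesis using that by blast
  qed
  have pfst: "fst (p i) = sel i (below r p i)" and psnd: "snd (p i) = (fst (p i) \<in> W)" if "i \<in> Field r" for i
    using p[OF that] by auto
  have cl: "W \<in> cl i (below r p i)" if "i \<in> Field r" for i
    unfolding cl_def using W psnd underS_Field'[of _ r i] by (auto simp: below_def)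
  have "\<exists>V\<in>cl i (below r p i). (fst (p i) \<in> V) \<noteq> (fst (p i) \<in> W) \<and> fst (p i) \<in> \<Union>\<F>" if i: "i \<in> Field r" for i
  proof -
    obtain W' where "W' \<in> cl i (below r p i)" "W' \<noteq> W" using p[OF i] by blast
    then have "\<exists>y. \<exists>U\<in>cl i (below r p i). \<exists>V\<in>cl i (below r p i). y \<in> U \<and> y \<notin> V"
      using cl[OF i] by blast
    from someI_ex[OF this] have "\<exists>U\<in>cl i (below r p i). \<exists>V\<in>cl i (below r p i). fst (p i) \<in> U \<and> fst (p i) \<notin> V"
      unfolding pfst[OF i] sel_def .
    then show ?thesis unfolding cl_def by blast
  qed
  then obtain V where V: "\<And>i. i \<in> Field r \<Longrightarrow> V i \<in> cl i (below r p i) \<and>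
      (fst (p i) \<in> V i) \<noteq> (fst (p i) \<in> W) \<and> fst (p i) \<in> \<Union>\<F>"
    by metis
  show ?thesis
  proof (intro exI conjI ballI)
    fix i assume i: "i \<in> Field r"
    show "V i \<in> \<F>" "fst (p i) \<in> \<Union>\<F>" using V[OF i] unfolding cl_def by blast+
  next
    fix j i assume ij: "j \<in> Field r" "i \<in> underS r j"
    have "snd (below r p j i) = (fst (below r p j i) \<in> V j)"
      using V[OF ij(1)] ij(2) unfolding cl_def by blast
    then have "snd (p i) = (fst (p i) \<in> V j)" using ij(2) by (simp add: below_def)
    then show "(fst (p i) \<in> V i) \<noteq> (fst (p i) \<in> V j)"
      using V[of i] psnd[of i] underS_Field'[OF ij(2)] by auto
  qed
qed

section \<open>Order-preserving maps into initial well-orders\<close>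

lemma mono_embedding:
  assumes "w \<le>o r"
  shows "\<exists>e. (\<forall>j\<in>Field w. e j \<in> Field r) \<and> (\<forall>j\<in>Field w. \<forall>i\<in>underS w j. e i \<in> underS r (e j))"
proof -
  obtain e where e: "Well_order w" "Well_order r" "embed w r e"
    using assms unfolding ordLeq_def by blast
  have "e ` Field w \<subseteq> Field r" by (rule embed_Field[OF e(3)])
  moreover have "e i \<in> underS r (e j)" if "j \<in> Field w" "i \<in> underS w j" for i j
    using embed_underS[OF e(1,3) that(1)] that(2) unfolding bij_betw_def by blast
  ultimately show ?thesis by (intro exI[of _ e]) auto
qed

text \<open>Any well-order of \<open>H\<close> is at least as long as the initial well-order of its
  cardinality, so thinning to a set of full size keeps a copy of the index order.\<close>

lemma card_mono_into:
  assumes r: "Card_order r" and R: "Well_order R" and H: "H \<subseteq> Field R" "Field r \<lesssim> H"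
  shows "\<exists>e. (\<forall>j\<in>Field r. e j \<in> H) \<and> (\<forall>j\<in>Field r. \<forall>i\<in>underS r j. e i \<in> underS R (e j))"
proof -
  have HR: "well_order_on H (Restr R H)" by (rule well_order_on_Restr[OF R H(1)])
  have "r \<le>o |Field r|" using r by (simp add: Card_order_iff_ordLeq_card_of)
  also have "|Field r| \<le>o |H|" using H(2) by (simp add: lepoll_iff_ordLeq)
  also have "|H| \<le>o Restr R H" by (rule card_of_least[OF HR])
  finally have "r \<le>o Restr R H" .
  from mono_embedding[OF this] obtain e where
    e: "\<forall>j\<in>Field r. e j \<in> Field (Restr R H)" "\<forall>j\<in>Field r. \<forall>i\<in>underS r j. e i \<in> underS (Restr R H) (e j)"
    by blast
  have "Field (Restr R H) = H" using well_order_on_Field[OF HR] by simp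
  with e show ?thesis by (intro exI[of _ e]) (auto simp: underS_def)
qed

lemma mono_into_card:
  assumes r: "Card_order r" and w: "Well_order w" and less: "Field w \<prec> Field r"
  shows "\<exists>e. (\<forall>j\<in>Field w. e j \<in> Field r) \<and> (\<forall>j\<in>Field w. \<forall>i\<in>underS w j. e i \<in> underS r (e j))"
proof (rule mono_embedding, rule ccontr)
  assume "\<not> w \<le>o r"
  moreover have wr: "Well_order r" using r unfolding card_order_on_def by simp
  ultimately have "r \<le>o w" using w ordLeq_total by blast
  then have "Field r \<lesssim> Field w" unfolding lepoll_iff_ordLeq by (rule card_of_mono2)
  then show False using less by (meson lesspoll_trans1 lesspoll_not_refl)
qed

lemma finite_UN_lesspoll:
  assumes "finite I" "infinite B" "\<And>i. i \<in> I \<Longrightarrow> A i \<prec> B"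
  shows "(\<Union>i\<in>I. A i) \<prec> B"
  using assms(1,3)
proof (induction I rule: finite_induct)
  case empty
  then show ?case using assms(2) by (simp add: finite_lesspoll_infinite)
next
  case (insert i I)
  let ?C = "\<Union>i\<in>I. A i"
  have AC: "A i \<prec> B" "?C \<prec> B" using insert by auto
  show ?case
  proof (cases "finite (A i) \<and> finite ?C")
    case True
    then show ?thesis using assms(2) by (simp add: finite_lesspoll_infinite)
  next
    case False
    have "A i \<lesssim> ?C \<or> ?C \<lesssim> A i" using lepoll_cases lesspoll_imp_lepoll by blast
    then have "A i \<union> ?C \<lesssim> ?C \<or> A i \<union> ?C \<lesssim> A i"
      using False Un_lepoll[of ?C "A i" ?C] Un_lepoll[of "A i" "A i" ?C]
      by (metis finite_lepoll_infinite lepoll_refl)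
    then show ?thesis using AC by (metis UN_insert lesspoll_trans1)
  qed
qed

lemma finite_colour_class:
  fixes c :: "'i \<Rightarrow> 'c::finite"
  assumes "infinite A" shows "\<exists>v. A \<lesssim> {i\<in>A. c i = v}"
proof (rule ccontr)
  assume "\<not> ?thesis"
  then have "(\<Union>v\<in>UNIV. {i\<in>A. c i = v}) \<prec> A"
    using assms by (intro finite_UN_lesspoll) (auto simp: not_lepoll_iff)
  moreover have "(\<Union>v\<in>UNIV. {i\<in>A. c i = v}) = A" by auto
  ultimately show False by (simp add: lesspoll_not_refl)
qed

section \<open>Patterns of points and sets\<close>

text \<open>One exponential is spent on a one-sided sequence of length \<open>2^(2^r)\<close>. From
  so many indices an end-homogeneous sequence of length \<open>r\<close> can be drawn, which makes
  both relations between two indices depend on the earlier one; a finite colour class of full size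
  removes this dependence.\<close>

lemma raw_pattern:
  fixes r :: "'i rel" and \<F> :: "'a set set"
  assumes r: "Card_order r" and inf: "infinite (Field r)" and big: "\<not> \<F> \<lesssim> Pow (Pow (Pow (Field r)))"
  shows "\<exists>y W d b1 b2. (\<forall>i\<in>Field r. W i \<in> \<F> \<and> y i \<in> \<Union>\<F>) \<and> \<not> (d = b1 \<and> b1 = b2) \<and>
    (\<forall>i\<in>Field r. \<forall>j\<in>Field r. y i \<in> W j \<longleftrightarrow> (if i = j then d else if i \<in> underS r j then b1 else b2))"
proof -
  define r2 where "r2 = |Pow (Pow (Field r))|"
  have F2: "Field r2 = Pow (Pow (Field r))" and w2: "Well_order r2"
    unfolding r2_def by (simp add: Field_card_of) (rule card_of_Well_order)
  have wr: "Well_order r" using r unfolding card_order_on_def by simp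
  have "infinite (Field r2)" unfolding F2 using inf by simp
  then have "Field r2 \<times> Pow (Field r2 \<times> (UNIV :: bool set)) \<lesssim> Pow (Pow (Pow (Field r)))"
    using infinite_Pow_times[of "Field r2" "UNIV :: bool set"] unfolding F2 by (simp add: finite_lepoll)
  then have "\<not> \<F> \<lesssim> Field r2 \<times> Pow (Field r2 \<times> (UNIV :: bool set))" using big lepoll_trans by blast
  from one_sided_sequence[OF w2 this] obtain y W where
    yW: "\<forall>i\<in>Field r2. W i \<in> \<F> \<and> y i \<in> \<Union>\<F>"
    and os: "\<forall>j\<in>Field r2. \<forall>i\<in>underS r2 j. (y i \<in> W i) \<noteq> (y i \<in> W j)" by blast
  have "Field r \<times> Pow (Field r \<times> (UNIV :: (bool \<times> bool) set)) \<lesssim> Pow (Field r)"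
    using inf by (intro infinite_Pow_times) (simp_all add: finite_lepoll)
  then have "\<not> Field r2 \<lesssim> Field r \<times> Pow (Field r \<times> (UNIV :: (bool \<times> bool) set))"
    unfolding F2 by (meson lesspoll_Pow_self lepoll_trans not_lepoll_iff)
  from end_homogeneous[OF wr this, of "\<lambda>a b. (y a \<in> W b, y b \<in> W a)"] obtain x g where
    x: "\<forall>i\<in>Field r. x i \<in> Field r2" and
    g: "\<forall>j\<in>Field r. \<forall>i\<in>underS r j. x i \<noteq> x j \<and> (y (x i) \<in> W (x j), y (x j) \<in> W (x i)) = g i"
    by blast
  obtain v where v: "Field r \<lesssim> {i\<in>Field r. (g i, y (x i) \<in> W (x i)) = v}"
    using finite_colour_class[OF inf, of "\<lambda>i. (g i, y (x i) \<in> W (x i))"] by blast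
  obtain b1 b2 d where [simp]: "v = ((b1, b2), d)" by (metis prod.exhaust)
  obtain e where e: "\<forall>j\<in>Field r. e j \<in> {i\<in>Field r. (g i, y (x i) \<in> W (x i)) = v}"
    and e': "\<forall>j\<in>Field r. \<forall>i\<in>underS r j. e i \<in> underS r (e j)"
    using card_mono_into[OF r wr _ v] by blast
  have lt: "y (x (e i)) \<in> W (x (e j)) \<longleftrightarrow> b1" "y (x (e j)) \<in> W (x (e i)) \<longleftrightarrow> b2" "x (e i) \<noteq> x (e j)"
    if "i \<in> underS r j" for i j
  proof -
    have ij: "i \<in> Field r" "j \<in> Field r" using underS_Field'[OF that] by auto
    then have "e i \<in> underS r (e j)" "g (e i) = (b1, b2)" "e j \<in> Field r" using e e' that by auto
    then show "y (x (e i)) \<in> W (x (e j)) \<longleftrightarrow> b1" "y (x (e j)) \<in> W (x (e i)) \<longleftrightarrow> b2" "x (e i) \<noteq> x (e j)"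
      using g by (metis prod.inject)+
  qed
  have eq: "y (x (e i)) \<in> W (x (e i)) \<longleftrightarrow> d" if "i \<in> Field r" for i using e that by auto
  \<comment> \<open>The sequence \<open>x\<close> need not be increasing for \<open>r2\<close>, so
    the one-sided condition only excludes that all three truth values agree.\<close>
  have "\<not> (d = b1 \<and> b1 = b2)"
  proof
    assume d: "d = b1 \<and> b1 = b2"
    obtain i where "i \<in> Field r" using inf by fastforce
    then obtain j where "j \<in> Field r" "i \<noteq> j" "(i, j) \<in> r"
      using infinite_Card_order_limit[OF r inf] by blast
    then have ij: "i \<in> underS r j" "j \<in> Field r" unfolding underS_def by auto
    have "x (e i) \<in> Field r2" "x (e j) \<in> Field r2" using x e \<open>i \<in> Field r\<close> ij by auto
    then have "x (e i) \<in> underS r2 (x (e j)) \<or> x (e j) \<in> underS r2 (x (e i))"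
      using underS_total[OF w2] lt(3)[OF ij(1)] by blast
    then show False
      using os d lt[OF ij(1)] eq[OF \<open>i \<in> Field r\<close>] eq[OF ij(2)] \<open>x (e i) \<in> Field r2\<close> \<open>x (e j) \<in> Field r2\<close> by blast
  qed
  moreover have "y (x (e i)) \<in> W (x (e j)) \<longleftrightarrow> (if i = j then d else if i \<in> underS r j then b1 else b2)"
    if "i \<in> Field r" "j \<in> Field r" for i j
    using underS_total[OF wr that] underS_asym[OF wr] lt eq that by auto
  moreover have "W (x (e i)) \<in> \<F> \<and> y (x (e i)) \<in> \<Union>\<F>" if "i \<in> Field r" for i
    using yW x e that by blast
  ultimately show ?thesis
    by (intro exI[of _ "\<lambda>i. y (x (e i))"] exI[of _ "\<lambda>i. W (x (e i))"] exI[of _ d] exI[of _ b1] exI[of _ b2]) blast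
qed

text \<open>An infinite cardinal is a limit ordinal. Shifting one index by \<open>s\<close> will
  turn a non-strict pattern into a strict one.\<close>

lemma card_order_succ:
  assumes r: "Card_order r" and inf: "infinite (Field r)"
  shows "\<exists>s. \<forall>i\<in>Field r. s i \<in> Field r \<and> i \<in> underS r (s i) \<and>
    (\<forall>j\<in>Field r. i \<in> underS r j \<longleftrightarrow> j = s i \<or> s i \<in> underS r j)"
proof -
  have wr: "Well_order r" using r unfolding card_order_on_def by simp
  have "\<exists>k\<in>Field r. i \<in> underS r k \<and> (\<forall>j\<in>Field r. i \<in> underS r j \<longrightarrow> j \<notin> underS r k)" if i: "i \<in> Field r" for i
  proof -
    obtain b where "b \<in> {j\<in>Field r. i \<in> underS r j}"
      using infinite_Card_order_limit[OF r inf i] unfolding underS_def by auto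
    from wfE_min[OF well_order_wf[OF wr] this] obtain k where "k \<in> {j\<in>Field r. i \<in> underS r j}"
      "\<And>j. (j, k) \<in> r - Id \<Longrightarrow> j \<notin> {j\<in>Field r. i \<in> underS r j}" by blast
    then show ?thesis by (intro bexI[of _ k]) (auto simp: underS_def)
  qed
  then obtain s where s: "\<And>i. i \<in> Field r \<Longrightarrow> s i \<in> Field r \<and> i \<in> underS r (s i) \<and>
    (\<forall>j\<in>Field r. i \<in> underS r j \<longrightarrow> j \<notin> underS r (s i))" by metis
  have "i \<in> underS r j \<longleftrightarrow> j = s i \<or> s i \<in> underS r j" if "i \<in> Field r" "j \<in> Field r" for i j
    using s[OF that(1)] underS_total[OF wr that(2), of "s i"] underS_trans[OF wr, of i "s i" j] that by blast
  then show ?thesis using s by blast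
qed

text \<open>With \<open>i\<close> the index of a point and \<open>j\<close> that of a set, the flags
  encode the linear patterns: \<open>b1\<close> alone gives initial segments, \<open>b2\<close>
  alone final segments, both together complements of points.\<close>

definition pr :: "'i rel \<Rightarrow> bool \<Rightarrow> bool \<Rightarrow> 'i \<Rightarrow> 'i \<Rightarrow> bool" where
  "pr r b1 b2 i j \<longleftrightarrow> i \<noteq> j \<and> (if i \<in> underS r j then b1 else b2)"

definition traces :: "'a set set \<Rightarrow> 'a set \<Rightarrow> 'a set set" where
  "traces P X = (\<lambda>W. W \<inter> X) ` P"

text \<open>If the diagonal value \<open>d\<close> is true, shifting the sets or the points by one
  index makes it false. Only the pattern of singletons, with both flags false, resists and is kept
  as an alternative.\<close>

lemma strict_pattern:
  assumes r: "Card_order r" and inf: "infinite (Field r)" and big: "\<not> \<F> \<lesssim> Pow (Pow (Pow (Field r)))"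
  shows "\<exists>y W. (\<forall>i\<in>Field r. W i \<in> \<F> \<and> y i \<in> \<Union>\<F>) \<and>
    ((\<forall>i\<in>Field r. \<forall>j\<in>Field r. y i \<in> W j \<longleftrightarrow> i = j) \<or>
     (\<exists>b1 b2. (b1 \<or> b2) \<and> (\<forall>i\<in>Field r. \<forall>j\<in>Field r. y i \<in> W j \<longleftrightarrow> pr r b1 b2 i j)))"
proof -
  have wr: "Well_order r" using r unfolding card_order_on_def by simp
  obtain s where s: "\<And>i. i \<in> Field r \<Longrightarrow> s i \<in> Field r \<and> i \<in> underS r (s i) \<and>
    (\<forall>j\<in>Field r. i \<in> underS r j \<longleftrightarrow> j = s i \<or> s i \<in> underS r j)"
    using card_order_succ[OF r inf] by metis
  obtain y W d b1 b2 where yW: "\<forall>i\<in>Field r. W i \<in> \<F> \<and> y i \<in> \<Union>\<F>" and d: "\<not> (d = b1 \<and> b1 = b2)"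
    and pat: "\<forall>i\<in>Field r. \<forall>j\<in>Field r. y i \<in> W j \<longleftrightarrow> (if i = j then d else if i \<in> underS r j then b1 else b2)"
    using raw_pattern[OF assms] by blast
  consider "\<not> d" | "d" "\<not> b1" "\<not> b2" | "d" "\<not> b1" "b2" | "d" "b1" "\<not> b2" using d by blast
  then show ?thesis
  proof cases
    case 1
    then have "(b1 \<or> b2) \<and> (\<forall>i\<in>Field r. \<forall>j\<in>Field r. y i \<in> W j \<longleftrightarrow> pr r b1 b2 i j)"
      using d pat by (auto simp: pr_def)
    then show ?thesis using yW by blast
  next
    case 2
    then have "\<forall>i\<in>Field r. \<forall>j\<in>Field r. y i \<in> W j \<longleftrightarrow> i = j" using pat by auto
    then show ?thesis using yW by blast
  next
    case 3
    have "y i \<in> W (s j) \<longleftrightarrow> pr r False True i j" if "i \<in> Field r" "j \<in> Field r" for i j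
    proof -
      have "y i \<in> W (s j) \<longleftrightarrow> i \<notin> underS r (s j)" using pat s[OF that(2)] that 3 by (auto simp: underS_def)
      also have "\<dots> \<longleftrightarrow> i = s j \<or> s j \<in> underS r i"
        using underS_total[OF wr that(1), of "s j"] conjunct1[OF s[OF that(2)]]
          underS_asym[OF wr, of i "s j"] underS_notIn[of "s j" r] by auto
      also have "\<dots> \<longleftrightarrow> j \<in> underS r i" using s[OF that(2)] that(1) by simp
      also have "\<dots> \<longleftrightarrow> pr r False True i j"
        using underS_total[OF wr that] underS_asym[OF wr, of i j] underS_notIn[of i r] unfolding pr_def by auto
      finally show ?thesis .
    qed
    then have p: "\<forall>i\<in>Field r. \<forall>j\<in>Field r. y i \<in> W (s j) \<longleftrightarrow> pr r False True i j" by blast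
    have "\<forall>i\<in>Field r. W (s i) \<in> \<F> \<and> y i \<in> \<Union>\<F>" using yW s by blast
    then show ?thesis
      by (rule_tac x = y in exI, rule_tac x = "\<lambda>j. W (s j)" in exI, rule_tac conjI, assumption,
          rule_tac disjI2, rule_tac x = False in exI, rule_tac x = True in exI) (simp add: p)
  next
    case 4
    have "y (s i) \<in> W j \<longleftrightarrow> pr r True False i j" if "i \<in> Field r" "j \<in> Field r" for i j
    proof -
      have "y (s i) \<in> W j \<longleftrightarrow> j = s i \<or> s i \<in> underS r j" using pat s[OF that(1)] that 4 by auto
      also have "\<dots> \<longleftrightarrow> i \<in> underS r j" using s[OF that(1)] that(2) by blast
      also have "\<dots> \<longleftrightarrow> pr r True False i j" by (auto simp: pr_def underS_def)
      finally show ?thesis .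
    qed
    then have p: "\<forall>i\<in>Field r. \<forall>j\<in>Field r. y (s i) \<in> W j \<longleftrightarrow> pr r True False i j" by blast
    have "\<forall>i\<in>Field r. W i \<in> \<F> \<and> y (s i) \<in> \<Union>\<F>" using yW s by blast
    then show ?thesis
      by (rule_tac x = "\<lambda>i. y (s i)" in exI, rule_tac x = W in exI, rule_tac conjI, assumption,
          rule_tac disjI2, rule_tac x = True in exI, rule_tac x = False in exI) (simp add: p)
  qed
qed

text \<open>Unions of the singleton pattern over initial segments are again initial segments, hence
  the sets \<open>M i\<close> are unions of members of \<open>P\<close>. These unions are nonempty
  so that \<open>M i\<close> inherits lower bounds common to all members of
  \<open>P\<close>.\<close>

lemma pattern:
  assumes r: "Card_order r" and inf: "infinite (Field r)"
    and big: "\<not> traces P X \<lesssim> Pow (Pow (Pow (Field r)))"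
  shows "\<exists>y M b1 b2. (b1 \<or> b2) \<and> (\<forall>i\<in>Field r. y i \<in> X \<and> (\<exists>Q\<subseteq>P. Q \<noteq> {} \<and> M i = \<Union>Q)) \<and>
    (\<forall>i\<in>Field r. \<forall>j\<in>Field r. y i \<in> M j \<longleftrightarrow> pr r b1 b2 i j)"
proof -
  have wr: "Well_order r" using r unfolding card_order_on_def by simp
  obtain y W where yW: "\<forall>i\<in>Field r. W i \<in> traces P X \<and> y i \<in> \<Union>(traces P X)" and
    alt: "(\<forall>i\<in>Field r. \<forall>j\<in>Field r. y i \<in> W j \<longleftrightarrow> i = j) \<or>
     (\<exists>b1 b2. (b1 \<or> b2) \<and> (\<forall>i\<in>Field r. \<forall>j\<in>Field r. y i \<in> W j \<longleftrightarrow> pr r b1 b2 i j))"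
    using strict_pattern[OF assms] by (elim exE conjE) (rule that, assumption+)
  from yW have "\<forall>i\<in>Field r. \<exists>V\<in>P. W i = V \<inter> X" unfolding traces_def by blast
  then obtain V where V: "\<And>i. i \<in> Field r \<Longrightarrow> V i \<in> P \<and> W i = V i \<inter> X" by metis
  have yX: "y i \<in> X" if "i \<in> Field r" for i using yW that unfolding traces_def by auto
  from alt show ?thesis
  proof
    assume "\<exists>b1 b2. (b1 \<or> b2) \<and> (\<forall>i\<in>Field r. \<forall>j\<in>Field r. y i \<in> W j \<longleftrightarrow> pr r b1 b2 i j)"
    then obtain b1 b2 where b: "b1 \<or> b2" "\<And>i j. i\<in>Field r \<Longrightarrow> j\<in>Field r \<Longrightarrow> y i \<in> W j \<longleftrightarrow> pr r b1 b2 i j"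
      by blast
    show ?thesis
    proof (intro exI conjI ballI)
      show "b1 \<or> b2" by fact
      fix i assume i: "i \<in> Field r"
      show "y i \<in> X" using yX i .
      show "{V i} \<subseteq> P" "{V i} \<noteq> {}" "V i = \<Union>{V i}" using V i by auto
      fix j assume j: "j \<in> Field r"
      show "y i \<in> V j \<longleftrightarrow> pr r b1 b2 i j" using b(2)[OF i j] V[OF j] yX[OF i] by blast
    qed
  next
    assume d: "\<forall>i\<in>Field r. \<forall>j\<in>Field r. y i \<in> W j \<longleftrightarrow> i = j"
    obtain s where s: "\<And>i. i \<in> Field r \<Longrightarrow> s i \<in> Field r \<and> i \<in> underS r (s i) \<and>
      (\<forall>j\<in>Field r. i \<in> underS r j \<longleftrightarrow> j = s i \<or> s i \<in> underS r j)"
      using card_order_succ[OF r inf] by metis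
    \<comment> \<open>Including \<open>j\<close> itself keeps the union nonempty for the least
      index; the points are shifted by \<open>s\<close> to compensate.\<close>
    define Q where "Q j = V ` ({j} \<union> underS r j)" for j
    show ?thesis
    proof (intro exI conjI ballI)
      show "True \<or> False" by simp
      fix i assume i: "i \<in> Field r"
      show "y (s i) \<in> X" using yX s i by blast
      show "Q i \<subseteq> P" using V i underS_Field'[of _ r i] unfolding Q_def by blast
      show "Q i \<noteq> {}" "\<Union>(Q i) = \<Union>(Q i)" unfolding Q_def by auto
      fix j assume j: "j \<in> Field r"
      have "y (s i) \<in> \<Union>(Q j) \<longleftrightarrow> s i \<in> {j} \<union> underS r j"
      proof -
        have "y (s i) \<in> V k \<longleftrightarrow> s i = k" if "k \<in> {j} \<union> underS r j" for k
        proof -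
          have k: "k \<in> Field r" using that j underS_Field'[of k r j] by auto
          have si: "s i \<in> Field r" using s[OF i] by simp
          show ?thesis using d si k V[OF k] yX[OF si] by auto
        qed
        then show ?thesis unfolding Q_def by auto
      qed
      also have "\<dots> \<longleftrightarrow> i \<in> underS r j" using s[OF i] j by auto
      also have "\<dots> \<longleftrightarrow> pr r True False i j" by (auto simp: pr_def underS_def)
      finally show "y (s i) \<in> \<Union>(Q j) \<longleftrightarrow> pr r True False i j" .
    qed
  qed
qed

section \<open>Split sequences, irreducible sets and chains of filters\<close>

text \<open>For a base this is the topology. It is defined for arbitrary families because
  subfamilies of a base occur later as bases of coarser topologies.\<close>

definition gen :: "'a set set \<Rightarrow> 'a set set" where
  "gen B = {\<Union>C | C. C \<subseteq> B}"

lemma gen_base: "V \<in> B \<Longrightarrow> V \<in> gen B"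
  unfolding gen_def by (auto intro: exI[of _ "{V}"])

lemma gen_sub: "C \<subseteq> B \<Longrightarrow> \<Union>C \<in> gen B"
  unfolding gen_def by blast

lemma gen_E: "W \<in> gen B \<Longrightarrow> x \<in> W \<Longrightarrow> \<exists>V\<in>B. x \<in> V \<and> V \<subseteq> W"
  unfolding gen_def by blast

lemma gen_iff: "W \<in> gen B \<longleftrightarrow> (\<forall>x\<in>W. \<exists>V\<in>B. x \<in> V \<and> V \<subseteq> W)"
proof
  assume "\<forall>x\<in>W. \<exists>V\<in>B. x \<in> V \<and> V \<subseteq> W"
  then have "W = \<Union>{V\<in>B. V \<subseteq> W}" by blast
  then show "W \<in> gen B" using gen_sub[of "{V\<in>B. V \<subseteq> W}" B] by simp
qed (intro ballI, rule gen_E)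

lemma gen_Union: "\<W> \<subseteq> gen B \<Longrightarrow> \<Union>\<W> \<in> gen B"
  unfolding gen_iff[of "\<Union>\<W>"]
proof
  fix x assume "\<W> \<subseteq> gen B" "x \<in> \<Union>\<W>"
  then obtain W where W: "W \<in> \<W>" "W \<in> gen B" "x \<in> W" by blast
  from gen_E[OF W(2,3)] show "\<exists>V\<in>B. x \<in> V \<and> V \<subseteq> \<Union>\<W>" using W(1) by blast
qed

lemma gen_UN: "(\<And>i. i \<in> I \<Longrightarrow> W i \<in> gen B) \<Longrightarrow> (\<Union>i\<in>I. W i) \<in> gen B"
  by (rule gen_Union) blast

lemma gen_Un: "U \<in> gen B \<Longrightarrow> V \<in> gen B \<Longrightarrow> U \<union> V \<in> gen B"
  using gen_Union[of "{U, V}" B] by simp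

text \<open>For finite \<open>G\<close> and \<open>H\<close> these are the basic open sets of
  \<open>K\<close> inside the power set of \<open>B\<close> with the product topology.\<close>

definition cyl :: "'a set set set \<Rightarrow> 'a set set \<Rightarrow> 'a set set \<Rightarrow> 'a set set set" where
  "cyl K G H = {F\<in>K. G \<subseteq> F \<and> H \<inter> F = {}}"

locale base_space =
  fixes B :: "'a set set" and Z :: "'a set"
  assumes B_Int: "\<And>U V. U \<in> B \<Longrightarrow> V \<in> B \<Longrightarrow> U \<inter> V \<in> B"
begin

lemma gen_Int: assumes "U \<in> gen B" "V \<in> gen B" shows "U \<inter> V \<in> gen B"
  unfolding gen_iff
proof
  fix x assume "x \<in> U \<inter> V"
  then have "x \<in> U" "x \<in> V" by auto
  from gen_E[OF assms(1) this(1)] gen_E[OF assms(2) this(2)]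
  obtain U' V' where "U' \<in> B" "x \<in> U'" "U' \<subseteq> U" "V' \<in> B" "x \<in> V'" "V' \<subseteq> V"
    by (elim bexE conjE)
  then show "\<exists>V''\<in>B. x \<in> V'' \<and> V'' \<subseteq> U \<inter> V" using B_Int[of U' V'] by (intro bexI[of _ "U' \<inter> V'"]) auto
qed

lemma gen_INT: "finite G \<Longrightarrow> G \<noteq> {} \<Longrightarrow> G \<subseteq> gen B \<Longrightarrow> \<Inter>G \<in> gen B"
  by (induction G rule: finite_ne_induct) (auto intro: gen_Int)

end

text \<open>Common frame for three ideals: few traces, few neighbourhood filters, and only the empty
  set. The last assumption is the abstract form of the absence of a product or, for the third ideal,
  of an infinite discrete subspace.\<close>

locale ideal_space = base_space +
  fixes small :: "'a set \<Rightarrow> bool"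
  assumes small_empty: "small {}"
    and small_sub: "\<And>X Y. small X \<Longrightarrow> Y \<subseteq> X \<Longrightarrow> small Y"
    and small_Un: "\<And>X Y. small X \<Longrightarrow> small Y \<Longrightarrow> small (X \<union> Y)"
    and small_loc: "\<And>X. X \<subseteq> Z \<Longrightarrow> (\<And>x. x \<in> X \<Longrightarrow> \<exists>V\<in>B. x \<in> V \<and> small (X \<inter> V)) \<Longrightarrow> small X"
    and no_split_seq: "\<not> (\<exists>A U V. A 0 \<subseteq> Z \<and> (\<forall>n::nat. U n \<in> gen B \<and> V n \<in> gen B \<and>
      A (Suc n) = A n \<inter> U n - V n \<and> \<not> small (A n \<inter> V n - U n)))"
begin

text \<open>Dependent choice: an invariant that survives every split step would produce the
  forbidden sequence.\<close>

lemma no_split: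
  assumes "G A0" "A0 \<subseteq> Z"
    and step: "\<And>A. G A \<Longrightarrow> A \<subseteq> Z \<Longrightarrow> \<exists>U\<in>gen B. \<exists>V\<in>gen B. G (A \<inter> U - V) \<and> \<not> small (A \<inter> V - U)"
  shows False
proof -
  let ?P = "\<lambda>n (A, U, V). G A \<and> A \<subseteq> Z \<and> U \<in> gen B \<and> V \<in> gen B \<and> G (A \<inter> U - V) \<and> \<not> small (A \<inter> V - U)"
  let ?Q = "\<lambda>n (A, U, V) (A', U', V'). A' = A \<inter> U - V"
  have "\<exists>f. \<forall>n. ?P n (f n) \<and> ?Q n (f n) (f (Suc n))"
  proof (rule dependent_nat_choice)
    show "\<exists>x. ?P 0 x" using step[OF assms(1,2)] assms(1,2) by auto
    fix x :: "'a set \<times> 'a set \<times> 'a set" and n :: nat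
    assume x: "?P n x"
    obtain A U V where [simp]: "x = (A, U, V)" by (cases x)
    have "G (A \<inter> U - V)" "A \<inter> U - V \<subseteq> Z" using x by auto
    from step[OF this] show "\<exists>y. ?P (Suc n) y \<and> ?Q n x y" using \<open>G (A \<inter> U - V)\<close> \<open>A \<inter> U - V \<subseteq> Z\<close> by auto
  qed
  then obtain f where f: "\<forall>n. ?P n (f n) \<and> ?Q n (f n) (f (Suc n))" ..
  define A U V where "A n = fst (f n)" and "U n = fst (snd (f n))" and "V n = snd (snd (f n))" for n
  have "A 0 \<subseteq> Z" using f[rule_format, of 0] unfolding A_def by (simp add: case_prod_unfold)
  moreover have "U n \<in> gen B \<and> V n \<in> gen B \<and> A (Suc n) = A n \<inter> U n - V n \<and> \<not> small (A n \<inter> V n - U n)" for n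
    using f[rule_format, of n] unfolding A_def U_def V_def by (simp add: case_prod_unfold)
  ultimately show False using no_split_seq by blast
qed

section \<open>Irreducible sets modulo the ideal and finite detection\<close>

definition irr :: "'a set \<Rightarrow> bool" where
  "irr X \<longleftrightarrow> X \<subseteq> Z \<and> \<not> small X \<and> (\<forall>U\<in>gen B. \<forall>V\<in>gen B.
     \<not> small (X \<inter> U) \<longrightarrow> \<not> small (X \<inter> V) \<longrightarrow> \<not> small (X \<inter> U \<inter> V))"

text \<open>The analogue of having finitely many irreducible components in a Noetherian space,
  except that the pieces need not cover \<open>A\<close>; they only have to notice every open set
  that is not negligible on \<open>A\<close>.\<close>

definition good :: "'a set \<Rightarrow> bool" where
  "good A \<longleftrightarrow> (\<exists>\<X>. finite \<X> \<and> (\<forall>X\<in>\<X>. irr X \<and> X \<subseteq> A) \<and>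
     (\<forall>V\<in>gen B. (\<forall>X\<in>\<X>. small (X \<inter> V)) \<longrightarrow> small (A \<inter> V)))"

lemma good_small: "small A \<Longrightarrow> good A"
  unfolding good_def using small_sub by (intro exI[of _ "{}"]) auto

lemma good_irr: "irr A \<Longrightarrow> good A"
  unfolding good_def by (intro exI[of _ "{A}"]) auto

lemma good_Un: assumes "good A" "good A'" shows "good (A \<union> A')"
proof -
  obtain \<X> \<X>' where X: "finite \<X>" "\<forall>X\<in>\<X>. irr X \<and> X \<subseteq> A" "\<forall>V\<in>gen B. (\<forall>X\<in>\<X>. small (X \<inter> V)) \<longrightarrow> small (A \<inter> V)"
    and X': "finite \<X>'" "\<forall>X\<in>\<X>'. irr X \<and> X \<subseteq> A'" "\<forall>V\<in>gen B. (\<forall>X\<in>\<X>'. small (X \<inter> V)) \<longrightarrow> small (A' \<inter> V)"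
    using assms unfolding good_def by (elim exE conjE) (rule that, assumption+)
  show ?thesis unfolding good_def
  proof (intro exI[of _ "\<X> \<union> \<X>'"] conjI ballI impI)
    fix V assume "V \<in> gen B" "\<forall>X\<in>\<X> \<union> \<X>'. small (X \<inter> V)"
    then have "small (A \<inter> V)" "small (A' \<inter> V)" using X(3) X'(3) by auto
    then show "small ((A \<union> A') \<inter> V)" using small_Un by (simp add: Int_Un_distrib2)
  qed (use X X' in auto)
qed

lemma irrD:
  "irr X \<Longrightarrow> U \<in> gen B \<Longrightarrow> V \<in> gen B \<Longrightarrow> \<not> small (X \<inter> U) \<Longrightarrow> \<not> small (X \<inter> V) \<Longrightarrow> \<not> small (X \<inter> U \<inter> V)"
  unfolding irr_def by simp

lemma irr_diff: assumes "irr X" "small (X \<inter> N)" shows "irr (X - N)"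
proof -
  have un: "\<not> small (Y - N)" if "\<not> small Y" "Y \<subseteq> X" for Y
  proof
    assume "small (Y - N)"
    then have "small ((Y - N) \<union> (X \<inter> N))" using assms(2) small_Un by blast
    then have "small Y" by (rule small_sub) (use that(2) in blast)
    then show False using that(1) by blast
  qed
  have "\<not> small ((X - N) \<inter> U \<inter> V)" if "U \<in> gen B" "V \<in> gen B" "\<not> small ((X - N) \<inter> U)" "\<not> small ((X - N) \<inter> V)" for U V
  proof -
    have "\<not> small (X \<inter> U)" "\<not> small (X \<inter> V)"
      using that(3,4) small_sub[of "X \<inter> U" "(X - N) \<inter> U"] small_sub[of "X \<inter> V" "(X - N) \<inter> V"] by blast+
    then have "\<not> small (X \<inter> U \<inter> V)" using irrD assms(1) that(1,2) by blast
    then have "\<not> small (X \<inter> U \<inter> V - N)" by (rule un) blast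
    moreover have "(X - N) \<inter> U \<inter> V = X \<inter> U \<inter> V - N" by blast
    ultimately show ?thesis by simp
  qed
  moreover have "X - N \<subseteq> Z" "\<not> small (X - N)" using assms(1) un[of X] unfolding irr_def by auto
  ultimately show ?thesis unfolding irr_def by simp
qed

text \<open>Reducibility gives two non-small open parts with small overlap. If the first is not
  good, the split is found. If it is good, it contains an irreducible open part
  \<open>A \<inter> V1\<close>, which by itself detects everything outside the largest open set
  \<open>N\<close> negligible on it; so the failure of goodness moves to
  \<open>A \<inter> N\<close>.\<close>

lemma not_good_splits:
  assumes A: "A \<subseteq> Z" "\<not> good A"
  shows "\<exists>U\<in>gen B. \<exists>V\<in>gen B. \<not> good (A \<inter> U) \<and> \<not> small (A \<inter> V) \<and> small (A \<inter> U \<inter> V)"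
proof -
  have "\<not> irr A" "\<not> small A" using A good_irr good_small by blast+
  then obtain V V' where V: "V \<in> gen B" "V' \<in> gen B" "\<not> small (A \<inter> V)" "\<not> small (A \<inter> V')" "small (A \<inter> V \<inter> V')"
    using A(1) unfolding irr_def by blast
  show ?thesis
  proof (cases "good (A \<inter> V)")
    case False
    then show ?thesis using V by (intro bexI[of _ V] bexI[of _ V']) auto
  next
    case True
    \<comment> \<open>Among the detecting families of \<open>A \<inter> V\<close> one of least
      cardinality is taken, so that each member is indispensable: some open \<open>V2\<close> is
      noticed by \<open>X1\<close> and by no other member.\<close>
    define okp where "okp \<X> \<longleftrightarrow> finite \<X> \<and> (\<forall>X\<in>\<X>. irr X \<and> X \<subseteq> A \<inter> V) \<and>
     (\<forall>W\<in>gen B. (\<forall>X\<in>\<X>. small (X \<inter> W)) \<longrightarrow> small (A \<inter> V \<inter> W))" for \<X>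
    from True have "\<exists>\<X>. okp \<X>" unfolding good_def okp_def .
    then obtain \<X>0 where "okp \<X>0" ..
    from ex_has_least_nat[of okp, OF this, of card] obtain \<X> where
      "okp \<X>" and least: "\<And>\<Y>. okp \<Y> \<Longrightarrow> card \<X> \<le> card \<Y>" by auto
    note ok = this(1)[unfolded okp_def]
    have "\<X> \<noteq> {}"
    proof
      assume "\<X> = {}"
      then have "\<forall>X\<in>\<X>. small (X \<inter> V)" by simp
      then have "small (A \<inter> V \<inter> V)" using ok V(1) by blast
      then show False using V(3) by (simp add: Int_assoc)
    qed
    then obtain X1 where X1: "X1 \<in> \<X>" by blast
    have "\<not> okp (\<X> - {X1})"
    proof
      assume "okp (\<X> - {X1})"
      then have "card \<X> \<le> card (\<X> - {X1})" by (rule least)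
      then show False using ok X1 by (metis card_Diff1_less not_le)
    qed
    then have "\<not> (\<forall>W\<in>gen B. (\<forall>X\<in>\<X> - {X1}. small (X \<inter> W)) \<longrightarrow> small (A \<inter> V \<inter> W))"
      using ok unfolding okp_def by auto
    then obtain V2 where V2: "V2 \<in> gen B" "\<forall>X\<in>\<X> - {X1}. small (X \<inter> V2)" "\<not> small (A \<inter> V \<inter> V2)"
      by blast
    define V1 where "V1 = V \<inter> V2"
    have V1: "V1 \<in> gen B" unfolding V1_def using V(1) V2(1) gen_Int by blast
    \<comment> \<open>Below \<open>V2\<close> the detection is done by \<open>X1\<close> alone, so
      irreducibility of \<open>X1\<close> passes to \<open>A \<inter> V1\<close>.\<close>
    have key: "\<not> small (X1 \<inter> (V2 \<inter> W))" if "W \<in> gen B" "\<not> small (A \<inter> V1 \<inter> W)" for W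
    proof
      assume s: "small (X1 \<inter> (V2 \<inter> W))"
      have "small (X \<inter> (V2 \<inter> W))" if "X \<in> \<X>" for X
      proof (cases "X = X1")
        case False
        then have "small (X \<inter> V2)" using V2(2) that by blast
        then show ?thesis by (rule small_sub) blast
      qed (use s in simp)
      moreover have "V2 \<inter> W \<in> gen B" using V2(1) that(1) gen_Int by blast
      ultimately have "small (A \<inter> V \<inter> (V2 \<inter> W))" using ok by blast
      then show False using that(2) unfolding V1_def by (simp add: Int_assoc)
    qed
    have irr1: "irr (A \<inter> V1)" unfolding irr_def
    proof (intro conjI ballI impI)
      show "A \<inter> V1 \<subseteq> Z" using A(1) by blast
      show "\<not> small (A \<inter> V1)" using V2(3) unfolding V1_def by (simp add: Int_assoc)
      fix W W' assume W: "W \<in> gen B" "W' \<in> gen B" "\<not> small (A \<inter> V1 \<inter> W)" "\<not> small (A \<inter> V1 \<inter> W')"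
      have "\<not> small (X1 \<inter> (V2 \<inter> W) \<inter> (V2 \<inter> W'))"
      proof (rule irrD)
        show "irr X1" using ok X1 by simp
      qed (use key[OF W(1,3)] key[OF W(2,4)] W(1,2) V2(1) gen_Int in auto)
      moreover have "X1 \<inter> (V2 \<inter> W) \<inter> (V2 \<inter> W') \<subseteq> A \<inter> V1 \<inter> W \<inter> W'" using ok X1 unfolding V1_def by blast
      ultimately show "\<not> small (A \<inter> V1 \<inter> W \<inter> W')" using small_sub by blast
    qed
    define N where "N = \<Union>{V''\<in>B. small (A \<inter> V1 \<inter> V'')}"
    have N: "N \<in> gen B" unfolding N_def by (rule gen_sub) blast
    \<comment> \<open>Locality of the ideal keeps this arbitrary union of negligible sets
      negligible.\<close>
    have sN: "small (A \<inter> V1 \<inter> N)"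
    proof (rule small_loc)
      show "A \<inter> V1 \<inter> N \<subseteq> Z" using A(1) by blast
      fix x assume "x \<in> A \<inter> V1 \<inter> N"
      then obtain V'' where V'': "V'' \<in> B" "small (A \<inter> V1 \<inter> V'')" "x \<in> V''" unfolding N_def by blast
      have "small (A \<inter> V1 \<inter> N \<inter> V'')" by (rule small_sub[OF V''(2)]) blast
      then show "\<exists>V\<in>B. x \<in> V \<and> small (A \<inter> V1 \<inter> N \<inter> V)" using V'' by blast
    qed
    \<comment> \<open>A single irreducible set suffices: an open set small on
      \<open>A \<inter> V1 - N\<close> is small on \<open>A \<inter> V1\<close> as well, hence lies
      inside \<open>N\<close>.\<close>
    have "good (A - N)" unfolding good_def
    proof (intro exI[of _ "{A \<inter> V1 - N}"] conjI ballI impI)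
      fix W assume W: "W \<in> gen B" "\<forall>X\<in>{A \<inter> V1 - N}. small (X \<inter> W)"
      have "small ((A \<inter> V1 - N) \<inter> W \<union> A \<inter> V1 \<inter> N)" using W(2) sN small_Un by blast
      then have s: "small (A \<inter> V1 \<inter> W)" by (rule small_sub) blast
      have "W \<subseteq> N"
      proof
        fix x assume "x \<in> W"
        from gen_E[OF W(1) this] obtain V3 where V3: "V3 \<in> B" "x \<in> V3" "V3 \<subseteq> W" by blast
        have "small (A \<inter> V1 \<inter> V3)" by (rule small_sub[OF s]) (use V3 in blast)
        then show "x \<in> N" unfolding N_def using V3 by blast
      qed
      then have "(A - N) \<inter> W = {}" by blast
      then show "small ((A - N) \<inter> W)" using small_empty by simp
    qed (use irr_diff[OF irr1 sN] in auto)
    then have "\<not> good (A \<inter> N)" using A(2) good_Un[of "A \<inter> N" "A - N"] by (metis Int_Diff_Un)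
    moreover have "small (A \<inter> N \<inter> V1)" using sN by (simp add: Int_ac)
    moreover have "\<not> small (A \<inter> V1)" using irr1 unfolding irr_def by blast
    ultimately show ?thesis using N V1 by (intro bexI[of _ N] bexI[of _ V1] conjI)
  qed
qed

text \<open>Noetherian induction: removing the small overlap from the two parts given by
  \<open>not_good_splits\<close> yields a split step that could be repeated forever.\<close>

lemma all_good: assumes "A \<subseteq> Z" shows "good A"
proof (rule ccontr)
  assume "\<not> good A"
  then show False
  proof (rule no_split[of "\<lambda>A. \<not> good A", OF _ assms])
    fix A assume A: "\<not> good A" "A \<subseteq> Z"
    obtain U V where UV: "U \<in> gen B" "V \<in> gen B" "\<not> good (A \<inter> U)" "\<not> small (A \<inter> V)" "small (A \<inter> U \<inter> V)"
      using not_good_splits[OF A(2,1)] by blast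
    have "\<not> good (A \<inter> U - V)"
      using UV(3) good_Un[of "A \<inter> U - V" "A \<inter> U \<inter> V"] good_small[OF UV(5)] by (metis Diff_Int_distrib2 Un_Diff_Int)
    moreover have "\<not> small (A \<inter> V - U)"
    proof
      assume "small (A \<inter> V - U)"
      from small_Un[OF this UV(5)] have "small (A \<inter> V)" by (rule small_sub) blast
      then show False using UV(4) by blast
    qed
    ultimately show "\<exists>U\<in>gen B. \<exists>V\<in>gen B. \<not> good (A \<inter> U - V) \<and> \<not> small (A \<inter> V - U)" using UV(1,2) by blast
  qed
qed

definition filt :: "'a set \<Rightarrow> 'a set set" where
  "filt X = {V\<in>B. \<not> small (X \<inter> V)}"

text \<open>A finite detecting family for \<open>Z - W\<close> determines which basic sets are
  negligible there: exactly those in none of its filters. So few filters would leave few such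
  collections.\<close>

lemma many_filters:
  assumes M: "infinite M" and many: "\<not> (\<lambda>W. {V\<in>B. small ((Z - W) \<inter> V)}) ` gen B \<lesssim> M"
  shows "\<not> filt ` {X. irr X} \<lesssim> M"
proof
  assume "filt ` {X. irr X} \<lesssim> M"
  from finite_subsets_lepoll[OF M this] have fin: "{S. S \<subseteq> filt ` {X. irr X} \<and> finite S} \<lesssim> M" .
  have "(\<lambda>W. {V\<in>B. small ((Z - W) \<inter> V)}) ` gen B \<subseteq> (\<lambda>S. B - \<Union>S) ` {S. S \<subseteq> filt ` {X. irr X} \<and> finite S}"
  proof clarify
    fix W assume "W \<in> gen B"
    have "good (Z - W)" by (rule all_good) blast
    then obtain \<X> where X: "finite \<X>" "\<forall>X\<in>\<X>. irr X \<and> X \<subseteq> Z - W"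
      "\<forall>V\<in>gen B. (\<forall>X\<in>\<X>. small (X \<inter> V)) \<longrightarrow> small ((Z - W) \<inter> V)" unfolding good_def by (elim exE conjE)
    have "{V\<in>B. small ((Z - W) \<inter> V)} = B - \<Union>(filt ` \<X>)"
    proof (intro equalityI subsetI)
      fix V assume V: "V \<in> {V\<in>B. small ((Z - W) \<inter> V)}"
      have "small (X \<inter> V)" if "X \<in> \<X>" for X
        by (rule small_sub[of "(Z - W) \<inter> V"]) (use V X(2) that in auto)
      then show "V \<in> B - \<Union>(filt ` \<X>)" using V unfolding filt_def by auto
    next
      fix V assume "V \<in> B - \<Union>(filt ` \<X>)"
      then show "V \<in> {V\<in>B. small ((Z - W) \<inter> V)}" using X(3) gen_base unfolding filt_def by blast
    qed
    then show "{V\<in>B. small ((Z - W) \<inter> V)} \<in> (\<lambda>S. B - \<Union>S) ` {S. S \<subseteq> filt ` {X. irr X} \<and> finite S}"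
      using X(1,2) by blast
  qed
  then show False using many fin by (meson lepoll_trans subset_image_lepoll)
qed

text \<open>Irreducibility handles the finitely many sets in \<open>G\<close>, and locality makes
  the union of all basic sets outside the filter negligible, however many there are.\<close>

lemma irr_large:
  assumes "irr X" "finite G" "G \<subseteq> filt X"
  shows "\<not> small (X \<inter> \<Inter>G - \<Union>(B - filt X))"
proof -
  let ?H = "\<Union>(B - filt X)"
  have "\<not> small (X \<inter> \<Inter>G)" using assms(2,3)
  proof (induction G rule: finite_induct)
    case empty
    then show ?case using assms(1) unfolding irr_def by simp
  next
    case (insert V G)
    show ?case
    proof (cases "G = {}")
      case True
      then show ?thesis using insert unfolding filt_def by simp
    next
      case False
      have "G \<subseteq> gen B" using insert(4) gen_base unfolding filt_def by blast
      then have "\<Inter>G \<in> gen B" using gen_INT insert(1) False by blast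
      moreover have "V \<in> gen B" "\<not> small (X \<inter> V)" using insert(4) gen_base unfolding filt_def by auto
      ultimately have "\<not> small (X \<inter> V \<inter> \<Inter>G)"
        using insert assms(1) unfolding irr_def by blast
      then show ?thesis by (simp add: Int_assoc)
    qed
  qed
  moreover have "small (X \<inter> ?H)"
  proof (rule small_loc)
    show "X \<inter> ?H \<subseteq> Z" using assms(1) unfolding irr_def by blast
    fix x assume "x \<in> X \<inter> ?H"
    then obtain V where V: "V \<in> B" "small (X \<inter> V)" "x \<in> V" unfolding filt_def by blast
    have "small (X \<inter> ?H \<inter> V)" by (rule small_sub[OF V(2)]) blast
    then show "\<exists>V\<in>B. x \<in> V \<and> small (X \<inter> ?H \<inter> V)" using V by blast
  qed
  ultimately show ?thesis
    using small_Un[of "X \<inter> \<Inter>G - ?H" "X \<inter> ?H"] small_sub[of "(X \<inter> \<Inter>G - ?H) \<union> X \<inter> ?H" "X \<inter> \<Inter>G"] by blast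
qed

text \<open>Positive conditions can be met finitely many at a time, negative ones all at once. This
  asymmetry is what the trees of points rely on.\<close>

lemma irr_point:
  assumes "irr X" "finite G" "G \<subseteq> filt X"
  shows "\<exists>x\<in>Z. x \<in> \<Inter>G \<and> (\<forall>V\<in>B - filt X. x \<notin> V)"
proof -
  have "X \<inter> \<Inter>G - \<Union>(B - filt X) \<noteq> {}" using irr_large[OF assms] small_empty by metis
  then show ?thesis using assms(1) unfolding irr_def by blast
qed

lemma irr_not_small:
  assumes "irr X" "finite G" "G \<subseteq> filt X" "H \<subseteq> B - filt X"
  shows "\<not> small (Z \<inter> \<Inter>G - \<Union>H)"
  using irr_large[OF assms(1-3)] small_sub[of "Z \<inter> \<Inter>G - \<Union>H" "X \<inter> \<Inter>G - \<Union>(B - filt X)"] assms(1,4)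
  unfolding irr_def by blast

text \<open>If no cylinder were a chain, two incomparable filters in it would give \<open>U\<close> and \<open>V\<close> for
  the next step of a split sequence.\<close>

lemma filter_chain:
  assumes M: "infinite M" and BM: "B \<lesssim> M" and big: "\<not> \<F> \<lesssim> M" and sub: "\<F> \<subseteq> Pow B"
    and lrg: "\<And>G H. finite G \<Longrightarrow> finite H \<Longrightarrow> G \<subseteq> B \<Longrightarrow> H \<subseteq> B \<Longrightarrow> \<not> cyl \<F> G H \<lesssim> M \<Longrightarrow> \<not> small (Z \<inter> \<Inter>G - \<Union>H)"
  shows "\<exists>K\<subseteq>\<F>. K \<noteq> {} \<and> (\<forall>F\<in>K. \<forall>F'\<in>K. F \<subseteq> F' \<or> F' \<subseteq> F) \<and>
    (\<forall>G H. finite G \<longrightarrow> finite H \<longrightarrow> G \<subseteq> B \<longrightarrow> H \<subseteq> B \<longrightarrow> cyl K G H \<noteq> {} \<longrightarrow> \<not> cyl K G H \<lesssim> M)"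
proof (rule ccontr)
  assume contra: "\<not> ?thesis"
  let ?fs = "{S. S \<subseteq> B \<and> finite S}"
  \<comment> \<open>Cantor-Bendixson step: there are at most \<open>M\<close> cylinders, so deleting
    all filters that lie in a small one deletes at most \<open>M\<close> filters, and every nonempty
    cylinder of the rest is large.\<close>
  define \<F>' where "\<F>' = {F\<in>\<F>. \<forall>G\<in>?fs. \<forall>H\<in>?fs. F \<in> cyl \<F> G H \<longrightarrow> \<not> cyl \<F> G H \<lesssim> M}"
  have "\<F> - \<F>' \<subseteq> (\<Union>(G, H)\<in>{p \<in> ?fs \<times> ?fs. cyl \<F> (fst p) (snd p) \<lesssim> M}. cyl \<F> G H)"
    unfolding \<F>'_def by (auto simp: split_beta)
  moreover have "(\<Union>(G, H)\<in>{p \<in> ?fs \<times> ?fs. cyl \<F> (fst p) (snd p) \<lesssim> M}. cyl \<F> G H) \<lesssim> M"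
  proof (rule UN_lepoll[OF M])
    have "?fs \<times> ?fs \<lesssim> M" using finite_subsets_lepoll[OF M BM] Times_lepoll[OF M] by blast
    then show "{p \<in> ?fs \<times> ?fs. cyl \<F> (fst p) (snd p) \<lesssim> M} \<lesssim> M"
      by (rule lepoll_trans[OF subset_imp_lepoll, rotated]) auto
  qed (auto simp: split_beta)
  ultimately have rest: "\<F> - \<F>' \<lesssim> M" by (meson lepoll_trans subset_imp_lepoll)
  have large: "\<not> cyl \<F>' G H \<lesssim> M" "\<not> cyl \<F> G H \<lesssim> M" if "finite G" "finite H" "G \<subseteq> B" "H \<subseteq> B" "cyl \<F>' G H \<noteq> {}" for G H
  proof -
    have "\<exists>F. F \<in> cyl \<F>' G H" using that(5) by blast
    then obtain F where "F \<in> cyl \<F>' G H" ..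
    then have "F \<in> \<F>'" "F \<in> cyl \<F> G H" unfolding cyl_def \<F>'_def by auto
    then show b: "\<not> cyl \<F> G H \<lesssim> M" using that(1-4) unfolding \<F>'_def by blast
    have "cyl \<F> G H \<subseteq> cyl \<F>' G H \<union> (\<F> - \<F>')" unfolding cyl_def by blast
    then show "\<not> cyl \<F>' G H \<lesssim> M" using b rest Un_lepoll[OF M] by (meson lepoll_trans subset_imp_lepoll)
  qed
  have "\<F>' \<noteq> {}" using rest big by auto
  then have ne0: "cyl \<F>' {} {} \<noteq> {}" unfolding cyl_def by simp
  \<comment> \<open>A nonempty cylinder without incomparable members could itself serve as
    \<open>K\<close>.\<close>
  have inc: "\<exists>F\<in>cyl \<F>' G H. \<exists>F'\<in>cyl \<F>' G H. \<not> F \<subseteq> F' \<and> \<not> F' \<subseteq> F"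
    if "finite G" "finite H" "G \<subseteq> B" "H \<subseteq> B" "cyl \<F>' G H \<noteq> {}" for G H
  proof (rule ccontr)
    assume c: "\<not> ?thesis"
    have "\<not> cyl (cyl \<F>' G H) G' H' \<lesssim> M" if "finite G'" "finite H'" "G' \<subseteq> B" "H' \<subseteq> B" "cyl (cyl \<F>' G H) G' H' \<noteq> {}" for G' H'
    proof -
      have "cyl (cyl \<F>' G H) G' H' = cyl \<F>' (G \<union> G') (H \<union> H')" unfolding cyl_def by blast
      then show ?thesis using large(1)[of "G \<union> G'" "H \<union> H'"] that \<open>finite G\<close> \<open>finite H\<close> \<open>G \<subseteq> B\<close> \<open>H \<subseteq> B\<close> by simp
    qed
    moreover have "cyl \<F>' G H \<subseteq> \<F>" unfolding cyl_def \<F>'_def by blast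
    ultimately have "\<exists>K\<subseteq>\<F>. K \<noteq> {} \<and> (\<forall>F\<in>K. \<forall>F'\<in>K. F \<subseteq> F' \<or> F' \<subseteq> F) \<and>
    (\<forall>G H. finite G \<longrightarrow> finite H \<longrightarrow> G \<subseteq> B \<longrightarrow> H \<subseteq> B \<longrightarrow> cyl K G H \<noteq> {} \<longrightarrow> \<not> cyl K G H \<lesssim> M)"
      using c that(5) by (intro exI[of _ "cyl \<F>' G H"] conjI ballI allI impI) auto
    then show False using contra by (rule notE[rotated])
  qed
  let ?G = "\<lambda>A. \<exists>G H. finite G \<and> finite H \<and> G \<subseteq> B \<and> H \<subseteq> B \<and> cyl \<F>' G H \<noteq> {} \<and> A = Z \<inter> \<Inter>G - \<Union>H"
  show False
  proof (rule no_split[of ?G Z])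
    show "?G Z" using ne0 by (intro exI[of _ "{}"]) simp
    fix A assume "?G A"
    then obtain G H where GH: "finite G" "finite H" "G \<subseteq> B" "H \<subseteq> B" "cyl \<F>' G H \<noteq> {}" and A: "A = Z \<inter> \<Inter>G - \<Union>H"
      by (elim exE conjE)
    from inc[OF GH] obtain F F' where F: "F \<in> cyl \<F>' G H" "F' \<in> cyl \<F>' G H" "\<not> F \<subseteq> F'" "\<not> F' \<subseteq> F"
      by (elim bexE conjE)
    obtain U V where U: "U \<in> F" "U \<notin> F'" and V: "V \<in> F'" "V \<notin> F" using F(3,4) by blast
    have "F \<in> \<F>" "F' \<in> \<F>" using F(1,2) unfolding cyl_def \<F>'_def by simp_all
    then have "F \<subseteq> B" "F' \<subseteq> B" using sub by auto
    then have UVB: "U \<in> B" "V \<in> B" using U V by auto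
    \<comment> \<open>The two filters answer oppositely on \<open>U\<close> and \<open>V\<close>:
      the first cylinder keeps the invariant for \<open>A \<inter> U - V\<close>, the second shows
      that \<open>A \<inter> V - U\<close> is not small.\<close>
    have "F \<in> cyl \<F>' (insert U G) (insert V H)" "F' \<in> cyl \<F>' (insert V G) (insert U H)"
      using F(1,2) U V unfolding cyl_def by auto
    then have ne: "cyl \<F>' (insert U G) (insert V H) \<noteq> {}" "cyl \<F>' (insert V G) (insert U H) \<noteq> {}" by blast+
    have "\<not> cyl \<F> (insert V G) (insert U H) \<lesssim> M" using large(2)[OF _ _ _ _ ne(2)] GH UVB by simp
    then have "\<not> small (Z \<inter> \<Inter>(insert V G) - \<Union>(insert U H))" by (intro lrg) (use GH UVB in auto)
    moreover have "Z \<inter> \<Inter>(insert V G) - \<Union>(insert U H) = A \<inter> V - U" unfolding A by auto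
    moreover have "?G (A \<inter> U - V)"
      unfolding A using ne(1) GH UVB by (intro exI[of _ "insert U G"] exI[of _ "insert V H"]) auto
    ultimately show "\<exists>U\<in>gen B. \<exists>V\<in>gen B. ?G (A \<inter> U - V) \<and> \<not> small (A \<inter> V - U)"
      using UVB gen_base by metis
  qed simp
qed

end

section \<open>Trees of intervals in a chain\<close>

lemma take_restr: "n \<le> m \<Longrightarrow> take n (restr \<eta> m) = restr \<eta> n"
  unfolding restr_def by (simp add: take_map)

lemma length_restr [simp]: "length (restr \<eta> n) = n"
  unfolding restr_def by simp

lemma restr_Suc: "restr \<eta> (Suc n) = restr \<eta> n @ [\<eta> n]"
  unfolding restr_def by simp

lemma restr_fin_seqs: "\<eta> \<in> inf_seqs m \<Longrightarrow> restr \<eta> n \<in> fin_seqs m"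
  unfolding restr_def fin_seqs_def inf_seqs_def by simp

lemma take_fin_seqs: "\<nu> \<in> fin_seqs m \<Longrightarrow> take n \<nu> \<in> fin_seqs m"
  unfolding fin_seqs_def by simp

lemma nth_fin_seqs: "\<nu> \<in> fin_seqs m \<Longrightarrow> n < length \<nu> \<Longrightarrow> \<nu> ! n \<in> Field (m n)"
  unfolding fin_seqs_def by simp

lemma longest_prefix:
  "\<exists>m\<le>length \<nu>. m \<le> length \<rho> \<and> take m \<nu> = take m \<rho> \<and> (m = length \<nu> \<or> m = length \<rho> \<or> \<nu> ! m \<noteq> \<rho> ! m)"
proof -
  let ?P = "\<lambda>m. m \<le> length \<nu> \<and> m \<le> length \<rho> \<and> take m \<nu> = take m \<rho>"
  have "?P 0" by simp
  moreover have "\<forall>m. ?P m \<longrightarrow> m < Suc (length \<nu>)" by simp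
  ultimately obtain m where m: "?P m" and max: "\<And>k. ?P k \<Longrightarrow> k \<le> m"
    using ex_has_greatest_nat[of ?P 0 "\<lambda>m. m" "Suc (length \<nu>)"] by auto
  have "m = length \<nu> \<or> m = length \<rho> \<or> \<nu> ! m \<noteq> \<rho> ! m"
  proof (rule ccontr)
    assume c: "\<not> ?thesis"
    then have "?P (Suc m)" using m by (auto simp: take_Suc_conv_app_nth)
    then show False using max by fastforce
  qed
  then show ?thesis using m by blast
qed

primrec walk :: "('s \<Rightarrow> nat \<Rightarrow> 'k \<Rightarrow> 's) \<Rightarrow> 's \<Rightarrow> nat \<Rightarrow> 'k list \<Rightarrow> 's" where
  "walk c I n [] = I"
| "walk c I n (b # \<nu>) = walk c (c I n b) (Suc n) \<nu>"

lemma walk_snoc: "walk c I n (\<nu> @ [b]) = c (walk c I n \<nu>) (n + length \<nu>) b"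
  by (induction \<nu> arbitrary: I n) auto

text \<open>The point \<open>x \<nu>\<close> belongs to the distinguished child \<open>cs\<close> of the node \<open>\<nu>\<close>, which lies outside
  all the sets \<open>Vs\<close> of that node; the set for a branch \<open>\<eta>\<close> is the union of the \<open>Vs\<close> along \<open>\<eta>\<close>.\<close>

lemma linear_tree:
  fixes mu :: "nat \<Rightarrow> 'k rel" and prec :: "nat \<Rightarrow> 'k \<Rightarrow> 'k \<Rightarrow> bool"
    and \<I> :: "'a set set set set" and Vs :: "'a set set set \<Rightarrow> nat \<Rightarrow> 'k \<Rightarrow> 'a set set"
  assumes I0: "I0 \<in> \<I>" and ne: "\<And>I. I \<in> \<I> \<Longrightarrow> I \<noteq> {} \<and> I \<subseteq> K"
    and chain: "\<And>F F'. F \<in> K \<Longrightarrow> F' \<in> K \<Longrightarrow> F \<subseteq> F' \<or> F' \<subseteq> F" and KB: "\<And>F. F \<in> K \<Longrightarrow> F \<subseteq> B"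
    and c: "\<And>I n b. I \<in> \<I> \<Longrightarrow> b \<in> Field (mu n) \<Longrightarrow> c I n b \<in> \<I> \<and> c I n b \<subseteq> I"
    and cs: "\<And>I n. I \<in> \<I> \<Longrightarrow> cs I n \<in> \<I> \<and> cs I n \<subseteq> I"
    and v: "\<And>I n b F. I \<in> \<I> \<Longrightarrow> b \<in> Field (mu n) \<Longrightarrow> F \<in> c I n b \<Longrightarrow> v I n b \<in> F"
    and v2: "\<And>I n a b. I \<in> \<I> \<Longrightarrow> a \<in> Field (mu n) \<Longrightarrow> b \<in> Field (mu n) \<Longrightarrow> prec n a b \<Longrightarrow> v I n b \<in> Vs I n a"
    and VB: "\<And>I n a. I \<in> \<I> \<Longrightarrow> a \<in> Field (mu n) \<Longrightarrow> Vs I n a \<subseteq> B"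
    and V1: "\<And>I n a b F. I \<in> \<I> \<Longrightarrow> a \<in> Field (mu n) \<Longrightarrow> b \<in> Field (mu n) \<Longrightarrow> F \<in> c I n b \<Longrightarrow>
      \<not> prec n a b \<Longrightarrow> Vs I n a \<inter> F = {}"
    and V2: "\<And>I n a F. I \<in> \<I> \<Longrightarrow> a \<in> Field (mu n) \<Longrightarrow> F \<in> cs I n \<Longrightarrow> Vs I n a \<inter> F = {}"
    and V3: "\<And>I n b F. I \<in> \<I> \<Longrightarrow> b \<in> Field (mu n) \<Longrightarrow> F \<in> cs I n \<Longrightarrow> v I n b \<notin> F"
    and total: "\<And>n a b. a \<in> Field (mu n) \<Longrightarrow> b \<in> Field (mu n) \<Longrightarrow> a \<noteq> b \<Longrightarrow> prec n a b \<or> prec n b a"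
    and irrefl: "\<And>n a. \<not> prec n a a"
    and P: "\<And>F G. F \<in> K \<Longrightarrow> finite G \<Longrightarrow> G \<subseteq> F \<Longrightarrow> \<exists>x\<in>Z. x \<in> \<Inter>G \<and> (\<forall>V\<in>B - F. x \<notin> V)"
  shows "\<exists>x. inj_on x (fin_seqs mu) \<and> x ` fin_seqs mu \<subseteq> Z \<and>
    (\<forall>\<eta>\<in>inf_seqs mu. \<exists>U\<in>gen B. \<forall>\<nu>\<in>fin_seqs mu.
      x \<nu> \<in> U \<longleftrightarrow> (\<exists>n<length \<nu>. take n \<nu> = restr \<eta> n \<and> prec n (\<eta> n) (\<nu> ! n)))"
proof -
  define N where "N = walk c I0 0"
  have N_snoc: "N (\<nu> @ [b]) = c (N \<nu>) (length \<nu>) b" for \<nu> b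
    unfolding N_def by (simp add: walk_snoc)
  have N_take: "N (take (Suc n) \<nu>) = c (N (take n \<nu>)) n (\<nu> ! n)" if "n < length \<nu>" for \<nu> n
    using N_snoc[of "take n \<nu>" "\<nu> ! n"] that by (simp add: take_Suc_conv_app_nth)
  have N_I: "N \<nu> \<in> \<I>" if "\<nu> \<in> fin_seqs mu" for \<nu>
  proof -
    have "N (take n \<nu>) \<in> \<I>" if "n \<le> length \<nu>" for n
      using that
    proof (induction n)
      case 0
      then show ?case using I0 by (simp add: N_def)
    next
      case (Suc n)
      then show ?case using N_take[of n \<nu>] c nth_fin_seqs[OF \<open>\<nu> \<in> fin_seqs mu\<close>, of n] by simp
    qed
    from this[of "length \<nu>"] show ?thesis by simp
  qed
  have N_mono: "N \<nu> \<subseteq> N (take n \<nu>)" if "\<nu> \<in> fin_seqs mu" for \<nu> n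
  proof -
    have "N (take (n + k) \<nu>) \<subseteq> N (take n \<nu>)" for k
    proof (induction k)
      case (Suc k)
      show ?case
      proof (cases "n + k < length \<nu>")
        case True
        have "N (take (Suc (n + k)) \<nu>) \<subseteq> N (take (n + k) \<nu>)"
          using N_take[OF True] c[OF N_I[OF take_fin_seqs[OF that]] nth_fin_seqs[OF that True]] by simp
        then show ?thesis using Suc by simp
      qed (use Suc in simp)
    qed simp
    from this[of "length \<nu>"] show ?thesis by simp
  qed
  have "\<exists>F. F \<in> cs (N \<nu>) (length \<nu>)" if "\<nu> \<in> fin_seqs mu" for \<nu>
    using ne[of "cs (N \<nu>) (length \<nu>)"] cs[OF N_I[OF that]] by blast
  then obtain F where F: "\<And>\<nu>. \<nu> \<in> fin_seqs mu \<Longrightarrow> F \<nu> \<in> cs (N \<nu>) (length \<nu>)" by metis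
  have FN: "F \<nu> \<in> N \<nu>" if "\<nu> \<in> fin_seqs mu" for \<nu> using F[OF that] cs[OF N_I[OF that]] by blast
  have FK: "F \<nu> \<in> K" if "\<nu> \<in> fin_seqs mu" for \<nu> using FN[OF that] ne[OF N_I[OF that]] by blast
  have Fc: "F' \<in> c (N (take n \<nu>)) n (\<nu> ! n)" if "\<nu> \<in> fin_seqs mu" "n < length \<nu>" "F' \<in> N \<nu>" for \<nu> n F'
    using N_mono[OF that(1), of "Suc n"] N_take[OF that(2)] that(3) by auto
  \<comment> \<open>One positive condition per proper initial segment of \<open>\<nu>\<close>, hence
    finitely many, as \<open>P\<close> demands.\<close>
  define G where "G \<nu> = (\<lambda>n. v (N (take n \<nu>)) n (\<nu> ! n)) ` {..<length \<nu>}" for \<nu>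
  have G: "finite (G \<nu>)" "G \<nu> \<subseteq> F \<nu>" if "\<nu> \<in> fin_seqs mu" for \<nu>
  proof -
    show "finite (G \<nu>)" unfolding G_def by simp
    show "G \<nu> \<subseteq> F \<nu>" unfolding G_def
      using v[OF N_I[OF take_fin_seqs[OF that]] nth_fin_seqs[OF that] Fc[OF that _ FN[OF that]]] by auto
  qed
  have "\<exists>x\<in>Z. x \<in> \<Inter>(G \<nu>) \<and> (\<forall>V\<in>B - F \<nu>. x \<notin> V)" if "\<nu> \<in> fin_seqs mu" for \<nu>
    using P[OF FK[OF that] G[OF that]] .
  then obtain x where x: "\<And>\<nu>. \<nu> \<in> fin_seqs mu \<Longrightarrow> x \<nu> \<in> Z \<and> x \<nu> \<in> \<Inter>(G \<nu>) \<and> (\<forall>V\<in>B - F \<nu>. x \<nu> \<notin> V)" by metis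
  have xv: "x \<nu> \<in> v (N (take n \<nu>)) n (\<nu> ! n)" if "\<nu> \<in> fin_seqs mu" "n < length \<nu>" for \<nu> n
    using x[OF that(1)] that(2) unfolding G_def by blast
  have xF: "V \<in> F \<nu>" if "\<nu> \<in> fin_seqs mu" "x \<nu> \<in> V" "V \<in> B" for \<nu> V
    using x[OF that(1)] that(2,3) by blast
  text \<open>If \<open>\<nu>\<close> ends at \<open>m\<close> or branches off below \<open>b\<close> there, it misses the witness of \<open>b\<close>.\<close>
  have miss: "v (N (take m \<nu>)) m b \<notin> F \<nu>"
    if "\<nu> \<in> fin_seqs mu" "m = length \<nu> \<or> m < length \<nu> \<and> prec m (\<nu> ! m) b" "b \<in> Field (mu m)" for \<nu> m b
    using that(2)
  proof
    assume "m = length \<nu>"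
    then show ?thesis using V3[OF N_I[OF that(1)] that(3)] F[OF that(1)] by simp
  next
    assume m: "m < length \<nu> \<and> prec m (\<nu> ! m) b"
    have I: "N (take m \<nu>) \<in> \<I>" by (rule N_I[OF take_fin_seqs[OF that(1)]])
    have a: "\<nu> ! m \<in> Field (mu m)" using m nth_fin_seqs[OF that(1)] by blast
    show ?thesis
      using v2[OF I a that(3)] V1[OF I a a Fc[OF that(1) _ FN[OF that(1)]]] irrefl m by blast
  qed
  have sep: "x \<nu> \<noteq> x \<rho>" if "\<nu> \<in> fin_seqs mu" "\<rho> \<in> fin_seqs mu" "m < length \<rho>" "take m \<nu> = take m \<rho>"
    "m = length \<nu> \<or> m < length \<nu> \<and> prec m (\<nu> ! m) (\<rho> ! m)" for \<nu> \<rho> m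
  proof
    assume eq: "x \<nu> = x \<rho>"
    have b: "\<rho> ! m \<in> Field (mu m)" using that nth_fin_seqs by blast
    let ?w = "v (N (take m \<rho>)) m (\<rho> ! m)"
    have "?w \<in> G \<rho>" unfolding G_def using that(3) by blast
    then have "?w \<in> B" using G(2)[OF that(2)] KB[OF FK[OF that(2)]] by blast
    then have "?w \<in> F \<nu>" using xF[OF that(1)] xv[OF that(2,3)] eq by simp
    then show False using miss[OF that(1,5) b] that(4) by simp
  qed
  have "inj_on x (fin_seqs mu)"
  proof (rule inj_onI, rule ccontr)
    fix \<nu> \<rho> assume nr: "\<nu> \<in> fin_seqs mu" "\<rho> \<in> fin_seqs mu" "x \<nu> = x \<rho>" "\<nu> \<noteq> \<rho>"
    obtain m where m: "m \<le> length \<nu>" "m \<le> length \<rho>" "take m \<nu> = take m \<rho>"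
      "m = length \<nu> \<or> m = length \<rho> \<or> \<nu> ! m \<noteq> \<rho> ! m" using longest_prefix by blast
    have "\<not> (m = length \<nu> \<and> m = length \<rho>)" using m(3) nr(4) by auto
    moreover have "prec m (\<nu> ! m) (\<rho> ! m) \<or> prec m (\<rho> ! m) (\<nu> ! m)"
      if "m < length \<nu>" "m < length \<rho>" "\<nu> ! m \<noteq> \<rho> ! m"
      using total[OF nth_fin_seqs[OF nr(1) that(1)] nth_fin_seqs[OF nr(2) that(2)] that(3)] .
    ultimately show False
      using sep[OF nr(1,2), of m] sep[OF nr(2,1), of m] m nr(3) by (metis le_neq_implies_less)
  qed
  moreover have "x ` fin_seqs mu \<subseteq> Z" using x by blast
  moreover have "\<exists>U\<in>gen B. \<forall>\<nu>\<in>fin_seqs mu.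
      x \<nu> \<in> U \<longleftrightarrow> (\<exists>n<length \<nu>. take n \<nu> = restr \<eta> n \<and> prec n (\<eta> n) (\<nu> ! n))" if \<eta>: "\<eta> \<in> inf_seqs mu" for \<eta>
  proof -
    have \<eta>F: "\<eta> n \<in> Field (mu n)" for n using \<eta> unfolding inf_seqs_def by blast
    have rI: "N (restr \<eta> n) \<in> \<I>" for n by (rule N_I[OF restr_fin_seqs[OF \<eta>]])
    define U where "U = \<Union>(\<Union>n. Vs (N (restr \<eta> n)) n (\<eta> n))"
    have "U \<in> gen B" unfolding U_def by (rule gen_sub) (use VB[OF rI \<eta>F] in blast)
    moreover have "x \<nu> \<in> U \<longleftrightarrow> (\<exists>n<length \<nu>. take n \<nu> = restr \<eta> n \<and> prec n (\<eta> n) (\<nu> ! n))" if \<nu>: "\<nu> \<in> fin_seqs mu" for \<nu>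
    proof
      assume "\<exists>n<length \<nu>. take n \<nu> = restr \<eta> n \<and> prec n (\<eta> n) (\<nu> ! n)"
      then obtain n where n: "n < length \<nu>" "take n \<nu> = restr \<eta> n" "prec n (\<eta> n) (\<nu> ! n)" by blast
      have "v (N (restr \<eta> n)) n (\<nu> ! n) \<in> Vs (N (restr \<eta> n)) n (\<eta> n)"
        by (rule v2[OF rI \<eta>F nth_fin_seqs[OF \<nu> n(1)] n(3)])
      moreover have "x \<nu> \<in> v (N (restr \<eta> n)) n (\<nu> ! n)" using xv[OF \<nu> n(1)] n(2) by simp
      ultimately show "x \<nu> \<in> U" unfolding U_def by blast
    next
      assume "x \<nu> \<in> U"
      then obtain n V where V: "V \<in> Vs (N (restr \<eta> n)) n (\<eta> n)" "x \<nu> \<in> V" unfolding U_def by blast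
      have VF: "V \<in> F \<nu>" using xF[OF \<nu> V(2)] VB[OF rI \<eta>F] V(1) by blast
      obtain m where m: "m \<le> length \<nu>" "m \<le> Suc n" "take m \<nu> = take m (restr \<eta> (Suc n))"
        "m = length \<nu> \<or> m = Suc n \<or> \<nu> ! m \<noteq> restr \<eta> (Suc n) ! m"
        using longest_prefix[of \<nu> "restr \<eta> (Suc n)"] by auto
      have tm: "take m \<nu> = restr \<eta> m" using m(2,3) take_restr by metis
      have "m \<noteq> Suc n"
      proof
        assume "m = Suc n"
        then have n: "n < length \<nu>" "take (Suc n) \<nu> = restr \<eta> (Suc n)" using m(1) tm by auto
        then have e: "take n \<nu> = restr \<eta> n" "\<nu> ! n = \<eta> n"
          by (simp_all add: take_Suc_conv_app_nth restr_Suc)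
        have "F \<nu> \<in> c (N (restr \<eta> n)) n (\<eta> n)" using Fc[OF \<nu> n(1) FN[OF \<nu>]] e by simp
        then show False using V1[OF rI \<eta>F \<eta>F _ irrefl] V(1) VF by blast
      qed
      then have mn: "m \<le> n" using m(2) by simp
      then have nm: "restr \<eta> (Suc n) ! m = \<eta> m" unfolding restr_def by (simp add: nth_append)
      show "\<exists>n<length \<nu>. take n \<nu> = restr \<eta> n \<and> prec n (\<eta> n) (\<nu> ! n)"
      proof (rule ccontr)
        assume no: "\<not> ?thesis"
        have "m = length \<nu> \<or> m < length \<nu> \<and> prec m (\<nu> ! m) (\<eta> m)"
          using m(1,4) \<open>m \<noteq> Suc n\<close> no tm nm total[OF nth_fin_seqs[OF \<nu>, of m] \<eta>F[of m]] by (metis le_neq_implies_less)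
        from miss[OF \<nu> this \<eta>F] have ms: "v (N (restr \<eta> m)) m (\<eta> m) \<notin> F \<nu>" using tm by simp
        \<comment> \<open>Here the chain is used. A filter \<open>F'\<close> further along
          \<open>\<eta>\<close> contains the witness that \<open>F \<nu>\<close> misses, so it
          includes \<open>F \<nu>\<close>; yet it omits \<open>V\<close>.\<close>
        obtain F' where F': "F' \<in> N (restr \<eta> (Suc n))" using ne[OF rI] by blast
        have r1: "take m (restr \<eta> (Suc n)) = restr \<eta> m" "take n (restr \<eta> (Suc n)) = restr \<eta> n"
          "restr \<eta> (Suc n) ! n = \<eta> n" using mn take_restr by (simp_all add: restr_Suc nth_append)
        have F'm: "F' \<in> c (N (restr \<eta> m)) m (\<eta> m)" and F'n: "F' \<in> c (N (restr \<eta> n)) n (\<eta> n)"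
          using Fc[OF restr_fin_seqs[OF \<eta>] _ F', of m] Fc[OF restr_fin_seqs[OF \<eta>] _ F', of n] r1 nm mn by simp_all
        have "v (N (restr \<eta> m)) m (\<eta> m) \<in> F'" by (rule v[OF rI \<eta>F F'm])
        then have "F \<nu> \<subseteq> F'" using ms chain[OF FK[OF \<nu>], of F'] F' ne[OF rI] by blast
        moreover have "V \<notin> F'" using V1[OF rI \<eta>F \<eta>F F'n irrefl] V(1) by blast
        ultimately show False using VF by blast
      qed
    qed
    ultimately show ?thesis by blast
  qed
  ultimately show ?thesis by blast
qed

text \<open>A monotone sequence of filters in \<open>I\<close> with witnesses of strictness:
  increasing for true \<open>b\<close>, decreasing for false \<open>b\<close>.\<close>

definition has_chain :: "'i rel \<Rightarrow> bool \<Rightarrow> 'a set set \<Rightarrow> 'a set set set \<Rightarrow> bool" where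
  "has_chain r b B I \<longleftrightarrow> (\<exists>V F. (\<forall>i\<in>Field r. F i \<in> I \<and> V i \<in> B) \<and>
     (\<forall>i\<in>Field r. \<forall>j\<in>Field r. V i \<in> F j \<longleftrightarrow> (if b then i \<in> underS r j else j \<in> underS r i)))"

lemma has_chain_mono:
  assumes r: "Card_order r" and R: "Well_order R" and le: "Field r \<lesssim> Field R" and h: "has_chain R b B I" and sub: "I \<subseteq> J"
  shows "has_chain r b B J"
proof -
  obtain V F where VF: "\<forall>i\<in>Field R. F i \<in> I \<and> V i \<in> B"
    "\<forall>i\<in>Field R. \<forall>j\<in>Field R. V i \<in> F j \<longleftrightarrow> (if b then i \<in> underS R j else j \<in> underS R i)"
    using h unfolding has_chain_def by (elim exE conjE)
  obtain e where e: "\<forall>j\<in>Field r. e j \<in> Field R" "\<forall>j\<in>Field r. \<forall>i\<in>underS r j. e i \<in> underS R (e j)"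
    using card_mono_into[OF r R order_refl le] by blast
  have wr: "Well_order r" using r unfolding card_order_on_def by simp
  have iff: "e i \<in> underS R (e j) \<longleftrightarrow> i \<in> underS r j" if "i \<in> Field r" "j \<in> Field r" for i j
    using underS_total[OF wr that] e(2) that underS_asym[OF R, of "e i" "e j"] underS_notIn[of "e j" R] by metis
  show ?thesis unfolding has_chain_def
    by (rule exI[of _ "V \<circ> e"], rule exI[of _ "F \<circ> e"]) (use VF e(1) iff sub in auto)
qed

text \<open>A well-order of smaller cardinality is isomorphic to a proper initial segment. The bound
  \<open>t\<close> will carry the distinguished child in the decreasing case.\<close>

lemma bounded_embedding:
  assumes r: "Card_order r" and w: "Well_order w" and less: "Field w \<prec> Field r"
  shows "\<exists>e. \<exists>t\<in>Field r. (\<forall>j\<in>Field w. e j \<in> underS r t) \<and> (\<forall>j\<in>Field w. \<forall>i\<in>underS w j. e i \<in> underS r (e j))"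
proof -
  have wr: "Well_order r" using r unfolding card_order_on_def by simp
  have "\<not> r \<le>o w"
    using card_of_mono2[of r w] less unfolding lepoll_iff_ordLeq[symmetric]
    by (meson lesspoll_trans1 lesspoll_not_refl)
  then have "w <o r" using w wr by (simp add: not_ordLeq_iff_ordLess)
  then obtain t where t: "t \<in> Field r" "w =o Restr r (underS r t)"
    using ordLess_iff_ordIso_Restr[OF wr w] by blast
  then have "w \<le>o Restr r (underS r t)" by (simp add: ordIso_imp_ordLeq)
  from mono_embedding[OF this] obtain e where e: "\<forall>j\<in>Field w. e j \<in> Field (Restr r (underS r t))"
    "\<forall>j\<in>Field w. \<forall>i\<in>underS w j. e i \<in> underS (Restr r (underS r t)) (e j)" by blast
  show ?thesis
    by (rule exI[of _ e], rule bexI[OF _ t(1)]) (use e in \<open>auto simp: underS_def Field_def\<close>)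
qed


text \<open>The demands of \<open>linear_tree\<close> on a single node, bundled so that the data can
  be chosen for all nodes at once.\<close>

definition split_ok :: "'a set set set set \<Rightarrow> 'a set set \<Rightarrow> 'k rel \<Rightarrow> ('k \<Rightarrow> 'k \<Rightarrow> bool) \<Rightarrow> 'a set set set \<Rightarrow>
    ('k \<Rightarrow> 'a set set set) \<Rightarrow> 'a set set set \<Rightarrow> ('k \<Rightarrow> 'a set) \<Rightarrow> ('k \<Rightarrow> 'a set set) \<Rightarrow> bool" where
  "split_ok \<I> B m prec I c cs v Vs \<longleftrightarrow> cs \<in> \<I> \<and> cs \<subseteq> I \<and> (\<forall>b\<in>Field m. c b \<in> \<I> \<and> c b \<subseteq> I \<and> Vs b \<subseteq> B \<and>
     (\<forall>F\<in>c b. v b \<in> F \<and> (\<forall>a\<in>Field m. \<not> prec a b \<longrightarrow> Vs a \<inter> F = {})) \<and>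
     (\<forall>a\<in>Field m. prec a b \<longrightarrow> v b \<in> Vs a) \<and> (\<forall>F\<in>cs. v b \<notin> F \<and> Vs b \<inter> F = {}))"

text \<open>Children are intervals of the chain cut out by consecutive witnesses: a filter with
  \<open>V i\<close> but without \<open>V (s i)\<close> is squeezed between members of the sequence
  and contains \<open>V j\<close> exactly for \<open>j\<close> up to \<open>i\<close>. As the
  filters grow with the index, the distinguished child sits at the least index
  \<open>z\<close>.\<close>

lemma split_inc:
  assumes r: "Card_order r" "infinite (Field r)" and m: "Well_order m" "Field m \<prec> Field r"
    and h: "has_chain r True B I" and chain: "\<And>F F'. F \<in> I \<Longrightarrow> F' \<in> I \<Longrightarrow> F \<subseteq> F' \<or> F' \<subseteq> F"
    and cl: "\<And>V V'. V \<in> B \<Longrightarrow> V' \<in> B \<Longrightarrow> {F\<in>I. V \<in> F \<and> V' \<notin> F} \<noteq> {} \<Longrightarrow> {F\<in>I. V \<in> F \<and> V' \<notin> F} \<in> \<I>"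
  shows "\<exists>c cs v Vs. split_ok \<I> B m (\<lambda>a b. a \<in> underS m b) I c cs v Vs"
proof -
  have wr: "Well_order r" using r unfolding card_order_on_def by simp
  obtain V F where VF: "\<And>i. i\<in>Field r \<Longrightarrow> F i \<in> I \<and> V i \<in> B"
    and iff: "\<And>i j. i\<in>Field r \<Longrightarrow> j\<in>Field r \<Longrightarrow> V i \<in> F j \<longleftrightarrow> i \<in> underS r j"
    using h unfolding has_chain_def if_True if_False by (elim exE conjE) (rule that, blast+)
  obtain s where s: "\<And>i. i \<in> Field r \<Longrightarrow> s i \<in> Field r \<and> i \<in> underS r (s i) \<and>
    (\<forall>j\<in>Field r. i \<in> underS r j \<longleftrightarrow> j = s i \<or> s i \<in> underS r j)"
    using card_order_succ[OF r] by metis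
  obtain e t where e: "\<And>j. j\<in>Field m \<Longrightarrow> e j \<in> underS r t"
    and em: "\<And>i j. j\<in>Field m \<Longrightarrow> i\<in>underS m j \<Longrightarrow> e i \<in> underS r (e j)"
    using bounded_embedding[OF r(1) m] by (elim exE bexE conjE) (rule that, blast+)
  obtain z where z: "z \<in> Field r" "\<And>j. j \<in> Field r \<Longrightarrow> j \<notin> underS r z"
  proof -
    obtain i where "i \<in> Field r" using r(2) by fastforce
    from wfE_min[OF well_order_wf[OF wr] this] obtain z where "z \<in> Field r" "\<And>y. (y, z) \<in> r - Id \<Longrightarrow> y \<notin> Field r"
      by blast
    then show ?thesis by (intro that[of z]) (auto simp: underS_def)
  qed
  have eF: "e a \<in> Field r" if "a \<in> Field m" for a using e[OF that] underS_Field' by fast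
  define ch where "ch i = {G\<in>I. V i \<in> G \<and> V (s i) \<notin> G}" for i
  have ch_iff: "V j \<in> G \<longleftrightarrow> j \<notin> underS r j \<and> (j = i \<or> j \<in> underS r i)" if i: "i \<in> Field r" and j: "j \<in> Field r" and G: "G \<in> ch i" for i j G
  proof -
    have GI: "G \<in> I" "V i \<in> G" "V (s i) \<notin> G" using G unfolding ch_def by auto
    have si: "s i \<in> Field r" using s[OF i] by simp
    have "V i \<notin> F i" using iff[OF i i] by (simp add: underS_def)
    then have "F i \<subseteq> G" using chain[of G "F i"] GI VF[OF i] by blast
    then have a: "V j \<in> G" if "j \<in> underS r i" using iff[OF j i] that by blast
    have b: "V j \<notin> G" if "s i \<in> underS r j"
    proof -
      have "V (s i) \<in> F j" using iff[OF si j] that by simp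
      then have "G \<subseteq> F j" using chain[of G "F j"] GI VF[OF j] by blast
      then show ?thesis using iff[OF j j] by (auto simp: underS_def)
    qed
    have "j = i \<or> j \<in> underS r i \<or> j = s i \<or> s i \<in> underS r j"
      using underS_total[OF wr i j] s[OF i] j by auto
    moreover have "j \<notin> underS r j" by (simp add: underS_def)
    moreover have "\<not> (s i = i \<or> s i \<in> underS r i)" 
    proof -
      have "i \<in> underS r (s i)" using s[OF i] by simp
      then show ?thesis using underS_asym[OF wr, of i "s i"] underS_notIn[of i r] by metis
    qed
    moreover have "\<not> (j = i \<or> j \<in> underS r i)" if "s i \<in> underS r j"
    proof -
      have "i \<in> underS r j" using that s[OF i] underS_trans[OF wr, of i "s i" j] by simp
      then show ?thesis using underS_asym[OF wr, of i j] by (auto simp: underS_def)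
    qed
    ultimately show ?thesis using a b GI(2,3) by auto
  qed
  have ch: "ch i \<in> \<I>" "ch i \<subseteq> I" if i: "i \<in> Field r" for i
  proof -
    have si: "s i \<in> Field r" using s[OF i] by simp
    have "F (s i) \<in> ch i" unfolding ch_def using VF[OF si] iff[OF i si] iff[OF si si] s[OF i] by (simp add: underS_def)
    then show "ch i \<in> \<I>" unfolding ch_def by (intro cl) (use VF[OF i] VF[OF si] in auto)
    show "ch i \<subseteq> I" unfolding ch_def by blast
  qed
  \<comment> \<open>The shift by \<open>s\<close> keeps the least index free for the distinguished
    child, which has to miss all witnesses \<open>V (k b)\<close>.\<close>
  define k where "k a = s (e a)" for a
  have kF: "k a \<in> Field r" if "a \<in> Field m" for a using s[OF eF[OF that]] unfolding k_def by simp
  have km: "k a \<in> underS r (k b)" if "a \<in> underS m b" for a b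
  proof -
    have ab: "a \<in> Field m" "b \<in> Field m" using underS_Field'[OF that] by auto
    have "e b = s (e a) \<or> s (e a) \<in> underS r (e b)" using s[OF eF[OF ab(1)]] em[OF ab(2) that] eF[OF ab(2)] by blast
    then show ?thesis using s[OF eF[OF ab(2)]] underS_trans[OF wr, of "s (e a)" "e b" "s (e b)"] unfolding k_def by metis
  qed
  have kz: "z \<in> underS r (k a)" if "a \<in> Field m" for a
    using underS_total[OF wr z(1) eF[OF that]] z(2)[OF eF[OF that]] s[OF eF[OF that]]
      underS_trans[OF wr, of z "e a" "k a"] unfolding k_def by blast
  define Vs where "Vs a = {V j | j. j \<in> Field r \<and> k a \<in> underS r j}" for a
  show ?thesis
  proof (intro exI)
    show "split_ok \<I> B m (\<lambda>a b. a \<in> underS m b) I (\<lambda>b. ch (k b)) (ch z) (\<lambda>b. V (k b)) Vs"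
      unfolding split_ok_def
    proof (intro conjI ballI impI)
      show "ch z \<in> \<I>" "ch z \<subseteq> I" using ch[OF z(1)] by auto
      fix b assume b: "b \<in> Field m"
      show "ch (k b) \<in> \<I>" "ch (k b) \<subseteq> I" using ch[OF kF[OF b]] by auto
      show "Vs b \<subseteq> B" unfolding Vs_def using VF by blast
      fix G
      show "V (k b) \<in> G" if "G \<in> ch (k b)" using that unfolding ch_def by simp
      show "Vs a \<inter> G = {}" if G: "G \<in> ch (k b)" and a: "a \<in> Field m" and nab: "a \<notin> underS m b" for a
      proof -
        have "V j \<notin> G" if j: "j \<in> Field r" "k a \<in> underS r j" for j
        proof
          assume "V j \<in> G"
          then have "j = k b \<or> j \<in> underS r (k b)" using ch_iff[OF kF[OF b] j(1) G] by blast
          then have "k a \<in> underS r (k b)" using j(2) underS_trans[OF wr] by blast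
          moreover have "a = b \<or> b \<in> underS m a" using underS_total[OF m(1) a b] nab by blast
          ultimately show False using km[of b a] underS_asym[OF wr] underS_notIn[of "k a" r] by blast
        qed
        then show ?thesis unfolding Vs_def by blast
      qed
      show "V (k b) \<in> Vs a" if "a \<in> Field m" "a \<in> underS m b" for a
        unfolding Vs_def using km[OF that(2)] kF[OF b] by blast
      assume G: "G \<in> ch z"
      show "V (k b) \<notin> G" using ch_iff[OF z(1) kF[OF b] G] kz[OF b] z(2)[OF kF[OF b]] by (auto simp: underS_def)
      have "V j \<notin> G" if j: "j \<in> Field r" "k b \<in> underS r j" for j
        using ch_iff[OF z(1) j(1) G] z(2)[OF j(1)] z(2)[OF kF[OF b]] j(2) by blast
      then show "Vs b \<inter> G = {}" unfolding Vs_def by blast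
    qed
  qed
qed

text \<open>Mirror image of the increasing case: the filters shrink as the index grows, so the
  distinguished child sits at the bound \<open>t\<close> above all indices in use, and
  \<open>Vs a\<close> collects the witnesses up to \<open>e a\<close>.\<close>

lemma split_dec:
  assumes r: "Card_order r" "infinite (Field r)" and m: "Well_order m" "Field m \<prec> Field r"
    and h: "has_chain r False B I" and chain: "\<And>F F'. F \<in> I \<Longrightarrow> F' \<in> I \<Longrightarrow> F \<subseteq> F' \<or> F' \<subseteq> F"
    and cl: "\<And>V V'. V \<in> B \<Longrightarrow> V' \<in> B \<Longrightarrow> {F\<in>I. V \<in> F \<and> V' \<notin> F} \<noteq> {} \<Longrightarrow> {F\<in>I. V \<in> F \<and> V' \<notin> F} \<in> \<I>"
  shows "\<exists>c cs v Vs. split_ok \<I> B m (\<lambda>a b. b \<in> underS m a) I c cs v Vs"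
proof -
  have wr: "Well_order r" using r unfolding card_order_on_def by simp
  obtain V F where VF: "\<And>i. i\<in>Field r \<Longrightarrow> F i \<in> I \<and> V i \<in> B"
    and iff: "\<And>i j. i\<in>Field r \<Longrightarrow> j\<in>Field r \<Longrightarrow> V i \<in> F j \<longleftrightarrow> j \<in> underS r i"
    using h unfolding has_chain_def if_True if_False by (elim exE conjE) (rule that, blast+)
  obtain s where s: "\<And>i. i \<in> Field r \<Longrightarrow> s i \<in> Field r \<and> i \<in> underS r (s i) \<and>
    (\<forall>j\<in>Field r. i \<in> underS r j \<longleftrightarrow> j = s i \<or> s i \<in> underS r j)"
    using card_order_succ[OF r] by metis
  obtain e t where t: "t \<in> Field r" and e: "\<And>j. j\<in>Field m \<Longrightarrow> e j \<in> underS r t"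
    and em: "\<And>i j. j\<in>Field m \<Longrightarrow> i\<in>underS m j \<Longrightarrow> e i \<in> underS r (e j)"
    using bounded_embedding[OF r(1) m] by (elim exE bexE conjE) (rule that, blast+)
  have eF: "e a \<in> Field r" if "a \<in> Field m" for a using e[OF that] underS_Field' by fast
  define ch where "ch i = {G\<in>I. V (s i) \<in> G \<and> V i \<notin> G}" for i
  have ch_in: "i \<in> underS r j" if i: "i \<in> Field r" and j: "j \<in> Field r" and G: "G \<in> ch i" and VG: "V j \<in> G" for i j G
  proof (rule ccontr)
    have GI: "G \<in> I" "V i \<notin> G" using G unfolding ch_def by auto
    assume "i \<notin> underS r j"
    then have "j = i \<or> j \<in> underS r i" using underS_total[OF wr i j] by blast
    then show False
    proof
      assume "j \<in> underS r i"
      then have "V i \<in> F j" using iff[OF i j] by simp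
      then have "G \<subseteq> F j" using chain[of G "F j"] GI VF[OF j] by blast
      then show False using iff[OF j j] VG by (auto simp: underS_def)
    qed (use VG GI in simp)
  qed
  have ch: "ch i \<in> \<I>" "ch i \<subseteq> I" if i: "i \<in> Field r" for i
  proof -
    have si: "s i \<in> Field r" using s[OF i] by simp
    have "F i \<in> ch i" unfolding ch_def using VF[OF i] iff[OF i i] iff[OF si i] s[OF i] by (simp add: underS_def)
    then show "ch i \<in> \<I>" unfolding ch_def by (intro cl) (use VF[OF i] VF[OF si] in auto)
    show "ch i \<subseteq> I" unfolding ch_def by blast
  qed
  define Vs where "Vs a = {V j | j. j = e a \<or> j \<in> underS r (e a)}" for a
  show ?thesis
  proof (intro exI)
    show "split_ok \<I> B m (\<lambda>a b. b \<in> underS m a) I (\<lambda>b. ch (e b)) (ch t) (\<lambda>b. V (s (e b))) Vs"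
      unfolding split_ok_def
    proof (intro conjI ballI impI)
      show "ch t \<in> \<I>" "ch t \<subseteq> I" using ch[OF t] by auto
      fix b assume b: "b \<in> Field m"
      have sb: "s (e b) \<in> Field r" using s[OF eF[OF b]] by simp
      show "ch (e b) \<in> \<I>" "ch (e b) \<subseteq> I" using ch[OF eF[OF b]] by auto
      show "Vs b \<subseteq> B" unfolding Vs_def using VF eF[OF b] underS_Field'[of _ r "e b"] by blast
      fix G
      show "V (s (e b)) \<in> G" if "G \<in> ch (e b)" using that unfolding ch_def by simp
      show "Vs a \<inter> G = {}" if G: "G \<in> ch (e b)" and a: "a \<in> Field m" and nab: "b \<notin> underS m a" for a
      proof -
        have "V j \<notin> G" if j: "j = e a \<or> j \<in> underS r (e a)" for j
        proof
          assume "V j \<in> G"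
          moreover have "j \<in> Field r" using j eF[OF a] underS_Field'[of _ r "e a"] by blast
          ultimately have "e b \<in> underS r j" using ch_in[OF eF[OF b] _ G] by blast
          then have "e b \<in> underS r (e a)" using j underS_trans[OF wr] by blast
          moreover have "a = b \<or> a \<in> underS m b" using underS_total[OF m(1) a b] nab by blast
          ultimately show False using em[OF b, of a] underS_asym[OF wr] underS_notIn[of "e a" r] by blast
        qed
        then show ?thesis unfolding Vs_def by blast
      qed
      show "V (s (e b)) \<in> Vs a" if "a \<in> Field m" "b \<in> underS m a" for a
        unfolding Vs_def using em[OF that] s[OF eF[OF b]] eF[OF that(1)] by auto
      assume G: "G \<in> ch t"
      have "s (e b) = t \<or> s (e b) \<in> underS r t" using s[OF eF[OF b]] e[OF b] t by auto
      then show "V (s (e b)) \<notin> G"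
        using ch_in[OF t sb G] underS_asym[OF wr, of t "s (e b)"] underS_notIn[of t r] by blast
      have "V j \<notin> G" if j: "j = e b \<or> j \<in> underS r (e b)" for j
      proof
        assume "V j \<in> G"
        moreover have "j \<in> Field r" using j eF[OF b] underS_Field'[of _ r "e b"] by blast
        ultimately have "t \<in> underS r j" using ch_in[OF t _ G] by blast
        moreover have "j \<in> underS r t" using j e[OF b] underS_trans[OF wr, of j "e b" t] by blast
        ultimately show False using underS_asym[OF wr] by blast
      qed
      then show "Vs b \<inter> G = {}" unfolding Vs_def by blast
    qed
  qed
qed

text \<open>\<open>linear_tree\<close> needs the same direction at every node; the work is to find a
  cylinder in which one direction is always available.\<close>

lemma chain_tree:
  fixes mu :: "nat \<Rightarrow> 'k rel" and r :: "nat \<Rightarrow> 'i rel"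
  assumes Kne: "K \<noteq> {}" and KB: "\<And>F. F \<in> K \<Longrightarrow> F \<subseteq> B"
    and chain: "\<And>F F'. F \<in> K \<Longrightarrow> F' \<in> K \<Longrightarrow> F \<subseteq> F' \<or> F' \<subseteq> F"
    and P: "\<And>F G. F \<in> K \<Longrightarrow> finite G \<Longrightarrow> G \<subseteq> F \<Longrightarrow> \<exists>x\<in>Z. x \<in> \<Inter>G \<and> (\<forall>V\<in>B - F. x \<notin> V)"
    and mu: "\<And>n. Well_order (mu n)" "\<And>n. Field (mu n) \<prec> Field (r n)"
    and r: "\<And>n. Card_order (r n)" "\<And>n. infinite (Field (r n))" "\<And>m n. m \<le> n \<Longrightarrow> Field (r m) \<lesssim> Field (r n)"
    and has: "\<And>G H n. finite G \<Longrightarrow> finite H \<Longrightarrow> G \<subseteq> B \<Longrightarrow> H \<subseteq> B \<Longrightarrow> cyl K G H \<noteq> {} \<Longrightarrow>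
      has_chain (r n) True B (cyl K G H) \<or> has_chain (r n) False B (cyl K G H)"
  shows "\<exists>b x. inj_on x (fin_seqs mu) \<and> x ` fin_seqs mu \<subseteq> Z \<and>
    (\<forall>\<eta>\<in>inf_seqs mu. \<exists>U\<in>gen B. \<forall>\<nu>\<in>fin_seqs mu. x \<nu> \<in> U \<longleftrightarrow>
      (\<exists>n<length \<nu>. take n \<nu> = restr \<eta> n \<and>
        (if b then \<eta> n \<in> underS (mu n) (\<nu> ! n) else \<nu> ! n \<in> underS (mu n) (\<eta> n))))"
proof -
  define \<I>0 where "\<I>0 = {I. I \<noteq> {} \<and> (\<exists>G H. finite G \<and> finite H \<and> G \<subseteq> B \<and> H \<subseteq> B \<and> I = cyl K G H)}"
  have wr: "Well_order (r n)" for n using r(1)[of n] unfolding card_order_on_def by simp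
  have \<I>0h: "has_chain (r n) True B I \<or> has_chain (r n) False B I" if "I \<in> \<I>0" for I n
    using that has unfolding \<I>0_def by blast
  have K0: "K \<in> \<I>0" unfolding \<I>0_def using Kne by (auto intro!: exI[of _ "{}"] simp: cyl_def)
  have \<I>0_cl: "{F\<in>I. V \<in> F \<and> V' \<notin> F} \<in> \<I>0"
    if "I \<in> \<I>0" "V \<in> B" "V' \<in> B" "{F\<in>I. V \<in> F \<and> V' \<notin> F} \<noteq> {}" for I V V'
  proof -
    have "\<exists>G H. finite G \<and> finite H \<and> G \<subseteq> B \<and> H \<subseteq> B \<and> I = cyl K G H" using that(1) unfolding \<I>0_def by simp
    then obtain G H where "finite G" "finite H" "G \<subseteq> B" "H \<subseteq> B" "I = cyl K G H" by (elim exE conjE)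
    then have "{F\<in>I. V \<in> F \<and> V' \<notin> F} = cyl K (insert V G) (insert V' H) \<and> finite (insert V G) \<and> finite (insert V' H) \<and>
      insert V G \<subseteq> B \<and> insert V' H \<subseteq> B"
      using that(2,3) unfolding cyl_def by auto
    then show ?thesis unfolding \<I>0_def using that(4) by blast
  qed
  \<comment> \<open>If some cylinder lacks an increasing sequence of some length, so do its
    subcylinders, also for greater lengths. There long sequences decrease, and shorter ones are
    obtained by thinning them.\<close>
  have "\<exists>b. \<exists>I1\<in>\<I>0. \<forall>I\<in>\<I>0. \<forall>n. I \<subseteq> I1 \<longrightarrow> has_chain (r n) b B I"
  proof (cases "\<forall>I\<in>\<I>0. \<forall>n. has_chain (r n) True B I")
    case True
    then show ?thesis using K0 by blast
  next
    case False
    then obtain I1 n1 where I1: "I1 \<in> \<I>0" "\<not> has_chain (r n1) True B I1" by blast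
    have "has_chain (r n) False B I" if I: "I \<in> \<I>0" "I \<subseteq> I1" for I n
    proof -
      let ?m = "max n n1"
      have "\<not> has_chain (r ?m) True B I"
        using has_chain_mono[OF r(1) wr r(3)[of n1 ?m] _ I(2)] I1(2) by auto
      then have "has_chain (r ?m) False B I" using \<I>0h[OF I(1)] by blast
      then show ?thesis using has_chain_mono[OF r(1) wr r(3)[of n ?m] _ subset_refl] by auto
    qed
    then show ?thesis using I1(1) by blast
  qed
  then obtain b I1 where I1: "I1 \<in> \<I>0" and b: "\<And>I n. I \<in> \<I>0 \<Longrightarrow> I \<subseteq> I1 \<Longrightarrow> has_chain (r n) b B I" by blast
  define prec where "prec n a a' = (if b then a \<in> underS (mu n) a' else a' \<in> underS (mu n) a)" for n a a'
  define \<I> where "\<I> = {I\<in>\<I>0. I \<subseteq> I1}"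
  have \<I>K: "I \<noteq> {} \<and> I \<subseteq> K" if "I \<in> \<I>" for I using that unfolding \<I>_def \<I>0_def cyl_def by auto
  have "\<exists>c cs v Vs. split_ok \<I> B (mu n) (prec n) I c cs v Vs" if I: "I \<in> \<I>" for I n
  proof -
    have I': "I \<in> \<I>0" "I \<subseteq> I1" using I unfolding \<I>_def by auto
    have ch: "F \<subseteq> F' \<or> F' \<subseteq> F" if "F \<in> I" "F' \<in> I" for F F' using chain \<I>K[OF I] that by blast
    have cl: "{F\<in>I. V \<in> F \<and> V' \<notin> F} \<in> \<I>" if "V \<in> B" "V' \<in> B" "{F\<in>I. V \<in> F \<and> V' \<notin> F} \<noteq> {}" for V V'
      using \<I>0_cl[OF I'(1) that] I'(2) unfolding \<I>_def by auto
    show ?thesis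
    proof (cases b)
      case True
      then show ?thesis
        using split_inc[OF r(1,2) mu, of n B I \<I>] ch cl b[OF I', of n] unfolding prec_def[abs_def] by simp
    next
      case False
      then show ?thesis
        using split_dec[OF r(1,2) mu, of n B I \<I>] ch cl b[OF I', of n] unfolding prec_def[abs_def] by simp
    qed
  qed
  then have "\<forall>I n. \<exists>c cs v Vs. I \<in> \<I> \<longrightarrow> split_ok \<I> B (mu n) (prec n) I c cs v Vs" by blast
  then obtain c cs v Vs where sp: "\<And>I n. I \<in> \<I> \<Longrightarrow> split_ok \<I> B (mu n) (prec n) I (c I n) (cs I n) (v I n) (Vs I n)"
    by metis
  have "\<exists>x. inj_on x (fin_seqs mu) \<and> x ` fin_seqs mu \<subseteq> Z \<and>
    (\<forall>\<eta>\<in>inf_seqs mu. \<exists>U\<in>gen B. \<forall>\<nu>\<in>fin_seqs mu.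
      x \<nu> \<in> U \<longleftrightarrow> (\<exists>n<length \<nu>. take n \<nu> = restr \<eta> n \<and> prec n (\<eta> n) (\<nu> ! n)))"
  proof (rule linear_tree[where \<I> = \<I> and K = K and c = c and cs = cs and v = v and Vs = Vs, OF _ \<I>K chain KB])
    show "I1 \<in> \<I>" unfolding \<I>_def using I1 by simp
    show "prec n a b \<or> prec n b a" if "a \<in> Field (mu n)" "b \<in> Field (mu n)" "a \<noteq> b" for n a b
      using underS_total[OF mu(1) that(1,2)] that(3) unfolding prec_def by auto
    show "\<not> prec n a a" for n a unfolding prec_def underS_def by simp
  qed (use sp P in \<open>auto simp: split_ok_def\<close>)
  then show ?thesis unfolding prec_def by (rule exI)
qed

section \<open>Strong limit cardinals of countable cofinality\<close>

lemma traces_mono: "Y \<subseteq> Y' \<Longrightarrow> P \<subseteq> P' \<Longrightarrow> traces P Y \<lesssim> traces P' Y'"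
proof -
  assume a: "Y \<subseteq> Y'" "P \<subseteq> P'"
  have "traces P Y \<subseteq> (\<lambda>T. T \<inter> Y) ` traces P' Y'"
  proof
    fix T assume "T \<in> traces P Y"
    then obtain W where "W \<in> P" "T = W \<inter> Y" unfolding traces_def by blast
    then have "W \<inter> Y' \<in> traces P' Y'" "T = (W \<inter> Y') \<inter> Y" using a unfolding traces_def by auto
    then show "T \<in> (\<lambda>T. T \<inter> Y) ` traces P' Y'" by blast
  qed
  then show ?thesis by (rule subset_image_lepoll)
qed

lemma traces_not_mono: "\<not> traces P Y \<lesssim> K \<Longrightarrow> Y \<subseteq> Y' \<Longrightarrow> P \<subseteq> P' \<Longrightarrow> \<not> traces P' Y' \<lesssim> K"
  using traces_mono lepoll_trans by metis

lemma traces_Un: "traces P (X \<union> Y) \<lesssim> traces P X \<times> traces P Y"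
proof -
  have "traces P (X \<union> Y) \<subseteq> (\<lambda>(S, T). S \<union> T) ` (traces P X \<times> traces P Y)"
  proof
    fix T assume "T \<in> traces P (X \<union> Y)"
    then obtain W where "W \<in> P" "T = W \<inter> (X \<union> Y)" unfolding traces_def by blast
    then have "(W \<inter> X, W \<inter> Y) \<in> traces P X \<times> traces P Y" "T = (\<lambda>(S, T). S \<union> T) (W \<inter> X, W \<inter> Y)"
      unfolding traces_def by auto
    then show "T \<in> (\<lambda>(S, T). S \<union> T) ` (traces P X \<times> traces P Y)" by (rule rev_image_eqI)
  qed
  then show ?thesis by (rule subset_image_lepoll)
qed

lemma traces_Un_lepoll:
  "infinite K \<Longrightarrow> traces P X \<lesssim> K \<Longrightarrow> traces P Y \<lesssim> K \<Longrightarrow> traces P (X \<union> Y) \<lesssim> K"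
  by (rule lepoll_trans[OF traces_Un Times_lepoll])

text \<open>A trace on the union is a sequence of traces on the pieces, so a countable union costs
  one exponential.\<close>

lemma traces_UN_lepoll:
  fixes E :: "nat \<Rightarrow> 'a set"
  assumes "infinite K" "\<And>m. traces P (E m) \<lesssim> K" shows "traces P (\<Union>m. E m) \<lesssim> Pow K"
proof -
  have "traces P (\<Union>m. E m) \<lesssim> Pow ((UNIV::nat set) \<times> K)"
    unfolding traces_def
  proof (rule funs_lepoll[where f = "\<lambda>m W. W \<inter> E m" and K = "\<lambda>m. traces P (E m)"])
    fix W W' assume "\<And>i. i \<in> (UNIV::nat set) \<Longrightarrow> W \<inter> E i = W' \<inter> E i"
    then show "W \<inter> (\<Union>m. E m) = W' \<inter> (\<Union>m. E m)" by blast
  qed (use assms in \<open>auto simp: traces_def\<close>)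
  also have "\<dots> \<lesssim> Pow K"
    using assms(1) by (intro Pow_lepoll_mono Times_lepoll nat_lepoll lepoll_refl)
  finally show ?thesis .
qed

lemma pr_embed:
  assumes R: "Well_order R" and r: "Well_order r" and e: "\<forall>j\<in>Field r. \<forall>i\<in>underS r j. e i \<in> underS R (e j)"
    and ij: "i \<in> Field r" "j \<in> Field r"
  shows "pr R b1 b2 (e i) (e j) \<longleftrightarrow> pr r b1 b2 i j"
proof (cases "i = j")
  case False
  then consider "i \<in> underS r j" | "j \<in> underS r i" using underS_total[OF r ij] by blast
  then show ?thesis
  proof cases
    case 1
    then have "e i \<in> underS R (e j)" using e ij by blast
    then show ?thesis using 1 unfolding pr_def by (auto simp: underS_def)
  next
    case 2
    then have a: "e j \<in> underS R (e i)" using e ij by blast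
    then have "e i \<notin> underS R (e j)" "i \<notin> underS r j" using underS_asym[OF R] underS_asym[OF r] 2 by blast+
    then show ?thesis using False a unfolding pr_def by (auto simp: underS_def)
  qed
qed (simp add: pr_def)

lemma lesspoll_not_lepoll: "A \<prec> B \<longleftrightarrow> \<not> B \<lesssim> A"
  using not_lepoll_iff by blast

text \<open>The sets \<open>\<Lambda> n\<close> stand for the cardinals \<lambda>_n from some
  infinite one on, and \<open>Lset\<close> for their sum \<lambda>.\<close>

locale lam_sets =
  fixes \<Lambda> :: "nat \<Rightarrow> 'k set"
  assumes inf: "infinite (\<Lambda> n)" and pow: "Pow (\<Lambda> n) \<lesssim> \<Lambda> (Suc n)"
begin

definition Lset :: "(nat \<times> 'k) set" where
  "Lset = (SIGMA n:UNIV. \<Lambda> n)"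

lemma Lam_mono: assumes "n \<le> m" shows "\<Lambda> n \<lesssim> \<Lambda> m"
  using assms
proof (induction m)
  case (Suc m)
  have "\<Lambda> m \<lesssim> \<Lambda> (Suc m)" using lepoll_Pow_self pow lepoll_trans by metis
  then show ?case using Suc by (metis lepoll_refl le_Suc_eq lepoll_trans)
qed simp

lemma Lam_less: assumes "n < m" shows "\<Lambda> n \<prec> \<Lambda> m"
proof -
  have "\<Lambda> n \<prec> Pow (\<Lambda> n)" by (rule lesspoll_Pow_self)
  also have "\<dots> \<lesssim> \<Lambda> m" using pow Lam_mono[of "Suc n" m] assms lepoll_trans by (metis Suc_leI)
  finally show ?thesis .
qed

lemma Lam_Lset: "\<Lambda> n \<lesssim> Lset"
  unfolding lepoll_def Lset_def by (intro exI[of _ "\<lambda>x. (n, x)"]) (auto simp: inj_on_def)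

lemma Lset_inf: "infinite Lset"
  using Lam_Lset[of 0] inf[of 0] by (meson finite_lepoll_infinite lepoll_iff_leqpoll infinite_le_lepoll lepoll_trans)

lemma Lset_lower: "{x\<in>Lset. fst x \<le> n} \<lesssim> \<Lambda> n"
proof -
  have "{x\<in>Lset. fst x \<le> n} = (SIGMA k:{..n}. \<Lambda> k)" unfolding Lset_def by auto
  also have "\<dots> \<lesssim> \<Lambda> n" using inf by (intro Sigma_lepoll) (auto intro: finite_lepoll Lam_mono)
  finally show ?thesis .
qed

text \<open>Countable cofinality of the sum: an injection into \<open>Lset\<close> is cut by its
  first coordinate.\<close>

lemma Lset_decomp:
  assumes "X \<lesssim> Lset"
  shows "\<exists>S. (\<forall>n. S n \<lesssim> \<Lambda> n) \<and> (\<forall>n m. n \<le> m \<longrightarrow> S n \<subseteq> S m) \<and> X = (\<Union>n::nat. S n)"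
proof -
  obtain f where f: "inj_on f X" "f ` X \<subseteq> Lset" using assms unfolding lepoll_def by blast
  let ?S = "\<lambda>n. {x\<in>X. fst (f x) \<le> n}"
  have "?S n \<lesssim> \<Lambda> n" for n
  proof -
    have "inj_on f (?S n)" using f(1) by (rule inj_on_subset) blast
    moreover have "f ` ?S n \<subseteq> {x\<in>Lset. fst x \<le> n}" using f(2) by auto
    ultimately have "?S n \<lesssim> {x\<in>Lset. fst x \<le> n}" unfolding lepoll_def by blast
    then show ?thesis using Lset_lower lepoll_trans by blast
  qed
  then show ?thesis by (intro exI[of _ ?S]) auto
qed

lemma Pow3: "Pow (Pow (Pow (\<Lambda> n))) \<lesssim> \<Lambda> (n + 3)"
proof -
  have "Pow (Pow (Pow (\<Lambda> n))) \<lesssim> Pow (Pow (\<Lambda> (Suc n)))" by (intro Pow_lepoll_mono pow)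
  also have "\<dots> \<lesssim> Pow (\<Lambda> (Suc (Suc n)))" by (intro Pow_lepoll_mono pow)
  also have "\<dots> \<lesssim> \<Lambda> (Suc (Suc (Suc n)))" by (rule pow)
  finally show ?thesis by (simp add: numeral_3_eq_3)
qed

lemma Lset_not: "\<not> X \<lesssim> Lset \<Longrightarrow> \<not> X \<lesssim> \<Lambda> n"
  using Lam_Lset lepoll_trans by blast

lemma traces_UN_large:
  fixes E :: "nat \<Rightarrow> 'a set"
  assumes "\<not> traces P (\<Union>m. E m) \<lesssim> \<Lambda> (Suc n)" shows "\<exists>m. \<not> traces P (E m) \<lesssim> \<Lambda> n"
  using traces_UN_lepoll[OF inf, of P E n] pow lepoll_trans assms by blast

definition ord :: "nat \<Rightarrow> 'k rel" where
  "ord n = |\<Lambda> n|"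

lemma Field_ord [simp]: "Field (ord n) = \<Lambda> n"
  unfolding ord_def by (rule Field_card_of)

lemma Card_ord: "Card_order (ord n)"
  unfolding ord_def by (rule card_of_Card_order)

lemma wo_ord: "Well_order (ord n)"
  using Card_ord[of n] unfolding card_order_on_def by simp

lemma pattern_ord:
  assumes "\<not> traces P X \<lesssim> \<Lambda> (n + 3)"
  shows "\<exists>y M b1 b2. (b1 \<or> b2) \<and> (\<forall>i\<in>\<Lambda> n. y i \<in> X \<and> (\<exists>Q\<subseteq>P. Q \<noteq> {} \<and> M i = \<Union>Q)) \<and>
    (\<forall>i\<in>\<Lambda> n. \<forall>j\<in>\<Lambda> n. y i \<in> M j \<longleftrightarrow> pr (ord n) b1 b2 i j)"
proof -
  have "\<not> traces P X \<lesssim> Pow (Pow (Pow (Field (ord n))))"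
    unfolding Field_ord using assms Pow3[of n] lepoll_trans by blast
  moreover have "infinite (Field (ord n))" unfolding Field_ord by (rule inf)
  ultimately show ?thesis using pattern[OF Card_ord, of n P X] unfolding Field_ord by blast
qed

lemma pigeonhole:
  assumes big: "\<not> traces P Y \<lesssim> Lset" and ty: "ty ` P \<lesssim> Lset"
  shows "\<exists>u. \<not> traces {W\<in>P. ty W = u} Y \<lesssim> Lset"
proof (rule ccontr)
  assume c: "\<not> ?thesis"
  have "traces P Y = (\<Union>u\<in>ty ` P. traces {W\<in>P. ty W = u} Y)" unfolding traces_def by auto
  moreover have "\<dots> \<lesssim> Lset" using c by (intro UN_lepoll[OF Lset_inf ty]) blast
  ultimately show False using big by simp
qed

text \<open>The sets that fail at some level contribute few traces altogether: countably many
  levels, at most \<lambda> types on each, and at most \<lambda> traces for each small type.\<close>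

lemma generic:
  fixes ty :: "nat \<Rightarrow> 'a set \<Rightarrow> 't"
  assumes big: "\<not> traces P Y \<lesssim> Lset" and ty: "\<And>n. ty n ` P \<lesssim> Lset"
  shows "\<exists>W\<in>P. \<forall>n. \<not> traces {W'\<in>P. ty n W' = ty n W} Y \<lesssim> Lset"
proof (rule ccontr)
  assume c: "\<not> ?thesis"
  let ?bad = "\<lambda>n. {u\<in>ty n ` P. traces {W'\<in>P. ty n W' = u} Y \<lesssim> Lset}"
  have "traces P Y \<subseteq> (\<Union>n. \<Union>u\<in>?bad n. traces {W'\<in>P. ty n W' = u} Y)"
  proof
    fix T assume "T \<in> traces P Y"
    then obtain W where W: "W \<in> P" "T = W \<inter> Y" unfolding traces_def by blast
    then obtain n where n: "traces {W'\<in>P. ty n W' = ty n W} Y \<lesssim> Lset" using c by blast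
    then have "ty n W \<in> ?bad n" using W(1) by simp
    moreover have "T \<in> traces {W'\<in>P. ty n W' = ty n W} Y" unfolding traces_def using W by blast
    ultimately show "T \<in> (\<Union>n. \<Union>u\<in>?bad n. traces {W'\<in>P. ty n W' = u} Y)" by blast
  qed
  moreover have "(\<Union>n. \<Union>u\<in>?bad n. traces {W'\<in>P. ty n W' = u} Y) \<lesssim> Lset"
  proof (rule UN_lepoll[OF Lset_inf nat_lepoll[OF Lset_inf]], rule UN_lepoll[OF Lset_inf])
    fix n show "?bad n \<lesssim> Lset" by (rule lepoll_trans[OF subset_imp_lepoll ty]) blast
  qed simp
  ultimately show False using big by (meson lepoll_trans subset_imp_lepoll)
qed

text \<open>Distinctness is demanded across levels only; within a level it follows from the pattern.
  The function \<open>f\<close> lets level \<open>n\<close> use a larger index set than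
  \<open>\<Lambda> n\<close>.\<close>

definition prodcfg :: "'a set set \<Rightarrow> 'a set \<Rightarrow> bool" where
  "prodcfg B Z \<longleftrightarrow> (\<exists>f y b1 b2. (\<forall>n::nat. n \<le> f n \<and> (b1 n \<or> b2 n)) \<and>
     (\<forall>n m. \<forall>i\<in>\<Lambda> (f n). \<forall>j\<in>\<Lambda> (f m). n \<noteq> m \<longrightarrow> y n i \<noteq> y m j) \<and> (\<forall>n. \<forall>i\<in>\<Lambda> (f n). y n i \<in> Z) \<and>
     (\<forall>\<eta>. (\<forall>n. \<eta> n \<in> \<Lambda> (f n)) \<longrightarrow>
        (\<exists>U\<in>gen B. \<forall>n. \<forall>i\<in>\<Lambda> (f n). y n i \<in> U \<longleftrightarrow> pr (ord (f n)) (b1 n) (b2 n) i (\<eta> n))))"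

end

section \<open>Assembling products from one pattern per level\<close>

locale lam_space = lam_sets \<Lambda> + base_space B Z for \<Lambda> :: "nat \<Rightarrow> 'k set" and B :: "'a set set" and Z
begin

text \<open>Only finite intersections of open sets are available. Since \<open>Opn n\<close>
  contains no later point, finitely many conditions suffice within it: all \<open>M l\<close> with
  \<open>l \<le> n\<close> if the sets contain the points of the other levels, and
  \<open>M n\<close> alone if they miss the earlier points.\<close>

lemma prodI:
  fixes y :: "nat \<Rightarrow> 'k \<Rightarrow> 'a" and f :: "nat \<Rightarrow> nat"
  assumes f: "\<And>n. n \<le> f n" and b: "\<And>n. b1 n \<or> b2 n"
    and Opn: "\<And>n. Opn n \<in> gen B" and M: "\<And>n i. i \<in> \<Lambda> (f n) \<Longrightarrow> M n i \<in> gen B"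
    and y: "\<And>n i. i \<in> \<Lambda> (f n) \<Longrightarrow> y n i \<in> Z \<and> y n i \<in> Opn n"
    and pat: "\<And>n i j. i \<in> \<Lambda> (f n) \<Longrightarrow> j \<in> \<Lambda> (f n) \<Longrightarrow> y n i \<in> M n j \<longleftrightarrow> pr (ord (f n)) (b1 n) (b2 n) i j"
    and out: "\<And>n m i. n < m \<Longrightarrow> i \<in> \<Lambda> (f m) \<Longrightarrow> y m i \<notin> Opn n"
    and alt: "(\<forall>n m. \<forall>i\<in>\<Lambda> (f n). \<forall>j\<in>\<Lambda> (f m). n \<noteq> m \<longrightarrow> y m j \<in> M n i) \<or>
              (\<forall>n m. \<forall>i\<in>\<Lambda> (f n). \<forall>j\<in>\<Lambda> (f m). m < n \<longrightarrow> y m j \<notin> M n i)"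
  shows "prodcfg B Z"
proof -
  have U: "\<exists>U\<in>gen B. \<forall>n. \<forall>i\<in>\<Lambda> (f n). y n i \<in> U \<longleftrightarrow> pr (ord (f n)) (b1 n) (b2 n) i (\<eta> n)"
    if \<eta>: "\<And>n. \<eta> n \<in> \<Lambda> (f n)" for \<eta>
    using alt
  proof
    assume in1: "\<forall>n m. \<forall>i\<in>\<Lambda> (f n). \<forall>j\<in>\<Lambda> (f m). n \<noteq> m \<longrightarrow> y m j \<in> M n i"
    define U where "U = (\<Union>n. (\<Inter>l\<in>{..n}. M l (\<eta> l)) \<inter> Opn n)"
    have "(\<Inter>l\<in>{..n}. M l (\<eta> l)) \<in> gen B" for n
      by (rule gen_INT) (use M \<eta> in auto)
    then have "U \<in> gen B" unfolding U_def by (intro gen_UN gen_Int Opn)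
    moreover have "y n i \<in> U \<longleftrightarrow> pr (ord (f n)) (b1 n) (b2 n) i (\<eta> n)" if i: "i \<in> \<Lambda> (f n)" for n i
    proof
      assume "y n i \<in> U"
      then obtain k where k: "\<And>l. l \<le> k \<Longrightarrow> y n i \<in> M l (\<eta> l)" "y n i \<in> Opn k" unfolding U_def by auto
      have "n \<le> k" using out[OF _ i, of k] k(2) by (meson not_le)
      then show "pr (ord (f n)) (b1 n) (b2 n) i (\<eta> n)" using k(1) pat[OF i \<eta>] by blast
    next
      assume p: "pr (ord (f n)) (b1 n) (b2 n) i (\<eta> n)"
      have "y n i \<in> M l (\<eta> l)" for l
      proof (cases "l = n")
        case True
        then show ?thesis using pat[OF i \<eta>] p by simp
      qed (use in1 \<eta> i in blast)
      then show "y n i \<in> U" unfolding U_def using y[OF i] by blast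
    qed
    ultimately show ?thesis by blast
  next
    assume out1: "\<forall>n m. \<forall>i\<in>\<Lambda> (f n). \<forall>j\<in>\<Lambda> (f m). m < n \<longrightarrow> y m j \<notin> M n i"
    define U where "U = (\<Union>n. M n (\<eta> n) \<inter> Opn n)"
    have "U \<in> gen B" unfolding U_def by (intro gen_UN gen_Int Opn M \<eta>)
    moreover have "y n i \<in> U \<longleftrightarrow> pr (ord (f n)) (b1 n) (b2 n) i (\<eta> n)" if i: "i \<in> \<Lambda> (f n)" for n i
    proof
      assume "y n i \<in> U"
      then obtain k where k: "y n i \<in> M k (\<eta> k)" "y n i \<in> Opn k" unfolding U_def by auto
      have "n \<le> k" using out[OF _ i, of k] k(2) by (meson not_le)
      moreover have "\<not> n < k" using out1 k(1) \<eta> i by blast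
      ultimately have "k = n" by simp
      then show "pr (ord (f n)) (b1 n) (b2 n) i (\<eta> n)" using k(1) pat[OF i \<eta>] by blast
    next
      assume p: "pr (ord (f n)) (b1 n) (b2 n) i (\<eta> n)"
      then show "y n i \<in> U" unfolding U_def using pat[OF i \<eta>] y[OF i] by blast
    qed
    ultimately show ?thesis by blast
  qed
  have dist: "y n i \<noteq> y m j" if "i \<in> \<Lambda> (f n)" "j \<in> \<Lambda> (f m)" "n \<noteq> m" for n m i j
  proof (cases "n < m")
    case True
    then show ?thesis using out[OF True that(2)] y[OF that(1)] by auto
  next
    case False
    then have "m < n" using that(3) by simp
    then show ?thesis using out[OF _ that(1)] y[OF that(2)] by auto
  qed
  show ?thesis unfolding prodcfg_def
    by (rule exI[of _ f], rule exI[of _ y], rule exI[of _ b1], rule exI[of _ b2])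
      (use f b y dist U in \<open>intro conjI allI ballI impI; simp\<close>)
qed

text \<open>Adding \<open>A n\<close>, which contains all later points, and the earlier
  \<open>Opn l\<close>, which contain the earlier points, turns every pattern set into one that
  contains the other levels, without touching the points of its own level.\<close>

lemma separated_sequence:
  assumes X: "\<And>n. X n \<subseteq> Z" "\<And>n. \<not> traces (gen B) (X n) \<lesssim> \<Lambda> (n + 3)"
    and OA: "\<And>n. Opn n \<in> gen B" "\<And>n. A n \<in> gen B" "\<And>n. X n \<subseteq> Opn n - A n"
    and later: "\<And>n m. n < m \<Longrightarrow> X m \<subseteq> A n - Opn n"
  shows "prodcfg B Z"
proof -
  from pattern_ord[OF X(2)] have "\<forall>n. \<exists>y M b1 b2. (b1 \<or> b2) \<and>
    (\<forall>i\<in>\<Lambda> n. y i \<in> X n \<and> (\<exists>Q\<subseteq>gen B. Q \<noteq> {} \<and> M i = \<Union>Q)) \<and>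
    (\<forall>i\<in>\<Lambda> n. \<forall>j\<in>\<Lambda> n. y i \<in> M j \<longleftrightarrow> pr (ord n) b1 b2 i j)" by blast
  then obtain y M b1 b2 where p: "\<And>n. (b1 n \<or> b2 n) \<and>
    (\<forall>i\<in>\<Lambda> n. y n i \<in> X n \<and> (\<exists>Q\<subseteq>gen B. Q \<noteq> {} \<and> M n i = \<Union>Q)) \<and>
    (\<forall>i\<in>\<Lambda> n. \<forall>j\<in>\<Lambda> n. y n i \<in> M n j \<longleftrightarrow> pr (ord n) (b1 n) (b2 n) i j)" by metis
  define N where "N n i = M n i \<union> A n \<union> (\<Union>l\<in>{..<n}. Opn l)" for n i
  have yX: "y n i \<in> X n" if "i \<in> \<Lambda> n" for n i using p that by blast
  have MB: "M n i \<in> gen B" if "i \<in> \<Lambda> n" for n i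
  proof -
    have "\<exists>Q\<subseteq>gen B. Q \<noteq> {} \<and> M n i = \<Union>Q" using p[of n] that by simp
    then show ?thesis by (elim exE conjE) (simp add: gen_Union)
  qed
  show ?thesis
  proof (rule prodI[where f = "\<lambda>n. n" and y = y and M = N and Opn = Opn and ?b1.0 = b1 and ?b2.0 = b2])
    show "b1 n \<or> b2 n" for n using p by blast
    show "N n i \<in> gen B" if "i \<in> \<Lambda> n" for n i
      unfolding N_def by (intro gen_Un gen_UN MB OA that)
    show "y n i \<in> Z \<and> y n i \<in> Opn n" if "i \<in> \<Lambda> n" for n i using yX[OF that] X(1) OA(3) by blast
    show "y n i \<in> N n j \<longleftrightarrow> pr (ord n) (b1 n) (b2 n) i j" if "i \<in> \<Lambda> n" "j \<in> \<Lambda> n" for n i j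
    proof -
      have "y n i \<notin> A n" using yX[OF that(1)] OA(3) by blast
      moreover have "y n i \<notin> Opn l" if "l < n" for l using yX[OF \<open>i \<in> \<Lambda> n\<close>] later[OF that] by blast
      ultimately show ?thesis using p that unfolding N_def by auto
    qed
    show "y m i \<notin> Opn n" if "n < m" "i \<in> \<Lambda> m" for n m i using later[OF that(1)] yX[OF that(2)] by blast
    have "y m j \<in> N n i" if "j \<in> \<Lambda> m" "n \<noteq> m" for n m i j
    proof (cases "n < m")
      case True
      then show ?thesis using later[OF True] yX[OF that(1)] unfolding N_def by blast
    next
      case False
      then have "m < n" using that(2) by simp
      moreover have "y m j \<in> Opn m" using yX[OF that(1)] OA(3) by blast
      ultimately show ?thesis unfolding N_def by blast
    qed
    then show "(\<forall>n m. \<forall>i\<in>\<Lambda> n. \<forall>j\<in>\<Lambda> m. n \<noteq> m \<longrightarrow> y m j \<in> N n i) \<or>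
      (\<forall>n m. \<forall>i\<in>\<Lambda> n. \<forall>j\<in>\<Lambda> m. m < n \<longrightarrow> y m j \<notin> N n i)" by blast
  qed (use OA in auto)
qed

lemma split_sequence_prodcfg:
  fixes A U V :: "nat \<Rightarrow> 'a set"
  assumes "A 0 \<subseteq> Z" and s: "\<And>n. U n \<in> gen B \<and> V n \<in> gen B \<and> A (Suc n) = A n \<inter> U n - V n \<and>
    \<not> traces (gen B) (A n \<inter> V n - U n) \<lesssim> \<Lambda> (n + 3)"
  shows "prodcfg B Z"
proof -
  have A: "A m \<subseteq> A n" if "n \<le> m" for n m using that
    by (induction m rule: dec_induct) (use s in blast)+
  have AZ: "A n \<subseteq> Z" for n using A[of 0 n] assms(1) by blast
  show ?thesis
  proof (rule separated_sequence[where X = "\<lambda>n. A n \<inter> V n - U n" and Opn = V and A = U])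
    fix n m :: nat assume "n < m"
    then have "A m \<subseteq> A (Suc n)" using A by simp
    then show "A m \<inter> V m - U m \<subseteq> U n - V n" using s[of n] by blast
  qed (use s AZ in auto)
qed

end

section \<open>Spaces of strong limit size\<close>

locale lam_base = lam_space \<Lambda> B Z for \<Lambda> :: "nat \<Rightarrow> 'k set" and B :: "'a set set" and Z +
  assumes BL: "B \<lesssim> Lset"
begin

definition Bn :: "nat \<Rightarrow> 'a set set" where
  "Bn = (SOME S. (\<forall>n. S n \<lesssim> \<Lambda> n) \<and> (\<forall>n m. n \<le> m \<longrightarrow> S n \<subseteq> S m) \<and> B = (\<Union>n::nat. S n))"

lemma Bn: "Bn n \<lesssim> \<Lambda> n" "n \<le> m \<Longrightarrow> Bn n \<subseteq> Bn m" "B = (\<Union>n. Bn n)"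
  using someI_ex[OF Lset_decomp[OF BL]] unfolding Bn_def[symmetric] by auto

lemma Bn_B: "Bn n \<subseteq> B"
  using Bn(3) by blast

text \<open>The part of \<open>W\<close> generated by the n-th piece of the base. It takes at most
  \<open>2^(\<Lambda> n)\<close> values, however many open sets there are.\<close>

definition ap :: "nat \<Rightarrow> 'a set \<Rightarrow> 'a set" where
  "ap n W = \<Union>{V\<in>Bn n. V \<subseteq> W}"

lemma ap_gen: "ap n W \<in> gen B"
  unfolding ap_def by (rule gen_sub) (use Bn_B in blast)

lemma ap_sub: "ap n W \<subseteq> W"
  unfolding ap_def by blast

lemma ap_mono: "n \<le> m \<Longrightarrow> ap n W \<subseteq> ap m W"
  unfolding ap_def using Bn(2) by blast

lemma ap_UN: assumes "W \<in> gen B" shows "(\<Union>n. ap n W) = W"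
proof (intro equalityI subsetI)
  fix x assume "x \<in> W"
  from gen_E[OF assms this] obtain V where V: "V \<in> B" "x \<in> V" "V \<subseteq> W" by blast
  then obtain n where "V \<in> Bn n" using Bn(3) by blast
  then have "x \<in> ap n W" unfolding ap_def using V by blast
  then show "x \<in> (\<Union>n. ap n W)" by blast
qed (use ap_sub in blast)

lemma ap_lepoll: "ap n ` P \<lesssim> Lset"
proof -
  have "ap n ` P \<subseteq> Union ` Pow (Bn n)" unfolding ap_def by blast
  then have "ap n ` P \<lesssim> Pow (Bn n)" by (rule subset_image_lepoll)
  also have "\<dots> \<lesssim> Pow (\<Lambda> n)" by (rule Pow_lepoll_mono[OF Bn(1)])
  also have "\<dots> \<lesssim> Lset" using pow Lam_Lset lepoll_trans by metis
  finally show ?thesis .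
qed

text \<open>The pattern makes the sets \<open>M i \<inter> E\<close> pairwise distinct, and each of
  them is a union of traces on \<open>E\<close>. Hence few traces on \<open>E\<close> leave room for
  few pattern points in \<open>E\<close>.\<close>

lemma pattern_missed:
  assumes pat: "\<forall>i\<in>I. \<forall>j\<in>I. y i \<in> M j \<longleftrightarrow> pr r b1 b2 i j" and b: "b1 \<or> b2" and wr: "Well_order r" and I: "I \<subseteq> Field r"
    and M: "\<And>i. i \<in> I \<Longrightarrow> \<exists>S\<subseteq>Q. M i = \<Union>S" and E: "\<And>i. i \<in> I \<Longrightarrow> y i \<in> E"
  shows "I \<lesssim> Pow (traces Q E)"
proof -
  have inj: "inj_on (\<lambda>i. M i \<inter> E) I"
  proof (rule inj_onI, rule ccontr)
    fix i j assume ij: "i \<in> I" "j \<in> I" "M i \<inter> E = M j \<inter> E" "i \<noteq> j"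
    have "y i \<in> M i \<longleftrightarrow> y i \<in> M j" "y j \<in> M i \<longleftrightarrow> y j \<in> M j" using ij(3) E[OF ij(1)] E[OF ij(2)] by blast+
    then have "\<not> pr r b1 b2 i j" "\<not> pr r b1 b2 j i" using pat ij(1,2) by (auto simp: pr_def)
    moreover have "i = j \<or> i \<in> underS r j \<or> j \<in> underS r i"
      by (rule underS_total[OF wr]) (use ij I in auto)
    moreover have "\<not> (i \<in> underS r j \<and> j \<in> underS r i)" using underS_asym[OF wr, of i j] by blast
    ultimately show False using b ij(4) unfolding pr_def by (auto split: if_splits)
  qed
  have "(\<lambda>i. M i \<inter> E) ` I \<subseteq> Union ` Pow (traces Q E)"
  proof
    fix T assume "T \<in> (\<lambda>i. M i \<inter> E) ` I"
    then obtain i where i: "i \<in> I" "T = M i \<inter> E" by blast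
    from M[OF i(1)] obtain S where S: "S \<subseteq> Q" "M i = \<Union>S" by (elim exE conjE)
    have "T = \<Union>((\<lambda>W. W \<inter> E) ` S)" "(\<lambda>W. W \<inter> E) ` S \<in> Pow (traces Q E)"
      using S i(2) unfolding traces_def by auto
    then show "T \<in> Union ` Pow (traces Q E)" by (rule image_eqI)
  qed
  then have "(\<lambda>i. M i \<inter> E) ` I \<lesssim> Pow (traces Q E)" by (rule subset_image_lepoll)
  then show ?thesis using inj by simp
qed

text \<open>A generic \<open>W\<close> supplies both the opens \<open>ap n W\<close> of the product and, since every member of \<open>Q\<close>
  misses few traces, patterns whose points lie in all the sets of the other levels.\<close>

lemma few_missed_traces_prodcfg:
  assumes Q: "Q \<subseteq> gen B" and Y: "Y \<subseteq> Z" and big: "\<not> traces Q Y \<lesssim> Lset"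
    and up: "\<And>W. W \<in> Q \<Longrightarrow> traces Q (Y - W) \<lesssim> \<Lambda> k"
  shows "prodcfg B Z"
proof -
  obtain W where W: "W \<in> Q" and gW: "\<And>n. \<not> traces {W'\<in>Q. ap n W' = ap n W} Y \<lesssim> Lset"
    using generic[where ty = ap, OF big ap_lepoll] by blast
  define Qn where "Qn n = {W'\<in>Q. ap n W' = ap n W}" for n
  have QnQ: "Qn n \<subseteq> Q" for n unfolding Qn_def by blast
  \<comment> \<open>Few traces live outside \<open>W\<close>, so the many traces of the type class
    live on \<open>W\<close>, and then already on one of its countably many approximations.\<close>
  have step: "\<exists>m>n. \<not> traces (Qn n) (Y \<inter> ap m W) \<lesssim> \<Lambda> p" for n p
  proof -
    have "Y = (Y \<inter> W) \<union> (Y - W)" by blast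
    moreover have "traces (Qn n) (Y - W) \<lesssim> Lset"
      using traces_mono[OF subset_refl QnQ] up[OF W] Lam_Lset lepoll_trans by metis
    ultimately have "\<not> traces (Qn n) (Y \<inter> W) \<lesssim> Lset"
      using traces_Un_lepoll[OF Lset_inf, of "Qn n" "Y \<inter> W" "Y - W"] gW[of n] unfolding Qn_def by auto
    moreover have "Y \<inter> W = (\<Union>m. Y \<inter> ap m W)" using ap_UN[of W] W Q by blast
    ultimately have "\<not> traces (Qn n) (\<Union>m. Y \<inter> ap m W) \<lesssim> \<Lambda> (Suc p)" using Lset_not by simp
    then obtain m where m: "\<not> traces (Qn n) (Y \<inter> ap m W) \<lesssim> \<Lambda> p" using traces_UN_large by blast
    have "\<not> traces (Qn n) (Y \<inter> ap (max m (Suc n)) W) \<lesssim> \<Lambda> p"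
      by (rule traces_not_mono[OF m _ subset_refl]) (use ap_mono[of m "max m (Suc n)" W] in auto)
    then show ?thesis by (intro exI[of _ "max m (Suc n)"]) auto
  qed
  then obtain nxt where nxt: "\<And>n p. n < nxt n p \<and> \<not> traces (Qn n) (Y \<inter> ap (nxt n p) W) \<lesssim> \<Lambda> p" by metis
  \<comment> \<open>Each set of an earlier level misses at most \<open>\<Lambda> (Suc k)\<close>
    indices of level \<open>n\<close>, and there are at most \<open>\<Lambda> (k + 1 + n)\<close>
    such sets; the size \<open>\<Lambda> (k + 2 + n)\<close> survives the loss.\<close>
  define g where "g n = k + 2 + n" for n :: nat
  define kk where "kk = rec_nat 0 (\<lambda>n l. nxt l (g n + 3))"
  have kk: "kk (Suc n) = nxt (kk n) (g n + 3)" for n unfolding kk_def by simp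
  have "kk n \<le> kk (Suc n)" for n unfolding kk using nxt by (simp add: less_imp_le)
  then have kk_mono: "n \<le> m \<Longrightarrow> kk n \<le> kk m" for n m by (rule lift_Suc_mono_le)
  have "\<forall>n. \<exists>y M b1 b2. (b1 \<or> b2) \<and>
    (\<forall>i\<in>\<Lambda> (g n). y i \<in> Y \<inter> ap (kk (Suc n)) W \<and> (\<exists>S\<subseteq>Qn (kk n). S \<noteq> {} \<and> M i = \<Union>S)) \<and>
    (\<forall>i\<in>\<Lambda> (g n). \<forall>j\<in>\<Lambda> (g n). y i \<in> M j \<longleftrightarrow> pr (ord (g n)) b1 b2 i j)"
    unfolding kk using nxt by (intro allI pattern_ord) simp
  then obtain y M b1 b2 where b: "\<And>n. b1 n \<or> b2 n"
    and y: "\<And>n i. i\<in>\<Lambda> (g n) \<Longrightarrow> y n i \<in> Y \<inter> ap (kk (Suc n)) W"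
    and M: "\<And>n i. i\<in>\<Lambda> (g n) \<Longrightarrow> \<exists>S\<subseteq>Qn (kk n). S \<noteq> {} \<and> M n i = \<Union>S"
    and pat: "\<And>n. \<forall>i\<in>\<Lambda> (g n). \<forall>j\<in>\<Lambda> (g n). y n i \<in> M n j \<longleftrightarrow> pr (ord (g n)) (b1 n) (b2 n) i j" by metis
  have Mge: "ap (kk n) W \<subseteq> M n i" and MB: "M n i \<in> gen B" and MQ: "\<exists>W'\<in>Q. W' \<subseteq> M n i" if "i \<in> \<Lambda> (g n)" for n i
  proof -
    from M[OF that] obtain S where S: "S \<subseteq> Qn (kk n)" "S \<noteq> {}" "M n i = \<Union>S" by (elim exE conjE)
    from S(2) obtain W' where W': "W' \<in> S" by blast
    then have "ap (kk n) W' = ap (kk n) W" using S(1) unfolding Qn_def by blast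
    then show "ap (kk n) W \<subseteq> M n i" using ap_sub[of "kk n" W'] W' S(3) by auto
    show "M n i \<in> gen B" unfolding S(3) by (rule gen_Union) (use S(1) QnQ Q in blast)
    show "\<exists>W'\<in>Q. W' \<subseteq> M n i" using W' S(1,3) QnQ by blast
  qed
  \<comment> \<open>The indices whose points belong to every set of every earlier level; later
    points are thereby put inside earlier sets.\<close>
  define H where "H n = {i\<in>\<Lambda> (g n). \<forall>l<n. \<forall>j\<in>\<Lambda> (g l). y n i \<in> M l j}" for n
  have few: "{i\<in>\<Lambda> (g n). y n i \<notin> M l j} \<lesssim> \<Lambda> (Suc k)" if "j \<in> \<Lambda> (g l)" for n l j
  proof -
    from MQ[OF that] obtain W' where W': "W' \<in> Q" "W' \<subseteq> M l j" by blast
    let ?I = "{i\<in>\<Lambda> (g n). y n i \<notin> M l j}"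
    have "?I \<lesssim> Pow (traces Q (Y - W'))"
    proof (rule pattern_missed[OF _ b[of n] wo_ord])
      show "\<forall>i\<in>?I. \<forall>j\<in>?I. y n i \<in> M n j \<longleftrightarrow> pr (ord (g n)) (b1 n) (b2 n) i j" using pat by simp
      show "\<exists>S\<subseteq>Q. M n i = \<Union>S" if "i \<in> ?I" for i
      proof -
        have "i \<in> \<Lambda> (g n)" using that by simp
        from M[OF this] obtain S where "S \<subseteq> Qn (kk n)" "M n i = \<Union>S" by (elim exE conjE)
        then show ?thesis using QnQ[of "kk n"] by (intro exI[of _ S]) simp
      qed
    qed (use y W'(2) in auto)
    also have "\<dots> \<lesssim> Pow (\<Lambda> k)" by (rule Pow_lepoll_mono[OF up[OF W'(1)]])
    also have "\<dots> \<lesssim> \<Lambda> (Suc k)" by (rule pow)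
    finally show ?thesis .
  qed
  have Hbig: "\<Lambda> (g n) \<lesssim> H n" for n
  proof (rule ccontr)
    assume "\<not> \<Lambda> (g n) \<lesssim> H n"
    then have H1: "H n \<prec> \<Lambda> (g n)" by (simp add: not_lepoll_iff)
    have "(\<Union>l\<in>{..<n}. \<Union>j\<in>\<Lambda> (g l). {i\<in>\<Lambda> (g n). y n i \<notin> M l j}) \<lesssim> \<Lambda> (k + 1 + n)"
    proof (rule UN_lepoll[OF inf])
      show "{..<n} \<lesssim> \<Lambda> (k + 1 + n)" by (rule nat_lepoll[OF inf])
      fix l assume l: "l \<in> {..<n}"
      show "(\<Union>j\<in>\<Lambda> (g l). {i\<in>\<Lambda> (g n). y n i \<notin> M l j}) \<lesssim> \<Lambda> (k + 1 + n)"
      proof (rule UN_lepoll[OF inf])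
        show "\<Lambda> (g l) \<lesssim> \<Lambda> (k + 1 + n)" by (rule Lam_mono) (use l in \<open>simp add: g_def\<close>)
        show "{i\<in>\<Lambda> (g n). y n i \<notin> M l j} \<lesssim> \<Lambda> (k + 1 + n)" if "j \<in> \<Lambda> (g l)" for j
          using few[OF that] Lam_mono[of "Suc k" "k + 1 + n"] lepoll_trans by (metis Suc_eq_plus1 le_add1)
      qed
    qed
    also have "\<Lambda> (k + 1 + n) \<prec> \<Lambda> (g n)" by (rule Lam_less) (simp add: g_def)
    finally have R1: "(\<Union>l\<in>{..<n}. \<Union>j\<in>\<Lambda> (g l). {i\<in>\<Lambda> (g n). y n i \<notin> M l j}) \<prec> \<Lambda> (g n)" .
    have "(\<Union>c\<in>(UNIV::bool set). if c then H n else (\<Union>l\<in>{..<n}. \<Union>j\<in>\<Lambda> (g l). {i\<in>\<Lambda> (g n). y n i \<notin> M l j})) \<prec> \<Lambda> (g n)"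
      using H1 R1 inf by (intro finite_UN_lesspoll) auto
    moreover have "\<Lambda> (g n) \<subseteq> (\<Union>c\<in>(UNIV::bool set). if c then H n else (\<Union>l\<in>{..<n}. \<Union>j\<in>\<Lambda> (g l). {i\<in>\<Lambda> (g n). y n i \<notin> M l j}))"
      unfolding H_def by (auto simp: UNIV_bool)
    ultimately show False by (meson lesspoll_trans1 lesspoll_not_refl subset_imp_lepoll)
  qed
  have "\<exists>e. (\<forall>j\<in>\<Lambda> (g n). e j \<in> H n) \<and> (\<forall>j\<in>\<Lambda> (g n). \<forall>i\<in>underS (ord (g n)) j. e i \<in> underS (ord (g n)) (e j))" for n
    using card_mono_into[OF Card_ord[of "g n"] wo_ord[of "g n"], of "H n"] Hbig[of n] unfolding Field_ord H_def by blast
  then obtain e where eH: "\<And>n j. j\<in>\<Lambda> (g n) \<Longrightarrow> e n j \<in> H n"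
    and em: "\<And>n. \<forall>j\<in>\<Lambda> (g n). \<forall>i\<in>underS (ord (g n)) j. e n i \<in> underS (ord (g n)) (e n j)" by metis
  have eL: "e n j \<in> \<Lambda> (g n)" if "j \<in> \<Lambda> (g n)" for n j using eH[OF that] unfolding H_def by blast
  show ?thesis
  proof (rule prodI[where f = g and y = "\<lambda>n i. y n (e n i)" and M = "\<lambda>n i. M n (e n i)"
        and Opn = "\<lambda>n. ap (kk (Suc n)) W" and ?b1.0 = b1 and ?b2.0 = b2, OF _ b ap_gen MB[OF eL]])
    show "n \<le> g n" for n unfolding g_def by simp
    show "y n (e n i) \<in> Z \<and> y n (e n i) \<in> ap (kk (Suc n)) W" if "i \<in> \<Lambda> (g n)" for n i
      using y[OF eL[OF that]] Y by blast
    show "y n (e n i) \<in> M n (e n j) \<longleftrightarrow> pr (ord (g n)) (b1 n) (b2 n) i j" if "i \<in> \<Lambda> (g n)" "j \<in> \<Lambda> (g n)" for n i j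
      using pat eL[OF that(1)] eL[OF that(2)] pr_embed[OF wo_ord wo_ord, of "g n" "e n" "g n" i j] em[of n] that by simp
    show "y m (e m i) \<notin> ap (kk (Suc n)) W" if "n < m" "i \<in> \<Lambda> (g m)" for n m i
    proof -
      \<comment> \<open>The diagonal is false, and \<open>M m\<close> includes the approximation of
        its stage; so the point lies outside that approximation and outside all earlier
        ones.\<close>
      have "y m (e m i) \<notin> M m (e m i)" using pat eL[OF that(2)] by (simp add: pr_def)
      moreover have "ap (kk (Suc n)) W \<subseteq> ap (kk m) W" using that(1) kk_mono by (intro ap_mono) simp
      ultimately show ?thesis using Mge[OF eL[OF that(2)]] by blast
    qed
    have "y m (e m j) \<in> M n (e n i)" if i: "i \<in> \<Lambda> (g n)" and j: "j \<in> \<Lambda> (g m)" and nm: "n \<noteq> m" for n m i j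
    proof (cases "n < m")
      case True
      then show ?thesis using eH[OF j] eL[OF i] unfolding H_def by blast
    next
      case False
      then have "Suc m \<le> n" using nm by simp
      then have "ap (kk (Suc m)) W \<subseteq> ap (kk n) W" by (intro ap_mono kk_mono)
      then show ?thesis using y[OF eL[OF j]] Mge[OF eL[OF i]] by blast
    qed
    then show "(\<forall>n m. \<forall>i\<in>\<Lambda> (g n). \<forall>j\<in>\<Lambda> (g m). n \<noteq> m \<longrightarrow> y m (e m j) \<in> M n (e n i)) \<or>
      (\<forall>n m. \<forall>i\<in>\<Lambda> (g n). \<forall>j\<in>\<Lambda> (g m). m < n \<longrightarrow> y m (e m j) \<notin> M n (e n i))" by blast
  qed
qed

text \<open>Dichotomy on the sets that agree with some \<open>W\<close> on a stage
  \<open>Opn n\<close>. If for one \<open>W\<close> they always have many traces outside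
  \<open>W\<close>, points of \<open>Y - W\<close> in successive shells form a product whose sets
  miss the earlier points. Otherwise, fixing the stage, the bound and the trace on that stage leaves
  a family to which \<open>few_missed_traces_prodcfg\<close> applies.\<close>

lemma increasing_union_prodcfg:
  assumes P: "P \<subseteq> gen B" and Y: "Y \<subseteq> Z" and big: "\<not> traces P Y \<lesssim> Lset"
    and Opn: "\<And>n::nat. Opn n \<in> gen B" "\<And>n m. n \<le> m \<Longrightarrow> Opn n \<subseteq> Opn m" "Y \<subseteq> (\<Union>n. Opn n)"
    and small: "\<And>n. traces P (Y \<inter> Opn n) \<lesssim> Lset"
  shows "prodcfg B Z"
proof -
  define PW where "PW n W = {W'\<in>P. W' \<inter> (Y \<inter> Opn n) = W \<inter> (Y \<inter> Opn n)}" for n W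
  show ?thesis
  proof (cases "\<exists>W\<in>P. \<forall>n k. \<not> traces (PW n W) (Y - W) \<lesssim> \<Lambda> k")
    case True
    then obtain W where W: "W \<in> P" and low: "\<And>n k. \<not> traces (PW n W) (Y - W) \<lesssim> \<Lambda> k" by blast
    have step: "\<exists>m>n. \<not> traces (PW n W) ((Y - W) \<inter> Opn m - Opn n) \<lesssim> \<Lambda> p" for n p
    proof -
      \<comment> \<open>Members of \<open>PW n W\<close> agree with \<open>W\<close> on the stage,
        so they contain no point of \<open>Y - W\<close> there and the stage can be removed.\<close>
      have "traces (PW n W) (Y - W) = traces (PW n W) (\<Union>m. (Y - W) \<inter> Opn m - Opn n)"
      proof -
        have "W' \<inter> (Y - W) = W' \<inter> (\<Union>m. (Y - W) \<inter> Opn m - Opn n)" if "W' \<in> PW n W" for W'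
          using that Opn(3) unfolding PW_def by blast
        then show ?thesis unfolding traces_def by (rule image_cong[OF refl])
      qed
      then obtain m where m: "\<not> traces (PW n W) ((Y - W) \<inter> Opn m - Opn n) \<lesssim> \<Lambda> p"
        using low[of n "Suc p"] traces_UN_large[of "PW n W" "\<lambda>m. (Y - W) \<inter> Opn m - Opn n" p] by auto
      have "\<not> traces (PW n W) ((Y - W) \<inter> Opn (max m (Suc n)) - Opn n) \<lesssim> \<Lambda> p"
        by (rule traces_not_mono[OF m _ subset_refl]) (use Opn(2)[of m "max m (Suc n)"] in auto)
      then show ?thesis by (intro exI[of _ "max m (Suc n)"]) auto
    qed
    then obtain nxt where nxt: "\<And>n p. n < nxt n p \<and> \<not> traces (PW n W) ((Y - W) \<inter> Opn (nxt n p) - Opn n) \<lesssim> \<Lambda> p"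
      by metis
    define kk where "kk = rec_nat 0 (\<lambda>n l. nxt l (n + 3))"
    have kk: "kk (Suc n) = nxt (kk n) (n + 3)" for n unfolding kk_def by simp
    have "kk n \<le> kk (Suc n)" for n unfolding kk using nxt by (simp add: less_imp_le)
    then have kk_mono: "n \<le> m \<Longrightarrow> kk n \<le> kk m" for n m by (rule lift_Suc_mono_le)
    have "\<forall>n. \<exists>y M b1 b2. (b1 \<or> b2) \<and>
      (\<forall>i\<in>\<Lambda> n. y i \<in> (Y - W) \<inter> Opn (kk (Suc n)) - Opn (kk n) \<and> (\<exists>S\<subseteq>PW (kk n) W. S \<noteq> {} \<and> M i = \<Union>S)) \<and>
      (\<forall>i\<in>\<Lambda> n. \<forall>j\<in>\<Lambda> n. y i \<in> M j \<longleftrightarrow> pr (ord n) b1 b2 i j)"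
      unfolding kk using nxt by (intro allI pattern_ord) simp
    then obtain y M b1 b2 where b: "\<And>n. b1 n \<or> b2 n"
      and y: "\<And>n i. i\<in>\<Lambda> n \<Longrightarrow> y n i \<in> (Y - W) \<inter> Opn (kk (Suc n)) - Opn (kk n)"
      and M: "\<And>n i. i\<in>\<Lambda> n \<Longrightarrow> \<exists>S\<subseteq>PW (kk n) W. S \<noteq> {} \<and> M n i = \<Union>S"
      and pat: "\<And>n. \<forall>i\<in>\<Lambda> n. \<forall>j\<in>\<Lambda> n. y n i \<in> M n j \<longleftrightarrow> pr (ord n) (b1 n) (b2 n) i j" by metis
    show ?thesis
    proof (rule prodI[where f = "\<lambda>n. n" and y = y and M = M and Opn = "\<lambda>n. Opn (kk (Suc n))" and ?b1.0 = b1 and ?b2.0 = b2])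
      show "M n i \<in> gen B" if "i \<in> \<Lambda> n" for n i
      proof -
        from M[OF that] obtain S where S: "S \<subseteq> PW (kk n) W" "M n i = \<Union>S" by (elim exE conjE)
        have "S \<subseteq> gen B" using S(1) P unfolding PW_def by blast
        then show ?thesis unfolding S(2) by (rule gen_Union)
      qed
      show "y n i \<in> Z \<and> y n i \<in> Opn (kk (Suc n))" if "i \<in> \<Lambda> n" for n i using y[OF that] Y by blast
      show "y m i \<notin> Opn (kk (Suc n))" if "n < m" "i \<in> \<Lambda> m" for n m i
        using y[OF that(2)] Opn(2)[OF kk_mono[of "Suc n" m]] that(1) by auto
      \<comment> \<open>Earlier points lie outside \<open>W\<close> but in the stage on which all
        the sets of level \<open>n\<close> agree with \<open>W\<close>.\<close>
      have "y m j \<notin> M n i" if i: "i \<in> \<Lambda> n" and j: "j \<in> \<Lambda> m" and mn: "m < n" for n m i j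
      proof -
        from M[OF i] obtain S where S: "S \<subseteq> PW (kk n) W" "M n i = \<Union>S" by (elim exE conjE)
        have "Opn (kk (Suc m)) \<subseteq> Opn (kk n)" using Opn(2) kk_mono mn by simp
        then have "y m j \<in> Y \<inter> Opn (kk n)" "y m j \<notin> W" using y[OF j] by auto
        then have "y m j \<notin> W'" if "W' \<in> S" for W' using that S(1) unfolding PW_def by blast
        then show ?thesis using S(2) by blast
      qed
      then show "(\<forall>n m. \<forall>i\<in>\<Lambda> n. \<forall>j\<in>\<Lambda> m. n \<noteq> m \<longrightarrow> y m j \<in> M n i) \<or>
        (\<forall>n m. \<forall>i\<in>\<Lambda> n. \<forall>j\<in>\<Lambda> m. m < n \<longrightarrow> y m j \<notin> M n i)" by blast
    qed (use b Opn(1) pat in auto)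
  next
    case False
    then have "\<forall>W\<in>P. \<exists>p. traces (PW (fst p) W) (Y - W) \<lesssim> \<Lambda> (snd p)" by auto
    then obtain p where p: "\<And>W. W \<in> P \<Longrightarrow> traces (PW (fst (p W)) W) (Y - W) \<lesssim> \<Lambda> (snd (p W))" by metis
    define ty where "ty W = (p W, W \<inter> (Y \<inter> Opn (fst (p W))))" for W
    have "ty ` P \<subseteq> (SIGMA q:(UNIV :: (nat \<times> nat) set). traces P (Y \<inter> Opn (fst q)))"
      unfolding ty_def traces_def by auto
    moreover have "(SIGMA q:(UNIV :: (nat \<times> nat) set). traces P (Y \<inter> Opn (fst q))) \<lesssim> Lset"
    proof (rule Sigma_lepoll[OF Lset_inf _ small])
      have "(UNIV::nat set) \<times> (UNIV::nat set) \<lesssim> Lset" using Lset_inf by (intro Times_lepoll nat_lepoll)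
      then show "(UNIV :: (nat \<times> nat) set) \<lesssim> Lset" by simp
    qed
    ultimately have "ty ` P \<lesssim> Lset" by (meson lepoll_trans subset_imp_lepoll)
    from pigeonhole[OF big this] obtain u where u: "\<not> traces {W\<in>P. ty W = u} Y \<lesssim> Lset" ..
    show ?thesis
    proof (rule few_missed_traces_prodcfg[OF _ Y u])
      show "{W\<in>P. ty W = u} \<subseteq> gen B" using P by blast
      fix W assume W: "W \<in> {W\<in>P. ty W = u}"
      then have pW: "p W = fst u" unfolding ty_def by auto
      have "{W\<in>P. ty W = u} \<subseteq> PW (fst (p W)) W"
      proof
        fix W' assume "W' \<in> {W\<in>P. ty W = u}"
        then have "W' \<in> P" "ty W' = ty W" using W by auto
        moreover from this(2) have "fst (ty W') = fst (ty W)" "snd (ty W') = snd (ty W)" by (rule arg_cong)+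
        then have "p W' = p W" "W' \<inter> (Y \<inter> Opn (fst (p W'))) = W \<inter> (Y \<inter> Opn (fst (p W)))"
          unfolding ty_def fst_conv snd_conv .
        ultimately show "W' \<in> PW (fst (p W)) W" unfolding PW_def by simp
      qed
      then have "traces {W\<in>P. ty W = u} (Y - W) \<lesssim> traces (PW (fst (p W)) W) (Y - W)"
        by (rule traces_mono[OF subset_refl])
      then show "traces {W\<in>P. ty W = u} (Y - W) \<lesssim> \<Lambda> (snd (fst u))"
        using p[of W] W pW lepoll_trans by auto
    qed
  qed
qed

end

section \<open>The ideal of small sets in a space without a product\<close>

context lam_base
begin

definition sm :: "'a set \<Rightarrow> bool" where
  "sm X \<longleftrightarrow> traces (gen B) X \<lesssim> Lset"

lemma sm_sub: "sm X \<Longrightarrow> Y \<subseteq> X \<Longrightarrow> sm Y"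
  unfolding sm_def by (rule lepoll_trans[OF traces_mono]) auto

lemma sm_Un: "sm X \<Longrightarrow> sm Y \<Longrightarrow> sm (X \<union> Y)"
  unfolding sm_def by (rule traces_Un_lepoll[OF Lset_inf])

lemma const_traces: assumes "\<And>W. W \<in> P \<Longrightarrow> W \<inter> X = S" shows "traces P X \<lesssim> Lset"
proof -
  have "traces P X \<subseteq> {S}" using assms unfolding traces_def by auto
  then have "finite (traces P X)" by (rule finite_subset) simp
  then show ?thesis by (rule finite_lepoll[OF Lset_inf])
qed

lemma Lset_Pow: "A \<lesssim> \<Lambda> n \<Longrightarrow> Pow A \<lesssim> Lset"
  using Pow_lepoll_mono pow Lam_Lset lepoll_trans by metis

text \<open>\<open>increasing_union_prodcfg\<close> is used twice: along the pieces of the base,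
  and, if one piece already carries many traces, along the ranks of the traces on its
  members.\<close>

lemma local_small:
  assumes np: "\<not> prodcfg B Z" and X: "X \<subseteq> Z" and loc: "\<And>x. x \<in> X \<Longrightarrow> \<exists>V\<in>B. x \<in> V \<and> sm (X \<inter> V)"
  shows "sm X"
proof (rule ccontr)
  assume big: "\<not> sm X"
  define J where "J n = {V\<in>Bn n. sm (X \<inter> V)}" for n
  have JB: "J n \<subseteq> B" for n using Bn_B unfolding J_def by blast
  have gJ: "\<Union>(J n) \<in> gen B" for n by (rule gen_sub[OF JB])
  have mJ: "\<Union>(J n) \<subseteq> \<Union>(J m)" if "n \<le> m" for n m using Bn(2)[OF that] unfolding J_def by blast
  have cJ: "X \<subseteq> (\<Union>n. \<Union>(J n))"
  proof
    fix x assume "x \<in> X"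
    from loc[OF this] obtain V where V: "V \<in> B" "x \<in> V" "sm (X \<inter> V)" by blast
    then obtain n where "V \<in> Bn n" using Bn(3) by blast
    then show "x \<in> (\<Union>n. \<Union>(J n))" unfolding J_def using V by blast
  qed
  have "\<not> (\<forall>n. sm (X \<inter> \<Union>(J n)))"
    using increasing_union_prodcfg[OF subset_refl X big[unfolded sm_def], of "\<lambda>n. \<Union>(J n)"] gJ mJ cJ np unfolding sm_def by blast
  then obtain n where n: "\<not> sm (X \<inter> \<Union>(J n))" by blast
  have "\<exists>c. inj_on c (traces (gen B) (X \<inter> V)) \<and> c ` traces (gen B) (X \<inter> V) \<subseteq> Lset" if "V \<in> J n" for V
    using that unfolding J_def sm_def lepoll_def by blast
  then obtain c where c: "\<And>V. V \<in> J n \<Longrightarrow> inj_on (c V) (traces (gen B) (X \<inter> V)) \<and> c V ` traces (gen B) (X \<inter> V) \<subseteq> Lset"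
    by metis
  define code where "code V W = c V (W \<inter> (X \<inter> V))" for V W
  have code_L: "code V W \<in> Lset" if "V \<in> J n" "W \<in> gen B" for V W
    using c[OF that(1)] that(2) unfolding code_def traces_def by blast
  have code_inj: "W \<inter> (X \<inter> V) = W' \<inter> (X \<inter> V)" if "code V W = code V W'" "V \<in> J n" "W \<in> gen B" "W' \<in> gen B" for V W W'
    using c[OF that(2)] that unfolding code_def traces_def inj_on_def by blast
  \<comment> \<open>The first coordinate of a code in \<open>Lset\<close> is its rank. The rank
    function of \<open>W\<close> on \<open>J n\<close> has at most \<open>2^(\<Lambda> n)\<close>
    possibilities; once it is fixed, the open sets \<open>\<Union>(Q j)\<close> below do not depend
    on \<open>W\<close>.\<close>
  define ty where "ty W = {(j, V). V \<in> J n \<and> fst (code V W) \<le> j}" for W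
  have Jn: "J n \<lesssim> \<Lambda> n" using Bn(1)[of n] unfolding J_def by (rule lepoll_trans[OF subset_imp_lepoll, rotated]) blast
  have "ty ` gen B \<lesssim> Pow ((UNIV::nat set) \<times> J n)" unfolding ty_def by (intro subset_imp_lepoll) auto
  also have "\<dots> \<lesssim> Lset" using Jn inf nat_lepoll by (intro Lset_Pow Times_lepoll) auto
  finally have "ty ` gen B \<lesssim> Lset" .
  from pigeonhole[OF n[unfolded sm_def] this]
  obtain u where u: "\<not> traces {W\<in>gen B. ty W = u} (X \<inter> \<Union>(J n)) \<lesssim> Lset" ..
  define P where "P = {W\<in>gen B. ty W = u}"
  have "P \<noteq> {}"
  proof
    assume "P = {}"
    have "traces P (X \<inter> \<Union>(J n)) \<lesssim> Lset" by (rule const_traces) (simp add: \<open>P = {}\<close>)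
    then show False using u unfolding P_def by simp
  qed
  then obtain W0 where W0: "W0 \<in> gen B" "ty W0 = u" unfolding P_def by blast
  define Q where "Q j = {V\<in>J n. (j, V) \<in> u}" for j
  have Q: "Q j \<subseteq> J n" for j unfolding Q_def by blast
  have "prodcfg B Z"
  proof (rule increasing_union_prodcfg[of P "X \<inter> \<Union>(J n)" "\<lambda>j. \<Union>(Q j)"])
    show "P \<subseteq> gen B" unfolding P_def by blast
    show "X \<inter> \<Union>(J n) \<subseteq> Z" using X by blast
    show "\<not> traces P (X \<inter> \<Union>(J n)) \<lesssim> Lset" using u unfolding P_def .
    show "\<Union>(Q j) \<in> gen B" for j by (rule gen_sub) (use Q JB in blast)
    show "\<Union>(Q j) \<subseteq> \<Union>(Q k)" if "j \<le> k" for j k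
      unfolding Q_def W0(2)[symmetric] ty_def using that by fastforce
    show "X \<inter> \<Union>(J n) \<subseteq> (\<Union>j. \<Union>(Q j))"
    proof
      fix x assume "x \<in> X \<inter> \<Union>(J n)"
      then obtain V where V: "V \<in> J n" "x \<in> V" by blast
      then have "V \<in> Q (fst (code V W0))" unfolding Q_def W0(2)[symmetric] ty_def by simp
      then show "x \<in> (\<Union>j. \<Union>(Q j))" using V(2) by blast
    qed
    fix j
    \<comment> \<open>On these \<open>V\<close> all codes have rank at most \<open>j\<close>, so a
      trace amounts to a function from \<open>Q j\<close> into a set of size
      \<open>\<Lambda> j\<close>.\<close>
    have "(\<lambda>W. W \<inter> (X \<inter> \<Union>(J n) \<inter> \<Union>(Q j))) ` P \<lesssim> Pow (Q j \<times> \<Lambda> j)"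
    proof (rule funs_lepoll[where f = code and K = "\<lambda>_. {x\<in>Lset. fst x \<le> j}"])
      fix W W' assume W: "W \<in> P" "W' \<in> P" and eq: "\<And>V. V \<in> Q j \<Longrightarrow> code V W = code V W'"
      have "W \<inter> (X \<inter> V) = W' \<inter> (X \<inter> V)" if "V \<in> Q j" for V
        by (rule code_inj[OF eq[OF that]]) (use that Q W in \<open>auto simp: P_def\<close>)
      then show "W \<inter> (X \<inter> \<Union>(J n) \<inter> \<Union>(Q j)) = W' \<inter> (X \<inter> \<Union>(J n) \<inter> \<Union>(Q j))" by blast
    next
      fix V W assume V: "V \<in> Q j" and W: "W \<in> P"
      have "(j, V) \<in> ty W" using V W unfolding Q_def P_def by simp
      then show "code V W \<in> {x\<in>Lset. fst x \<le> j}" using code_L[of V W] W unfolding ty_def P_def by simp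
    qed (rule Lset_lower)
    also have "\<dots> \<lesssim> Lset"
    proof (rule Lset_Pow[OF Times_lepoll[OF inf]])
      show "Q j \<lesssim> \<Lambda> (max n j)"
        using lepoll_trans[OF subset_imp_lepoll[OF Q] Jn] Lam_mono[of n "max n j"] lepoll_trans by (metis max.cobounded1)
      show "\<Lambda> j \<lesssim> \<Lambda> (max n j)" by (rule Lam_mono) simp
    qed
    finally show "traces P (X \<inter> \<Union>(J n) \<inter> \<Union>(Q j)) \<lesssim> Lset" unfolding traces_def .
  qed
  then show False using np by simp
qed

text \<open>Otherwise shells between approximations of one cosmall \<open>Wh\<close> would form a
  separated sequence: the current approximation excludes all later shells, and a suitable cosmall
  \<open>A' n\<close> contains them while missing many traces of the current shell.\<close>

lemma few_cosmall_traces: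
  assumes np: "\<not> prodcfg B Z" and Y: "Y \<subseteq> Z"
  shows "traces {W\<in>gen B. sm (Y - W)} Y \<lesssim> Lset"
proof (rule ccontr)
  define T1 where "T1 = {W\<in>gen B. sm (Y - W)}"
  assume "\<not> ?thesis"
  then have big: "\<not> traces T1 Y \<lesssim> Lset" unfolding T1_def .
  have T1_Int: "W \<inter> W' \<in> T1" if "W \<in> T1" "W' \<in> T1" for W W'
    using that gen_Int sm_Un[of "Y - W" "Y - W'"] unfolding T1_def by (simp add: Diff_Int)
  have T1B: "T1 \<subseteq> gen B" unfolding T1_def by blast
  \<comment> \<open>If every member had an approximation outside which few traces remain, fixing
    that approximation would leave sets that all include it and have few traces elsewhere.\<close>
  have "\<exists>W\<in>T1. \<forall>n. \<not> traces T1 (Y - ap n W) \<lesssim> Lset"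
  proof (rule ccontr)
    assume "\<not> ?thesis"
    then obtain l where l: "\<And>W. W \<in> T1 \<Longrightarrow> traces T1 (Y - ap (l W) W) \<lesssim> Lset" by metis
    have "(\<lambda>W. (l W, ap (l W) W)) ` T1 \<subseteq> (SIGMA n:UNIV. ap n ` T1)" by auto
    moreover have "(SIGMA n:UNIV. ap n ` T1) \<lesssim> Lset"
      by (intro Sigma_lepoll nat_lepoll Lset_inf ap_lepoll)
    ultimately have "(\<lambda>W. (l W, ap (l W) W)) ` T1 \<lesssim> Lset" by (meson lepoll_trans subset_imp_lepoll)
    from pigeonhole[OF big this] obtain u where u: "\<not> traces {W\<in>T1. (l W, ap (l W) W) = u} Y \<lesssim> Lset" ..
    let ?P = "{W\<in>T1. (l W, ap (l W) W) = u}"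
    have "traces ?P (Y \<inter> snd u) \<lesssim> Lset"
    proof (rule const_traces)
      fix W assume "W \<in> ?P"
      then have "snd u \<subseteq> W" using ap_sub[of "l W" W] by auto
      then show "W \<inter> (Y \<inter> snd u) = Y \<inter> snd u" by blast
    qed
    moreover have "traces ?P (Y - snd u) \<lesssim> Lset"
    proof (cases "?P = {}")
      case False
      then obtain W where W: "W \<in> T1" "ap (l W) W = snd u" by auto
      have "traces ?P (Y - snd u) \<lesssim> traces T1 (Y - snd u)" by (rule traces_mono) auto
      then show ?thesis using l[OF W(1)] W(2) lepoll_trans by auto
    next
      case True
      show ?thesis unfolding True by (rule const_traces) simp
    qed
    ultimately have "traces ?P ((Y \<inter> snd u) \<union> (Y - snd u)) \<lesssim> Lset" by (rule traces_Un_lepoll[OF Lset_inf])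
    then show False using u by (simp add: Int_Diff_Un)
  qed
  then obtain Wh where Wh: "Wh \<in> T1" "\<And>n. \<not> traces T1 (Y - ap n Wh) \<lesssim> Lset" by blast
  \<comment> \<open>As there is no product, \<open>few_missed_traces_prodcfg\<close> fails for every
    bound, which gives a cosmall \<open>A'\<close> missing many traces; the countable union of
    approximations then confines them to one stage of \<open>Wh\<close>.\<close>
  have step: "\<exists>m>k. \<exists>A'\<in>T1. \<not> traces (gen B) ((Y \<inter> A - ap k Wh - A') \<inter> ap m Wh) \<lesssim> \<Lambda> p"
    if A: "A \<in> T1" "A \<subseteq> Wh" for k A p
  proof -
    have "sm (Y - A)" using A(1) unfolding T1_def by blast
    then have "traces (gen B) (Y - A) \<lesssim> Lset" unfolding sm_def .
    then have "traces T1 ((Y - A) - ap k Wh) \<lesssim> Lset"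
      using traces_mono[of "(Y - A) - ap k Wh" "Y - A" T1 "gen B"] T1B lepoll_trans by blast
    moreover have "Y - ap k Wh = (Y \<inter> A - ap k Wh) \<union> ((Y - A) - ap k Wh)" by blast
    ultimately have big': "\<not> traces T1 (Y \<inter> A - ap k Wh) \<lesssim> Lset"
      using Wh(2)[of k] traces_Un_lepoll[OF Lset_inf, of T1 "Y \<inter> A - ap k Wh" "(Y - A) - ap k Wh"] by auto
    have "\<exists>A'\<in>T1. \<not> traces T1 (Y \<inter> A - ap k Wh - A') \<lesssim> \<Lambda> (Suc p)"
    proof (rule ccontr)
      assume "\<not> ?thesis"
      then have "prodcfg B Z" by (intro few_missed_traces_prodcfg[OF T1B _ big', of "Suc p"]) (use Y in auto)
      then show False using np by simp
    qed
    then obtain A' where A': "A' \<in> T1" "\<not> traces T1 (Y \<inter> A - ap k Wh - A') \<lesssim> \<Lambda> (Suc p)" by blast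
    then have "\<not> traces (gen B) (Y \<inter> A - ap k Wh - A') \<lesssim> \<Lambda> (Suc p)"
      using traces_not_mono T1B by blast
    moreover have "Y \<inter> A - ap k Wh - A' = (\<Union>m. (Y \<inter> A - ap k Wh - A') \<inter> ap m Wh)"
      using ap_UN[of Wh] Wh(1) T1B A(2) by blast
    ultimately obtain m where m: "\<not> traces (gen B) ((Y \<inter> A - ap k Wh - A') \<inter> ap m Wh) \<lesssim> \<Lambda> p"
      using traces_UN_large[of "gen B" "\<lambda>m. (Y \<inter> A - ap k Wh - A') \<inter> ap m Wh" p] by auto
    have "\<not> traces (gen B) ((Y \<inter> A - ap k Wh - A') \<inter> ap (max m (Suc k)) Wh) \<lesssim> \<Lambda> p"
      by (rule traces_not_mono[OF m _ subset_refl]) (use ap_mono[of m "max m (Suc k)" Wh] in auto)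
    then show ?thesis using A'(1) by (intro exI[of _ "max m (Suc k)"]) auto
  qed
  then have "\<forall>k A p. \<exists>m A'. A \<in> T1 \<and> A \<subseteq> Wh \<longrightarrow>
      k < m \<and> A' \<in> T1 \<and> \<not> traces (gen B) ((Y \<inter> A - ap k Wh - A') \<inter> ap m Wh) \<lesssim> \<Lambda> p" by meson
  then obtain nm nA where nx: "\<And>k A p. A \<in> T1 \<Longrightarrow> A \<subseteq> Wh \<Longrightarrow> k < nm k A p \<and> nA k A p \<in> T1 \<and>
      \<not> traces (gen B) ((Y \<inter> A - ap k Wh - nA k A p) \<inter> ap (nm k A p) Wh) \<lesssim> \<Lambda> p" by metis
  define st where "st = rec_nat (0, Wh) (\<lambda>n s. (nm (fst s) (snd s) (n + 3), snd s \<inter> nA (fst s) (snd s) (n + 3)))"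
  define k A A' where "k n = fst (st n)" and "A n = snd (st n)" and "A' n = nA (fst (st n)) (snd (st n)) (n + 3)" for n
  have st0: "A 0 = Wh" unfolding A_def st_def by simp
  have stS: "k (Suc n) = nm (k n) (A n) (n + 3)" "A (Suc n) = A n \<inter> A' n" for n
    unfolding k_def A_def A'_def st_def by simp_all
  have AT: "A n \<in> T1 \<and> A n \<subseteq> Wh" for n
  proof (induction n)
    case 0
    then show ?case using st0 Wh(1) by simp
  next
    case (Suc n)
    then show ?case using nx[of "A n" "k n" "n + 3"] T1_Int unfolding stS A'_def k_def[symmetric] A_def[symmetric] by blast
  qed
  have nx': "k n < k (Suc n)" "A' n \<in> T1"
    "\<not> traces (gen B) ((Y \<inter> A n - ap (k n) Wh - A' n) \<inter> ap (k (Suc n)) Wh) \<lesssim> \<Lambda> (n + 3)" for n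
    using nx[of "A n" "k n" "n + 3"] AT[of n] unfolding stS A'_def k_def[symmetric] A_def[symmetric] by auto
  have "k n \<le> k (Suc n)" for n using nx'(1)[of n] by simp
  then have k_mono: "n \<le> m \<Longrightarrow> k n \<le> k m" for n m by (rule lift_Suc_mono_le)
  have "A (Suc n) \<subseteq> A n" for n using stS(2)[of n] by blast
  then have A_mono: "n \<le> m \<Longrightarrow> A m \<subseteq> A n" for n m by (rule lift_Suc_antimono_le)
  have "prodcfg B Z"
  proof (rule separated_sequence[where X = "\<lambda>n. (Y \<inter> A n - ap (k n) Wh - A' n) \<inter> ap (k (Suc n)) Wh"
        and Opn = "\<lambda>n. ap (k (Suc n)) Wh" and A = A'])
    fix n m :: nat assume "n < m"
    then have "A m \<subseteq> A (Suc n)" "ap (k (Suc n)) Wh \<subseteq> ap (k m) Wh" using A_mono k_mono ap_mono by simp_all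
    then show "(Y \<inter> A m - ap (k m) Wh - A' m) \<inter> ap (k (Suc m)) Wh \<subseteq> A' n - ap (k (Suc n)) Wh"
      unfolding stS(2) by blast
  next
    show "(Y \<inter> A n - ap (k n) Wh - A' n) \<inter> ap (k (Suc n)) Wh \<subseteq> Z" for n using Y by blast
    show "\<not> traces (gen B) ((Y \<inter> A n - ap (k n) Wh - A' n) \<inter> ap (k (Suc n)) Wh) \<lesssim> \<Lambda> (n + 3)" for n
      by (rule nx'(3))
    show "ap (k (Suc n)) Wh \<in> gen B" for n by (rule ap_gen)
    show "A' n \<in> gen B" for n using nx'(2) T1B by blast
    show "(Y \<inter> A n - ap (k n) Wh - A' n) \<inter> ap (k (Suc n)) Wh \<subseteq> ap (k (Suc n)) Wh - A' n" for n by blast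
  qed
  then show False using np by simp
qed

lemma ideal_space_small_traces: assumes np: "\<not> prodcfg B Z" shows "ideal_space B Z sm"
proof
  show "sm {}" unfolding sm_def by (rule const_traces) simp
  show "sm Y" if "sm X" "Y \<subseteq> X" for X Y using sm_sub that .
  show "sm (X \<union> Y)" if "sm X" "sm Y" for X Y using sm_Un that .
  show "sm X" if "X \<subseteq> Z" "\<And>x. x \<in> X \<Longrightarrow> \<exists>V\<in>B. x \<in> V \<and> sm (X \<inter> V)" for X using local_small[OF np that] .
  show "\<not> (\<exists>A U V. A 0 \<subseteq> Z \<and> (\<forall>n::nat. U n \<in> gen B \<and> V n \<in> gen B \<and>
      A (Suc n) = A n \<inter> U n - V n \<and> \<not> sm (A n \<inter> V n - U n)))"
  proof (intro notI, elim exE conjE)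
    fix A U V :: "nat \<Rightarrow> 'a set"
    assume "A 0 \<subseteq> Z" and s: "\<forall>n. U n \<in> gen B \<and> V n \<in> gen B \<and> A (Suc n) = A n \<inter> U n - V n \<and> \<not> sm (A n \<inter> V n - U n)"
    then have "prodcfg B Z"
      by (intro split_sequence_prodcfg[of A U V]) (auto simp: sm_def dest: Lset_not)
    then show False using np by simp
  qed
qed

text \<open>By locality \<open>\<Union>u\<close> exceeds every \<open>W\<close> with saturation
  \<open>u\<close> only by a small subset of \<open>Z\<close>, so \<open>few_cosmall_traces\<close>
  bounds each class. Many traces therefore need many saturations.\<close>

lemma many_saturations:
  assumes np: "\<not> prodcfg B Z" and big: "\<not> traces (gen B) Z \<lesssim> Lset"
  shows "\<not> (\<lambda>W. {V\<in>B. sm ((Z - W) \<inter> V)}) ` gen B \<lesssim> Lset"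
proof
  interpret ideal_space B Z sm by (rule ideal_space_small_traces[OF np])
  assume "(\<lambda>W. {V\<in>B. sm ((Z - W) \<inter> V)}) ` gen B \<lesssim> Lset"
  from pigeonhole[OF big this] obtain u where
    u: "\<not> traces {W\<in>gen B. {V\<in>B. sm ((Z - W) \<inter> V)} = u} Z \<lesssim> Lset" ..
  define P where "P = {W\<in>gen B. {V\<in>B. sm ((Z - W) \<inter> V)} = u}"
  have "P \<subseteq> {W\<in>gen B. sm (Z \<inter> \<Union>u - W)}"
  proof
    fix W assume "W \<in> P"
    then have W: "W \<in> gen B" "{V\<in>B. sm ((Z - W) \<inter> V)} = u" unfolding P_def by auto
    have "sm (Z \<inter> \<Union>u - W)"
    proof (rule small_loc)
      fix x assume "x \<in> Z \<inter> \<Union>u - W"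
      then obtain V where V: "V \<in> u" "x \<in> V" by blast
      then have "V \<in> B" "sm ((Z - W) \<inter> V)" using W(2) by auto
      moreover from this(2) have "sm ((Z \<inter> \<Union>u - W) \<inter> V)" by (rule sm_sub) blast
      ultimately show "\<exists>V\<in>B. x \<in> V \<and> sm ((Z \<inter> \<Union>u - W) \<inter> V)" using V(2) by blast
    qed blast
    then show "W \<in> {W\<in>gen B. sm (Z \<inter> \<Union>u - W)}" using W(1) by simp
  qed
  then have "traces P (Z \<inter> \<Union>u) \<lesssim> traces {W\<in>gen B. sm (Z \<inter> \<Union>u - W)} (Z \<inter> \<Union>u)"
    by (rule traces_mono[OF subset_refl])
  also have "\<dots> \<lesssim> Lset" by (rule few_cosmall_traces[OF np]) blast
  finally have 1: "traces P (Z \<inter> \<Union>u) \<lesssim> Lset" .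
  have 2: "traces P (Z - \<Union>u) \<lesssim> Lset"
  proof (rule const_traces)
    fix W assume "W \<in> P"
    then have W: "W \<in> gen B" "{V\<in>B. sm ((Z - W) \<inter> V)} = u" unfolding P_def by auto
    have "W \<subseteq> \<Union>u"
    proof
      fix x assume "x \<in> W"
      from gen_E[OF W(1) this] obtain V where V: "V \<in> B" "x \<in> V" "V \<subseteq> W" by blast
      then have "(Z - W) \<inter> V = {}" by blast
      then have "V \<in> u" using W(2) V(1) small_empty by auto
      then show "x \<in> \<Union>u" using V(2) by blast
    qed
    then show "W \<inter> (Z - \<Union>u) = {}" by blast
  qed
  have "traces P Z \<lesssim> Lset" using traces_Un_lepoll[OF Lset_inf 1 2] by (simp add: Int_Diff_Un)
  then show False using u unfolding P_def by simp
qed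

theorem chain_of_filters:
  assumes np: "\<not> prodcfg B Z" and big: "\<not> traces (gen B) Z \<lesssim> Lset"
  shows "\<exists>K\<subseteq>Pow B. K \<noteq> {} \<and> (\<forall>F\<in>K. \<forall>F'\<in>K. F \<subseteq> F' \<or> F' \<subseteq> F) \<and>
    (\<forall>F\<in>K. \<forall>G. finite G \<longrightarrow> G \<subseteq> F \<longrightarrow> (\<exists>x\<in>Z. x \<in> \<Inter>G \<and> (\<forall>V\<in>B - F. x \<notin> V))) \<and>
    (\<forall>G H. finite G \<longrightarrow> finite H \<longrightarrow> G \<subseteq> B \<longrightarrow> H \<subseteq> B \<longrightarrow> cyl K G H \<noteq> {} \<longrightarrow> \<not> cyl K G H \<lesssim> Lset)"
proof -
  interpret ideal_space B Z sm by (rule ideal_space_small_traces[OF np])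
  have sub: "filt ` {X. irr X} \<subseteq> Pow B" unfolding filt_def by blast
  have many: "\<not> filt ` {X. irr X} \<lesssim> Lset" by (rule many_filters[OF Lset_inf many_saturations[OF np big]])
  have lrg: "\<not> sm (Z \<inter> \<Inter>G - \<Union>H)"
    if "finite G" "finite H" "G \<subseteq> B" "H \<subseteq> B" "\<not> cyl (filt ` {X. irr X}) G H \<lesssim> Lset" for G H
  proof -
    have "cyl (filt ` {X. irr X}) G H \<noteq> {}" using that(5) finite_lepoll[OF Lset_inf, of "{}"] by auto
    then obtain X where "irr X" "G \<subseteq> filt X" "H \<inter> filt X = {}" unfolding cyl_def by blast
    then show ?thesis using irr_not_small[of X G H] that(1,4) by blast
  qed
  have "\<exists>K\<subseteq>filt ` {X. irr X}. K \<noteq> {} \<and> (\<forall>F\<in>K. \<forall>F'\<in>K. F \<subseteq> F' \<or> F' \<subseteq> F) \<and>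
    (\<forall>G H. finite G \<longrightarrow> finite H \<longrightarrow> G \<subseteq> B \<longrightarrow> H \<subseteq> B \<longrightarrow> cyl K G H \<noteq> {} \<longrightarrow> \<not> cyl K G H \<lesssim> Lset)"
    by (rule filter_chain[OF Lset_inf BL many sub lrg])
  then obtain K where
    K: "K \<subseteq> filt ` {X. irr X}" "K \<noteq> {}" "\<forall>F\<in>K. \<forall>F'\<in>K. F \<subseteq> F' \<or> F' \<subseteq> F"
    "\<forall>G H. finite G \<longrightarrow> finite H \<longrightarrow> G \<subseteq> B \<longrightarrow> H \<subseteq> B \<longrightarrow> cyl K G H \<noteq> {} \<longrightarrow> \<not> cyl K G H \<lesssim> Lset"
    by (elim exE conjE) (rule that)
  have "\<exists>x\<in>Z. x \<in> \<Inter>G \<and> (\<forall>V\<in>B - F. x \<notin> V)" if "F \<in> K" "finite G" "G \<subseteq> F" for F G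
  proof -
    from K(1) that(1) obtain X where "irr X" "F = filt X" by blast
    then show ?thesis using irr_point[of X G] that by simp
  qed
  then have "\<forall>F\<in>K. \<forall>G. finite G \<longrightarrow> G \<subseteq> F \<longrightarrow> (\<exists>x\<in>Z. x \<in> \<Inter>G \<and> (\<forall>V\<in>B - F. x \<notin> V))" by simp
  with K(2-4) subset_trans[OF K(1) sub] show ?thesis by (intro exI[of _ K] conjI)
qed

end

text \<open>The pattern lemma one type higher: basic sets play the points and filters the sets.
  Comparability of the filters rules out singletons and complements of points.\<close>

lemma chain_has:
  assumes r: "Card_order r" "infinite (Field r)" and big: "\<not> I \<lesssim> Pow (Pow (Pow (Field r)))"
    and IB: "\<And>F. F \<in> I \<Longrightarrow> F \<subseteq> B" and chain: "\<And>F F'. F \<in> I \<Longrightarrow> F' \<in> I \<Longrightarrow> F \<subseteq> F' \<or> F' \<subseteq> F"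
  shows "has_chain r True B I \<or> has_chain r False B I"
proof -
  have wr: "Well_order r" using r(1) unfolding card_order_on_def by simp
  obtain y W where yW: "\<forall>i\<in>Field r. W i \<in> I \<and> y i \<in> \<Union>I" and
    alt: "(\<forall>i\<in>Field r. \<forall>j\<in>Field r. y i \<in> W j \<longleftrightarrow> i = j) \<or>
     (\<exists>b1 b2. (b1 \<or> b2) \<and> (\<forall>i\<in>Field r. \<forall>j\<in>Field r. y i \<in> W j \<longleftrightarrow> pr r b1 b2 i j))"
    using strict_pattern[OF r big] by (elim exE conjE) (rule that)
  have yB: "y i \<in> B" if "i \<in> Field r" for i using yW that IB by blast
  obtain i where i: "i \<in> Field r" using r(2) by (metis ex_in_conv finite.emptyI)
  obtain j where "j \<in> Field r - {i}" using infinite_remove[OF r(2), of i] by (metis ex_in_conv finite.emptyI)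
  with i have ij: "i \<in> Field r" "j \<in> Field r" "i \<noteq> j" by auto
  have "W i \<subseteq> W j \<or> W j \<subseteq> W i" using yW ij by (intro chain) simp_all
  then have nd: "\<not> (y i \<in> W i \<and> y j \<in> W j \<and> y i \<notin> W j \<and> y j \<notin> W i)"
    "\<not> (y i \<notin> W i \<and> y j \<notin> W j \<and> y i \<in> W j \<and> y j \<in> W i)"
    by blast+
  have neq: "\<not> (\<forall>i\<in>Field r. \<forall>j\<in>Field r. y i \<in> W j \<longleftrightarrow> i = j)"
  proof
    assume A: "\<forall>i\<in>Field r. \<forall>j\<in>Field r. y i \<in> W j \<longleftrightarrow> i = j"
    note A' = A[THEN bspec, THEN bspec]
    show False using nd(1) ij(3) A'[OF ij(1,1)] A'[OF ij(1,2)] A'[OF ij(2,1)] A'[OF ij(2,2)] by simp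
  qed
  have "\<exists>b1 b2. (b1 \<or> b2) \<and> (\<forall>i\<in>Field r. \<forall>j\<in>Field r. y i \<in> W j \<longleftrightarrow> pr r b1 b2 i j)"
    by (rule disjE[OF alt], erule notE[OF neq], assumption)
  then obtain b1 b2 where b: "b1 \<or> b2" and pat: "\<forall>i\<in>Field r. \<forall>j\<in>Field r. y i \<in> W j \<longleftrightarrow> pr r b1 b2 i j"
    by (elim exE conjE) (rule that)
  have "\<not> (b1 \<and> b2)" using nd(2) pat ij unfolding pr_def by (auto split: if_splits)
  with b consider "b1" "\<not> b2" | "\<not> b1" "b2" by blast
  then show ?thesis
  proof cases
    case 1
    have "y i \<in> W j \<longleftrightarrow> i \<in> underS r j" if "i \<in> Field r" "j \<in> Field r" for i j
      using pat that 1 unfolding pr_def by (auto simp: underS_def)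
    then have "has_chain r True B I" unfolding has_chain_def using yW yB by (intro exI[of _ y] exI[of _ W]) simp
    then show ?thesis ..
  next
    case 2
    have "y i \<in> W j \<longleftrightarrow> j \<in> underS r i" if "i \<in> Field r" "j \<in> Field r" for i j
      using pat that 2 underS_total[OF wr that] underS_asym[OF wr, of i j] unfolding pr_def by (auto simp: underS_def)
    then have "has_chain r False B I" unfolding has_chain_def using yW yB by (intro exI[of _ y] exI[of _ W]) simp
    then show ?thesis ..
  qed
qed

definition tree_config :: "(nat \<Rightarrow> 'k rel) \<Rightarrow> 'a set set \<Rightarrow> 'a set \<Rightarrow> bool" where
  "tree_config mu B Z \<longleftrightarrow> (\<exists>b x. inj_on x (fin_seqs mu) \<and> x ` fin_seqs mu \<subseteq> Z \<and>
    (\<forall>\<eta>\<in>inf_seqs mu. \<exists>U\<in>gen B. \<forall>\<nu>\<in>fin_seqs mu. x \<nu> \<in> U \<longleftrightarrow>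
      (\<exists>n<length \<nu>. take n \<nu> = restr \<eta> n \<and>
        (if b then \<eta> n \<in> underS (mu n) (\<nu> ! n) else \<nu> ! n \<in> underS (mu n) (\<eta> n)))))"

context lam_sets
begin

lemma large_chain_tree:
  fixes mu :: "nat \<Rightarrow> 'c rel"
  assumes K: "K \<noteq> {}" "K \<subseteq> Pow B" "\<forall>F\<in>K. \<forall>F'\<in>K. F \<subseteq> F' \<or> F' \<subseteq> F"
    and P: "\<forall>F\<in>K. \<forall>G. finite G \<longrightarrow> G \<subseteq> F \<longrightarrow> (\<exists>x\<in>Z. x \<in> \<Inter>G \<and> (\<forall>V\<in>B - F. x \<notin> V))"
    and big: "\<forall>G H. finite G \<longrightarrow> finite H \<longrightarrow> G \<subseteq> B \<longrightarrow> H \<subseteq> B \<longrightarrow> cyl K G H \<noteq> {} \<longrightarrow> \<not> cyl K G H \<lesssim> Lset"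
    and mu: "\<And>n. Well_order (mu n)" "\<And>n. \<exists>m. Field (mu n) \<prec> \<Lambda> m"
  shows "tree_config mu B Z"
proof -
  obtain m where m: "\<And>n. Field (mu n) \<prec> \<Lambda> (m n)" using mu(2) by metis
  \<comment> \<open>Partial sums make the lengths increase with \<open>n\<close>, as
    \<open>chain_tree\<close> requires.\<close>
  define s where "s n = (\<Sum>i\<le>n. m i)" for n
  have s: "m n \<le> s n" for n unfolding s_def by (meson atMost_iff finite_atMost member_le_sum order_refl zero_le)
  have s_mono: "i \<le> j \<Longrightarrow> s i \<le> s j" for i j unfolding s_def by (intro sum_mono2) auto
  show ?thesis unfolding tree_config_def
  proof (rule chain_tree[where K = K and r = "\<lambda>n. ord (s n)"])
    show "Field (mu n) \<prec> Field (ord (s n))" for n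
      using m[of n] Lam_mono[OF s[of n]] lesspoll_trans2 unfolding Field_ord by blast
    fix G H n assume GH: "finite G" "finite H" "G \<subseteq> B" "H \<subseteq> B" "cyl K G H \<noteq> {}"
    have "\<not> cyl K G H \<lesssim> Lset" using big GH by simp
    then have "\<not> cyl K G H \<lesssim> Pow (Pow (Pow (Field (ord (s n)))))"
      using Pow3[of "s n"] Lam_Lset lepoll_trans unfolding Field_ord by metis
    then show "has_chain (ord (s n)) True B (cyl K G H) \<or> has_chain (ord (s n)) False B (cyl K G H)"
    proof (rule chain_has[OF Card_ord, rotated])
      show "infinite (Field (ord (s n)))" unfolding Field_ord by (rule inf)
      show "F \<subseteq> B" if "F \<in> cyl K G H" for F using K(2) that unfolding cyl_def by blast
      show "F \<subseteq> F' \<or> F' \<subseteq> F" if "F \<in> cyl K G H" "F' \<in> cyl K G H" for F F'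
        using K(3) that unfolding cyl_def by blast
    qed
  next
    show "K \<noteq> {}" by (rule K(1))
    show "F \<subseteq> B" if "F \<in> K" for F using K(2) that by blast
    show "F \<subseteq> F' \<or> F' \<subseteq> F" if "F \<in> K" "F' \<in> K" for F F' using K(3) that by blast
    show "\<exists>x\<in>Z. x \<in> \<Inter>G \<and> (\<forall>V\<in>B - F. x \<notin> V)" if "F \<in> K" "finite G" "G \<subseteq> F" for F G
      using P that by simp
    show "Well_order (mu n)" for n by (rule mu(1))
    show "Card_order (ord (s n))" for n by (rule Card_ord)
    show "infinite (Field (ord (s n)))" for n unfolding Field_ord by (rule inf)
    show "Field (ord (s i)) \<lesssim> Field (ord (s j))" if "i \<le> j" for i j
      unfolding Field_ord using that by (intro Lam_mono s_mono)
  qed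
qed

end

theorem (in lam_base) strong_limit_case:
  fixes mu :: "nat \<Rightarrow> 'c rel"
  assumes "\<not> traces (gen B) Z \<lesssim> Lset" "\<And>n. Well_order (mu n)" "\<And>n. \<exists>m. Field (mu n) \<prec> \<Lambda> m"
  shows "prodcfg B Z \<or> tree_config mu B Z"
proof (rule disjCI)
  assume "\<not> tree_config mu B Z"
  show "prodcfg B Z"
  proof (rule ccontr)
    assume "\<not> prodcfg B Z"
    from chain_of_filters[OF this assms(1)] obtain K where K: "K \<subseteq> Pow B" "K \<noteq> {}"
      "\<forall>F\<in>K. \<forall>F'\<in>K. F \<subseteq> F' \<or> F' \<subseteq> F"
      "\<forall>F\<in>K. \<forall>G. finite G \<longrightarrow> G \<subseteq> F \<longrightarrow> (\<exists>x\<in>Z. x \<in> \<Inter>G \<and> (\<forall>V\<in>B - F. x \<notin> V))"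
      "\<forall>G H. finite G \<longrightarrow> finite H \<longrightarrow> G \<subseteq> B \<longrightarrow> H \<subseteq> B \<longrightarrow> cyl K G H \<noteq> {} \<longrightarrow> \<not> cyl K G H \<lesssim> Lset"
      by (elim exE conjE) (rule that)
    from large_chain_tree[where mu = mu, OF K(2,1,3,4,5) assms(2,3)] show False using \<open>\<not> tree_config mu B Z\<close> by blast
  qed
qed

section \<open>The three configurations\<close>

definition levels :: "(nat \<Rightarrow> 'k rel) \<Rightarrow> nat \<Rightarrow> 'k list set" where
  "levels mu m = {\<nu>\<in>fin_seqs mu. length \<nu> = m}"

definition lexless :: "(nat \<Rightarrow> 'k rel) \<Rightarrow> 'k list \<Rightarrow> 'k list \<Rightarrow> bool" where
  "lexless mu \<nu> \<rho> \<longleftrightarrow> (\<exists>n<length \<nu>. take n \<nu> = take n \<rho> \<and> \<nu> ! n \<in> underS (mu n) (\<rho> ! n))"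

lemma lexless_snoc:
  assumes "length \<nu> = length \<rho>"
  shows "lexless mu (\<nu> @ [a]) (\<rho> @ [b]) \<longleftrightarrow> lexless mu \<nu> \<rho> \<or> \<nu> = \<rho> \<and> a \<in> underS (mu (length \<nu>)) b"
proof -
  have "(\<exists>n<length (\<nu> @ [a]). P n) \<longleftrightarrow> (\<exists>n<length \<nu>. P n) \<or> P (length \<nu>)" for P
    by (auto simp: less_Suc_eq)
  then show ?thesis unfolding lexless_def using assms by (auto simp: nth_append)
qed

lemma levels_Suc:
  assumes "\<nu> \<in> levels mu (Suc m)"
  shows "\<exists>\<nu>' a. \<nu> = \<nu>' @ [a] \<and> \<nu>' \<in> levels mu m \<and> a \<in> Field (mu m)"
proof -
  have l: "length \<nu> = Suc m" "\<And>l. l < length \<nu> \<Longrightarrow> \<nu> ! l \<in> Field (mu l)"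
    using assms unfolding levels_def fin_seqs_def by auto
  then obtain \<nu>' a where e: "\<nu> = \<nu>' @ [a]" "length \<nu>' = m" by (metis length_Suc_conv_rev)
  have "\<nu>' ! k \<in> Field (mu k)" if "k < length \<nu>'" for k
    using l(2)[of k] that e by (simp add: nth_append)
  moreover have "a \<in> Field (mu m)" using l(2)[of m] e by (simp add: nth_append)
  ultimately show ?thesis using e unfolding levels_def fin_seqs_def by blast
qed

text \<open>The fixed length is essential: over all lengths, 1 > 01 > 001 > ... would descend
  forever. The induction peels off the last entry, the least significant one.\<close>

lemma lexless_order:
  assumes mu: "\<And>n. Well_order (mu n)"
  shows "wf {(\<nu>, \<rho>). \<nu> \<in> levels mu m \<and> \<rho> \<in> levels mu m \<and> lexless mu \<nu> \<rho>}"
    and "\<nu> \<in> levels mu m \<Longrightarrow> \<rho> \<in> levels mu m \<Longrightarrow> \<sigma> \<in> levels mu m \<Longrightarrow>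
      lexless mu \<nu> \<rho> \<Longrightarrow> lexless mu \<rho> \<sigma> \<Longrightarrow> lexless mu \<nu> \<sigma>"
    and "\<nu> \<in> levels mu m \<Longrightarrow> \<rho> \<in> levels mu m \<Longrightarrow> \<nu> = \<rho> \<or> lexless mu \<nu> \<rho> \<or> lexless mu \<rho> \<nu>"
proof -
  let ?W = "\<lambda>m. {(\<nu>, \<rho>). \<nu> \<in> levels mu m \<and> \<rho> \<in> levels mu m \<and> lexless mu \<nu> \<rho>}"
  have len: "length \<nu> = m" if "\<nu> \<in> levels mu m" for \<nu> m using that unfolding levels_def by simp
  show "wf (?W m)"
  proof (induction m)
    case 0
    have "?W 0 = {}" unfolding levels_def lexless_def by auto
    then show ?case by (rule ssubst) (simp add: wf_def)
  next
    case (Suc m)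
    have "wf (inv_image (?W m <*lex*> (mu m - Id)) (\<lambda>\<nu>. (butlast \<nu>, last \<nu>)))"
      by (intro wf_inv_image wf_lex_prod Suc well_order_wf mu)
    then show ?case
    proof (rule wf_subset)
      show "?W (Suc m) \<subseteq> inv_image (?W m <*lex*> (mu m - Id)) (\<lambda>\<nu>. (butlast \<nu>, last \<nu>))"
      proof (clarify)
        fix \<nu> \<rho> assume a: "\<nu> \<in> levels mu (Suc m)" "\<rho> \<in> levels mu (Suc m)" "lexless mu \<nu> \<rho>"
        obtain \<nu>' a \<rho>' b where e: "\<nu> = \<nu>' @ [a]" "\<nu>' \<in> levels mu m" "\<rho> = \<rho>' @ [b]" "\<rho>' \<in> levels mu m"
          using levels_Suc[OF a(1)] levels_Suc[OF a(2)] by blast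
        then show "(\<nu>, \<rho>) \<in> inv_image (?W m <*lex*> (mu m - Id)) (\<lambda>\<nu>. (butlast \<nu>, last \<nu>))"
          using a(3) len[OF e(2)] len[OF e(4)] lexless_snoc[of \<nu>' \<rho>' mu a b] by (auto simp: underS_def)
      qed
    qed
  qed
  show "lexless mu \<nu> \<sigma>" if "\<nu> \<in> levels mu m" "\<rho> \<in> levels mu m" "\<sigma> \<in> levels mu m" "lexless mu \<nu> \<rho>" "lexless mu \<rho> \<sigma>"
    using that
  proof (induction m arbitrary: \<nu> \<rho> \<sigma>)
    case 0
    then show ?case unfolding levels_def lexless_def by auto
  next
    case (Suc m)
    obtain \<nu>' a \<rho>' b \<sigma>' c where e: "\<nu> = \<nu>' @ [a]" "\<nu>' \<in> levels mu m" "\<rho> = \<rho>' @ [b]" "\<rho>' \<in> levels mu m"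
      "\<sigma> = \<sigma>' @ [c]" "\<sigma>' \<in> levels mu m"
      using levels_Suc[OF Suc.prems(1)] levels_Suc[OF Suc.prems(2)] levels_Suc[OF Suc.prems(3)] by blast
    note l = len[OF e(2)] len[OF e(4)] len[OF e(6)]
    have "lexless mu \<nu>' \<rho>' \<or> \<nu>' = \<rho>' \<and> a \<in> underS (mu m) b" "lexless mu \<rho>' \<sigma>' \<or> \<rho>' = \<sigma>' \<and> b \<in> underS (mu m) c"
      using Suc.prems(4,5) lexless_snoc[of \<nu>' \<rho>' mu a b] lexless_snoc[of \<rho>' \<sigma>' mu b c] l unfolding e by auto
    then have "lexless mu \<nu>' \<sigma>' \<or> \<nu>' = \<sigma>' \<and> a \<in> underS (mu m) c"
      using Suc.IH[OF e(2,4,6)] underS_trans[OF mu, of a m b c] by auto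
    then show ?case using lexless_snoc[of \<nu>' \<sigma>' mu a c] l unfolding e by auto
  qed
  show "\<nu> = \<rho> \<or> lexless mu \<nu> \<rho> \<or> lexless mu \<rho> \<nu>" if "\<nu> \<in> levels mu m" "\<rho> \<in> levels mu m"
    using that
  proof (induction m arbitrary: \<nu> \<rho>)
    case 0
    then show ?case unfolding levels_def by auto
  next
    case (Suc m)
    obtain \<nu>' a \<rho>' b where e: "\<nu> = \<nu>' @ [a]" "\<nu>' \<in> levels mu m" "a \<in> Field (mu m)" "\<rho> = \<rho>' @ [b]" "\<rho>' \<in> levels mu m" "b \<in> Field (mu m)"
      using levels_Suc[OF Suc.prems(1)] levels_Suc[OF Suc.prems(2)] by blast
    note l = len[OF e(2)] len[OF e(5)]
    show ?case using Suc.IH[OF e(2,5)] underS_total[OF mu e(3,6)] l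
        lexless_snoc[of \<nu>' \<rho>' mu a b] lexless_snoc[of \<rho>' \<nu>' mu b a] unfolding e by auto
  qed
qed

lemma lex_well_order:
  assumes mu: "\<And>n. Well_order (mu n)"
  shows "\<exists>w. Well_order w \<and> Field w = levels mu m \<and>
    (\<forall>\<nu>\<in>levels mu m. \<forall>\<rho>\<in>levels mu m. \<nu> \<in> underS w \<rho> \<longleftrightarrow> lexless mu \<nu> \<rho>)"
proof -
  let ?V = "levels mu m"
  define w where "w = {(\<nu>, \<rho>). \<nu> \<in> ?V \<and> \<rho> \<in> ?V \<and> (\<nu> = \<rho> \<or> lexless mu \<nu> \<rho>)}"
  note o = lexless_order[where mu = mu, OF mu, where m = m]
  have irrefl: "\<not> lexless mu \<nu> \<nu>" if "\<nu> \<in> ?V" for \<nu> using wf_not_refl[OF o(1), of \<nu>] that by simp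
  have F: "Field w = ?V" unfolding w_def Field_def by auto
  have "w - Id = {(\<nu>, \<rho>). \<nu> \<in> ?V \<and> \<rho> \<in> ?V \<and> lexless mu \<nu> \<rho>}" unfolding w_def using irrefl by auto
  then have "wf (w - Id)" using o(1) by simp
  moreover have "refl_on ?V w" unfolding w_def refl_on_def by auto
  moreover have "trans w" unfolding w_def trans_def using o(2) by blast
  moreover have "antisym w" unfolding w_def antisym_def using o(2) irrefl by blast
  moreover have "total_on ?V w" unfolding w_def total_on_def using o(3) by blast
  moreover have "w \<subseteq> ?V \<times> ?V" unfolding w_def by auto
  ultimately have "Well_order w" unfolding F well_order_on_def linear_order_on_def partial_order_on_def preorder_on_def by simp
  moreover have "\<nu> \<in> underS w \<rho> \<longleftrightarrow> lexless mu \<nu> \<rho>" if "\<nu> \<in> ?V" "\<rho> \<in> ?V" for \<nu> \<rho>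
    unfolding underS_def w_def using that irrefl by auto
  ultimately show ?thesis using F by blast
qed

definition configuration :: "(nat \<Rightarrow> 'k rel) \<Rightarrow> 'a set set \<Rightarrow> 'a set \<Rightarrow> bool" where
  "configuration mu B Z \<longleftrightarrow> (\<exists>x. inj_on x (fin_seqs mu) \<and> x ` fin_seqs mu \<subseteq> Z \<and>
    ((\<forall>\<eta>\<in>inf_seqs mu. \<exists>U\<in>gen B. \<forall>\<nu>\<in>fin_seqs mu. x \<nu> \<in> U \<longleftrightarrow>
       (\<exists>n<length \<nu>. take n \<nu> = restr \<eta> n \<and> \<nu> ! n \<in> underS (mu n) (\<eta> n))) \<or>
     (\<forall>\<eta>\<in>inf_seqs mu. \<exists>U\<in>gen B. \<forall>\<nu>\<in>fin_seqs mu. x \<nu> \<in> U \<longleftrightarrow>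
       (\<exists>n<length \<nu>. take n \<nu> = restr \<eta> n \<and> \<eta> n \<in> underS (mu n) (\<nu> ! n))) \<or>
     (\<forall>\<eta>\<in>inf_seqs mu. \<exists>U\<in>gen B. \<forall>\<nu>\<in>fin_seqs mu. x \<nu> \<in> U \<longleftrightarrow> \<not> initial_seg \<nu> \<eta>)))"

lemma tree_config_configuration: "tree_config mu B Z \<Longrightarrow> configuration mu B Z"
  unfolding tree_config_def configuration_def
  apply (elim exE conjE)
  subgoal for b x by (cases b) (auto intro!: exI[of _ x])
  done

lemma configuration_mono:
  assumes "configuration mu B Z" "gen B \<subseteq> gen B'" "Z \<subseteq> Z'" shows "configuration mu B' Z'"
proof -
  have *: "(\<forall>\<eta>\<in>I. \<exists>U\<in>gen B. Q U \<eta>) \<Longrightarrow> (\<forall>\<eta>\<in>I. \<exists>U\<in>gen B'. Q U \<eta>)" for I :: "(nat \<Rightarrow> 'a) set" and Q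
    using assms(2) by blast
  from assms(1) show ?thesis unfolding configuration_def
    apply (elim exE conjE)
    subgoal for x
      apply (intro exI[of _ x] conjI)
        apply assumption
       apply (rule subset_trans[OF _ assms(3)], assumption)
      apply (elim disjE)
        apply (rule disjI1, erule *)
       apply (rule disjI2, rule disjI1, erule *)
      apply (rule disjI2, rule disjI2, erule *)
      done
    done
qed

lemma (in lam_sets) prodcfg_configuration:
  assumes cfg: "prodcfg B Z" and mu: "\<And>n. Well_order (mu n)" "\<And>n. \<exists>m. Field (mu n) \<prec> \<Lambda> m"
  shows "configuration mu B Z"
proof -
  obtain f y b1 b2 where f: "\<forall>n::nat. n \<le> f n \<and> (b1 n \<or> b2 n)" and
    dist: "\<forall>n m. \<forall>i\<in>\<Lambda> (f n). \<forall>j\<in>\<Lambda> (f m). n \<noteq> m \<longrightarrow> y n i \<noteq> y m j" and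
    yZ: "\<forall>n. \<forall>i\<in>\<Lambda> (f n). y n i \<in> Z" and
    U: "\<forall>\<eta>. (\<forall>n. \<eta> n \<in> \<Lambda> (f n)) \<longrightarrow>
        (\<exists>U\<in>gen B. \<forall>n. \<forall>i\<in>\<Lambda> (f n). y n i \<in> U \<longleftrightarrow> pr (ord (f n)) (b1 n) (b2 n) i (\<eta> n))"
    using cfg unfolding prodcfg_def by (elim exE conjE) (rule that)
  \<comment> \<open>Infinitely many levels share both flags; only these are used, because one
    configuration must serve all lengths.\<close>
  have "\<exists>a0\<in>(UNIV::nat set). infinite {a\<in>UNIV. (b1 a, b2 a) = (b1 a0, b2 a0)}"
    by (rule pigeonhole_infinite) auto
  then obtain n0 where S: "infinite {n. b1 n = b1 n0 \<and> b2 n = b2 n0}" by auto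
  define S where "S = {n. b1 n = b1 n0 \<and> b2 n = b2 n0}"
  define c1 c2 where "c1 = b1 n0" and "c2 = b2 n0"
  have c: "c1 \<or> c2" using f unfolding c1_def c2_def by blast
  obtain k where k: "\<And>n. Field (mu n) \<prec> \<Lambda> (k n)" using mu(2) by metis
  \<comment> \<open>The sum bounds the number of sequences of length \<open>m\<close>, and adding 1
    makes the bound strict, as the order embedding requires.\<close>
  define t where "t m = (\<Sum>i<m. k i) + 1" for m
  have lev: "levels mu m \<prec> \<Lambda> (t m)" for m
  proof -
    have "levels mu m \<subseteq> lists (\<Union>i<m. Field (mu i))" unfolding levels_def fin_seqs_def
      by (fastforce simp: in_set_conv_nth)
    then have "levels mu m \<lesssim> lists (\<Union>i<m. Field (mu i))" by (rule subset_imp_lepoll)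
    also have "\<dots> \<lesssim> \<Lambda> (\<Sum>i<m. k i)"
    proof (rule lists_lepoll[OF inf UN_lepoll[OF inf nat_lepoll[OF inf]]])
      fix i assume "i \<in> {..<m}"
      then have "k i \<le> (\<Sum>i<m. k i)" by (intro member_le_sum) auto
      then show "Field (mu i) \<lesssim> \<Lambda> (\<Sum>i<m. k i)"
        using k[of i] Lam_mono lesspoll_imp_lepoll lepoll_trans by metis
    qed
    also have "\<dots> \<prec> \<Lambda> (t m)" unfolding t_def by (rule Lam_less) simp
    finally show ?thesis .
  qed
  \<comment> \<open>Position \<open>t m + m\<close> ensures a level with enough indices; the summand
    \<open>m\<close> makes \<open>g\<close> strictly increasing.\<close>
  define g where "g m = enumerate S (t m + m)" for m
  have S': "infinite S" using S unfolding S_def .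
  have gS: "b1 (g m) = c1 \<and> b2 (g m) = c2" for m
    using enumerate_in_set[OF S', of "t m + m"] unfolding g_def S_def c1_def c2_def by simp
  have "t m + m < t (Suc m) + Suc m" for m unfolding t_def by simp
  then have "g m < g (Suc m)" for m unfolding g_def using S' by (rule enumerate_mono)
  then have "strict_mono g" by (rule strict_monoI_Suc)
  then have ginj: "g n = g m \<longleftrightarrow> n = m" for n m by (rule strict_mono_eq)
  have "t m \<le> f (g m)" for m
    using le_enumerate[OF S', of "t m + m"] f order_trans[of "t m" "g m" "f (g m)"] unfolding g_def by simp
  then have lev': "levels mu m \<prec> \<Lambda> (f (g m))" for m using lev Lam_mono lesspoll_trans2 by metis
  have "\<forall>m. \<exists>w. Well_order w \<and> Field w = levels mu m \<and>
    (\<forall>\<nu>\<in>levels mu m. \<forall>\<rho>\<in>levels mu m. \<nu> \<in> underS w \<rho> \<longleftrightarrow> lexless mu \<nu> \<rho>)"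
    by (intro allI lex_well_order mu)
  then obtain w where w: "\<And>m. Well_order (w m)" "\<And>m. Field (w m) = levels mu m"
    "\<And>m \<nu> \<rho>. \<nu> \<in> levels mu m \<Longrightarrow> \<rho> \<in> levels mu m \<Longrightarrow> \<nu> \<in> underS (w m) \<rho> \<longleftrightarrow> lexless mu \<nu> \<rho>" by metis
  have "\<forall>m. \<exists>e. (\<forall>j\<in>Field (w m). e j \<in> Field (ord (f (g m)))) \<and>
      (\<forall>j\<in>Field (w m). \<forall>i\<in>underS (w m) j. e i \<in> underS (ord (f (g m))) (e j))"
    using lev' w(2) by (intro allI mono_into_card Card_ord w(1)) simp
  then obtain h where h: "\<And>m \<nu>. \<nu> \<in> levels mu m \<Longrightarrow> h m \<nu> \<in> \<Lambda> (f (g m))" and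
    hm: "\<And>m. \<forall>j\<in>Field (w m). \<forall>i\<in>underS (w m) j. h m i \<in> underS (ord (f (g m))) (h m j)"
    unfolding w(2) Field_ord by metis
  have hpr: "pr (ord (f (g m))) c1 c2 (h m \<nu>) (h m \<rho>) \<longleftrightarrow> \<nu> \<noteq> \<rho> \<and> (if lexless mu \<nu> \<rho> then c1 else c2)"
    if "\<nu> \<in> levels mu m" "\<rho> \<in> levels mu m" for m \<nu> \<rho>
  proof -
    have "pr (ord (f (g m))) c1 c2 (h m \<nu>) (h m \<rho>) \<longleftrightarrow> pr (w m) c1 c2 \<nu> \<rho>"
      by (rule pr_embed[OF wo_ord w(1) hm]) (use that w(2) in simp_all)
    then show ?thesis unfolding pr_def w(3)[OF that] .
  qed
  define x where "x \<nu> = y (g (length \<nu>)) (h (length \<nu>) \<nu>)" for \<nu>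
  have lv: "\<nu> \<in> levels mu (length \<nu>)" if "\<nu> \<in> fin_seqs mu" for \<nu> using that unfolding levels_def by simp
  have UU: "\<exists>U\<in>gen B. \<forall>\<nu>\<in>fin_seqs mu. x \<nu> \<in> U \<longleftrightarrow> \<nu> \<noteq> \<rho> (length \<nu>) \<and> (if lexless mu \<nu> (\<rho> (length \<nu>)) then c1 else c2)"
    if \<rho>: "\<And>m. \<rho> m \<in> levels mu m" for \<rho>
  proof -
    \<comment> \<open>Levels outside the range of \<open>g\<close> carry no point of the tree and
      get an arbitrary index.\<close>
    define \<eta>' where "\<eta>' n = (if \<exists>m. n = g m then h (THE m. n = g m) (\<rho> (THE m. n = g m)) else (SOME i. i \<in> \<Lambda> (f n)))" for n
    have g': "\<eta>' (g m) = h m (\<rho> m)" for m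
    proof -
      have "(THE m'. g m = g m') = m" using ginj by (intro the_equality) auto
      then show ?thesis unfolding \<eta>'_def by auto
    qed
    have "\<eta>' n \<in> \<Lambda> (f n)" for n
    proof (cases "\<exists>m. n = g m")
      case True
      then obtain m where "n = g m" ..
      then show ?thesis using g'[of m] h[OF \<rho>[of m]] by simp
    next
      case False
      have "\<exists>i. i \<in> \<Lambda> (f n)" using inf[of "f n"] by (metis ex_in_conv finite.emptyI)
      then have "(SOME i. i \<in> \<Lambda> (f n)) \<in> \<Lambda> (f n)" by (rule someI_ex)
      then show ?thesis using False unfolding \<eta>'_def by simp
    qed
    then obtain U' where U': "U' \<in> gen B" "\<forall>n. \<forall>i\<in>\<Lambda> (f n). y n i \<in> U' \<longleftrightarrow> pr (ord (f n)) (b1 n) (b2 n) i (\<eta>' n)"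
      using U by blast
    have "x \<nu> \<in> U' \<longleftrightarrow> \<nu> \<noteq> \<rho> (length \<nu>) \<and> (if lexless mu \<nu> (\<rho> (length \<nu>)) then c1 else c2)" if "\<nu> \<in> fin_seqs mu" for \<nu>
      using U'(2)[rule_format, OF h[OF lv[OF that]]] hpr[OF lv[OF that] \<rho>] gS unfolding x_def g' by simp
    then show ?thesis using U'(1) by blast
  qed
  have inj: "inj_on x (fin_seqs mu)"
  proof (rule inj_onI, rule ccontr)
    fix \<nu> \<rho> assume a: "\<nu> \<in> fin_seqs mu" "\<rho> \<in> fin_seqs mu" "x \<nu> = x \<rho>" "\<nu> \<noteq> \<rho>"
    have len: "length \<nu> = length \<rho>"
    proof (rule ccontr)
      assume "length \<nu> \<noteq> length \<rho>"
      then have "g (length \<nu>) \<noteq> g (length \<rho>)" using ginj by simp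
      then show False using dist h[OF lv[OF a(1)]] h[OF lv[OF a(2)]] a(3) unfolding x_def by blast
    qed
    let ?m = "length \<nu>"
    have l: "\<nu> \<in> levels mu ?m" "\<rho> \<in> levels mu ?m" using lv[OF a(1)] lv[OF a(2)] len by simp_all
    from lexless_order(3)[where mu = mu, OF mu(1) l] a(4)
    have "pr (ord (f (g ?m))) c1 c2 (h ?m \<nu>) (h ?m \<rho>) \<or> pr (ord (f (g ?m))) c1 c2 (h ?m \<rho>) (h ?m \<nu>)"
      using c a(4) lexless_order(2)[where mu = mu, OF mu(1) l(1,2,1)] wf_not_refl[OF lexless_order(1)[where mu = mu, OF mu(1)], of \<nu> ?m] l(1)
      unfolding hpr[OF l] hpr[OF l(2,1)] by auto
    \<comment> \<open>Equal points lie in the same open sets, and no point lies in the set of its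
      own index.\<close>
    moreover have "\<not> pr (ord (f (g ?m))) c1 c2 (h ?m \<alpha>) (h ?m \<beta>)"
      if "\<alpha> \<in> levels mu ?m" "\<beta> \<in> levels mu ?m" "x \<alpha> = x \<beta>" for \<alpha> \<beta>
    proof -
      have e: "y (g ?m) (h ?m \<alpha>) = y (g ?m) (h ?m \<beta>)" using that unfolding x_def levels_def by simp
      have "\<exists>i. i \<in> \<Lambda> (f n)" for n using inf[of "f n"] by (metis ex_in_conv finite.emptyI)
      then have "(SOME i. i \<in> \<Lambda> (f n)) \<in> \<Lambda> (f n)" for n by (rule someI_ex)
      then have "\<forall>n. ((\<lambda>n. SOME i. i \<in> \<Lambda> (f n))(g ?m := h ?m \<beta>)) n \<in> \<Lambda> (f n)" using h[OF that(2)] by simp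
      from U[rule_format, OF this[rule_format]] obtain U' where U': "\<forall>n. \<forall>i\<in>\<Lambda> (f n). y n i \<in> U' \<longleftrightarrow>
        pr (ord (f n)) (b1 n) (b2 n) i (((\<lambda>n. SOME i. i \<in> \<Lambda> (f n))(g ?m := h ?m \<beta>)) n)" by blast
      from U'[rule_format, OF h[OF that(1)]] U'[rule_format, OF h[OF that(2)]] show ?thesis
        using e gS by (simp add: pr_def)
    qed
    ultimately show False using l a(3) by metis
  qed
  have "x ` fin_seqs mu \<subseteq> Z" unfolding x_def using yZ h[OF lv] by blast
  moreover have "(\<forall>\<eta>\<in>inf_seqs mu. \<exists>U\<in>gen B. \<forall>\<nu>\<in>fin_seqs mu. x \<nu> \<in> U \<longleftrightarrow>
       (\<exists>n<length \<nu>. take n \<nu> = restr \<eta> n \<and> \<nu> ! n \<in> underS (mu n) (\<eta> n))) \<or>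
     (\<forall>\<eta>\<in>inf_seqs mu. \<exists>U\<in>gen B. \<forall>\<nu>\<in>fin_seqs mu. x \<nu> \<in> U \<longleftrightarrow>
       (\<exists>n<length \<nu>. take n \<nu> = restr \<eta> n \<and> \<eta> n \<in> underS (mu n) (\<nu> ! n))) \<or>
     (\<forall>\<eta>\<in>inf_seqs mu. \<exists>U\<in>gen B. \<forall>\<nu>\<in>fin_seqs mu. x \<nu> \<in> U \<longleftrightarrow> \<not> initial_seg \<nu> \<eta>)"
  proof -
    have lev_restr: "restr \<eta> m \<in> levels mu m" if "\<eta> \<in> inf_seqs mu" for \<eta> m
      using restr_fin_seqs[OF that] unfolding levels_def by simp
    have rs: "take n (restr \<eta> m) = restr \<eta> n" "restr \<eta> m ! n = \<eta> n" if "n < m" for n m :: nat and \<eta>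
      using that take_restr[of n m \<eta>] by (simp_all add: restr_def)
    have less1: "lexless mu \<nu> (restr \<eta> (length \<nu>)) \<longleftrightarrow>
      (\<exists>n<length \<nu>. take n \<nu> = restr \<eta> n \<and> \<nu> ! n \<in> underS (mu n) (\<eta> n))" for \<nu> \<eta>
      unfolding lexless_def by (intro ex_cong1 conj_cong refl) (simp_all add: rs)
    have less2: "lexless mu (restr \<eta> (length \<nu>)) \<nu> \<longleftrightarrow>
      (\<exists>n<length \<nu>. take n \<nu> = restr \<eta> n \<and> \<eta> n \<in> underS (mu n) (\<nu> ! n))" for \<nu> \<eta>
      unfolding lexless_def length_restr by (intro ex_cong1 conj_cong refl) (auto simp: rs)
    \<comment> \<open>Trichotomy against the restriction of \<open>\<eta>\<close> to the same length
      translates the flags into (a), (b) and (c).\<close>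
    have trich: "\<nu> \<noteq> restr \<eta> (length \<nu>) \<and> (if lexless mu \<nu> (restr \<eta> (length \<nu>)) then c1 else c2) \<longleftrightarrow>
      (if c1 \<and> c2 then \<not> initial_seg \<nu> \<eta> else if c1 then lexless mu \<nu> (restr \<eta> (length \<nu>))
        else lexless mu (restr \<eta> (length \<nu>)) \<nu>)" if "\<nu> \<in> fin_seqs mu" "\<eta> \<in> inf_seqs mu" for \<nu> \<eta>
    proof -
      let ?r = "restr \<eta> (length \<nu>)"
      note l = lv[OF that(1)] lev_restr[OF that(2), of "length \<nu>"]
      have "\<not> lexless mu \<nu> \<nu>" using wf_not_refl[OF lexless_order(1)[where mu = mu, OF mu(1)], of \<nu> "length \<nu>"] l(1) by simp
      moreover have "\<not> (lexless mu \<nu> ?r \<and> lexless mu ?r \<nu>)"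
        using lexless_order(2)[where mu = mu, OF mu(1) l(1,2,1)] calculation by blast
      ultimately show ?thesis using lexless_order(3)[where mu = mu, OF mu(1) l] c unfolding initial_seg_def by auto
    qed
    have U: "\<exists>U\<in>gen B. \<forall>\<nu>\<in>fin_seqs mu. x \<nu> \<in> U \<longleftrightarrow> (if c1 \<and> c2 then \<not> initial_seg \<nu> \<eta>
        else if c1 then (\<exists>n<length \<nu>. take n \<nu> = restr \<eta> n \<and> \<nu> ! n \<in> underS (mu n) (\<eta> n))
        else (\<exists>n<length \<nu>. take n \<nu> = restr \<eta> n \<and> \<eta> n \<in> underS (mu n) (\<nu> ! n)))" if "\<eta> \<in> inf_seqs mu" for \<eta>
    proof -
      from UU[of "restr \<eta>", OF lev_restr[OF that]] obtain U where "U \<in> gen B" "\<forall>\<nu>\<in>fin_seqs mu. x \<nu> \<in> U \<longleftrightarrow>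
        \<nu> \<noteq> restr \<eta> (length \<nu>) \<and> (if lexless mu \<nu> (restr \<eta> (length \<nu>)) then c1 else c2)"
        by blast
      then show ?thesis using trich[OF _ that] less1[of _ \<eta>] less2[of \<eta>] by (intro bexI[of _ U]) simp_all
    qed
    consider "c1 \<and> c2" | "c1" "\<not> c2" | "\<not> c1" by blast
    then show ?thesis
      by cases (rule disjI2, rule disjI2, use U in simp, rule disjI1, use U in simp, rule disjI2, rule disjI1, use U in simp)
  qed
  ultimately show ?thesis unfolding configuration_def using inj by blast
qed

section \<open>Spaces with a base of size \<open>M\<close>\<close>

lemma gen_mono: "B \<subseteq> B' \<Longrightarrow> gen B \<subseteq> gen B'"
  unfolding gen_def by blast

text \<open>In \<open>cov\<close>, the sets \<open>N\<close> and \<open>Q\<close> stand for \<mu>_n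
  and \<lambda>_n with \<open>n\<close> beyond \<open>j\<close>, \<open>\<A>\<close> is the covering
  family, and \<open>\<D>\<close> is the part of it that covers \<open>a\<close>.\<close>

locale cov_space = lam_space \<Lambda> B Z for \<Lambda> :: "nat \<Rightarrow> 'k set" and B :: "'a set set" and Z +
  fixes M :: "'m set"
  assumes LM: "Lset \<lesssim> M" and BM: "B \<lesssim> M" and BZ: "\<And>V. V \<in> B \<Longrightarrow> V \<subseteq> Z"
    and cov: "\<And>j. \<exists>N Q p \<A>. infinite (N :: 'k set) \<and> \<Lambda> j \<lesssim> N \<and> \<not> (Q :: 'k set) \<lesssim> Pow (Pow N) \<and> Pow Q \<lesssim> M \<and> Q \<lesssim> \<Lambda> p \<and>
      \<A> \<lesssim> M \<and> (\<forall>A\<in>\<A>. A \<lesssim> Q) \<and> (\<forall>a\<subseteq>M. a \<lesssim> Q \<longrightarrow> (\<exists>\<D>\<subseteq>\<A>. \<D> \<lesssim> N \<and> a \<subseteq> \<Union>\<D>))"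
begin

lemma Minf: "infinite M"
  using LM Lset_inf by (meson infinite_le_lepoll lepoll_trans)

section \<open>Neighbourhood filters of points\<close>

definition nbhds :: "'a \<Rightarrow> 'a set set" where
  "nbhds x = {V\<in>B. x \<in> V}"

lemma gen_nbhds: assumes "nbhds x = nbhds z" "W \<in> gen B" "x \<in> W" shows "z \<in> W"
proof -
  from gen_E[OF assms(2,3)] obtain V where V: "V \<in> B" "x \<in> V" "V \<subseteq> W" by blast
  then have "V \<in> nbhds z" using assms(1) unfolding nbhds_def by blast
  then show ?thesis using V(3) unfolding nbhds_def by blast
qed

text \<open>The filter of \<open>x\<close> is read off from the set of traces on \<open>X\<close>
  that contain \<open>x\<close>.\<close>

lemma nbhds_traces: "nbhds ` X \<lesssim> Pow (traces (gen B) X)"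
proof -
  have "nbhds ` X \<subseteq> (\<lambda>\<T>. {V\<in>B. V \<inter> X \<in> \<T>}) ` Pow (traces (gen B) X)"
  proof
    fix F assume "F \<in> nbhds ` X"
    then obtain x where x: "x \<in> X" "F = nbhds x" by blast
    have "F = {V\<in>B. V \<inter> X \<in> {T\<in>traces (gen B) X. x \<in> T}}"
      unfolding x(2) nbhds_def traces_def using x(1) gen_base by blast
    then show "F \<in> (\<lambda>\<T>. {V\<in>B. V \<inter> X \<in> \<T>}) ` Pow (traces (gen B) X)" by (rule image_eqI) blast
  qed
  then show ?thesis by (rule subset_image_lepoll)
qed

text \<open>The ideal now consists of the sets with at most \<open>M\<close> filters; it is local
  because the base has at most \<open>M\<close> members. Cylinders of neighbourhood filters come
  from sets of points, so no detour through irreducible sets is made.\<close>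

lemma many_points:
  fixes mu :: "nat \<Rightarrow> 'c rel"
  assumes big: "\<not> nbhds ` Z \<lesssim> M" and np: "\<not> prodcfg B Z"
    and mu: "\<And>n. Well_order (mu n)" "\<And>n. \<exists>m. Field (mu n) \<prec> \<Lambda> m"
  shows "tree_config mu B Z"
proof -
  have large: "\<not> traces (gen B) X \<lesssim> \<Lambda> n" if "\<not> nbhds ` X \<lesssim> M" for X n
  proof
    assume "traces (gen B) X \<lesssim> \<Lambda> n"
    then have "Pow (traces (gen B) X) \<lesssim> \<Lambda> (Suc n)" using Pow_lepoll_mono pow lepoll_trans by blast
    then have "nbhds ` X \<lesssim> Lset" using nbhds_traces Lam_Lset lepoll_trans by metis
    then show False using that LM lepoll_trans by blast
  qed
  interpret ideal_space B Z "\<lambda>X. nbhds ` X \<lesssim> M"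
  proof
    show "nbhds ` {} \<lesssim> M" by (simp add: finite_lepoll[OF Minf])
    show "nbhds ` Y \<lesssim> M" if "nbhds ` X \<lesssim> M" "Y \<subseteq> X" for X Y
      using that by (meson image_mono lepoll_trans subset_imp_lepoll)
    show "nbhds ` (X \<union> Y) \<lesssim> M" if "nbhds ` X \<lesssim> M" "nbhds ` Y \<lesssim> M" for X Y
      using that by (simp add: image_Un Un_lepoll[OF Minf])
    show "nbhds ` X \<lesssim> M" if "X \<subseteq> Z" "\<And>x. x \<in> X \<Longrightarrow> \<exists>V\<in>B. x \<in> V \<and> nbhds ` (X \<inter> V) \<lesssim> M" for X
    proof -
      let ?B' = "{V\<in>B. nbhds ` (X \<inter> V) \<lesssim> M}"
      have "nbhds ` X \<subseteq> (\<Union>V\<in>?B'. nbhds ` (X \<inter> V))"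
      proof
        fix F assume "F \<in> nbhds ` X"
        then obtain x where x: "x \<in> X" "F = nbhds x" by blast
        from that(2)[OF x(1)] obtain V where "V \<in> ?B'" "x \<in> V" by blast
        then show "F \<in> (\<Union>V\<in>?B'. nbhds ` (X \<inter> V))" using x by blast
      qed
      moreover have "(\<Union>V\<in>?B'. nbhds ` (X \<inter> V)) \<lesssim> M"
      proof (rule UN_lepoll[OF Minf])
        show "?B' \<lesssim> M" by (rule lepoll_trans[OF subset_imp_lepoll BM]) blast
      qed blast
      ultimately show ?thesis by (meson lepoll_trans subset_imp_lepoll)
    qed
    show "\<not> (\<exists>A U V. A 0 \<subseteq> Z \<and> (\<forall>n::nat. U n \<in> gen B \<and> V n \<in> gen B \<and>
      A (Suc n) = A n \<inter> U n - V n \<and> \<not> nbhds ` (A n \<inter> V n - U n) \<lesssim> M))"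
    proof (intro notI, elim exE conjE)
      fix A U V :: "nat \<Rightarrow> 'a set"
      assume A0: "A 0 \<subseteq> Z" and s: "\<forall>n. U n \<in> gen B \<and> V n \<in> gen B \<and> A (Suc n) = A n \<inter> U n - V n \<and> \<not> nbhds ` (A n \<inter> V n - U n) \<lesssim> M"
      have "prodcfg B Z" by (rule split_sequence_prodcfg[of A U V, OF A0]) (use s large in blast)
      then show False using np by simp
    qed
  qed
  have sub: "nbhds ` Z \<subseteq> Pow B" unfolding nbhds_def by blast
  have lrg: "\<not> nbhds ` (Z \<inter> \<Inter>G - \<Union>H) \<lesssim> M"
    if "finite G" "finite H" "G \<subseteq> B" "H \<subseteq> B" "\<not> cyl (nbhds ` Z) G H \<lesssim> M" for G H
  proof -
    have "G \<subseteq> nbhds x \<and> H \<inter> nbhds x = {} \<longleftrightarrow> x \<in> \<Inter>G - \<Union>H" for x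
      unfolding nbhds_def using that(3,4) by blast
    then have "cyl (nbhds ` Z) G H = nbhds ` (Z \<inter> \<Inter>G - \<Union>H)" unfolding cyl_def by blast
    then show ?thesis using that(5) by simp
  qed
  have "\<exists>K\<subseteq>nbhds ` Z. K \<noteq> {} \<and> (\<forall>F\<in>K. \<forall>F'\<in>K. F \<subseteq> F' \<or> F' \<subseteq> F) \<and>
    (\<forall>G H. finite G \<longrightarrow> finite H \<longrightarrow> G \<subseteq> B \<longrightarrow> H \<subseteq> B \<longrightarrow> cyl K G H \<noteq> {} \<longrightarrow> \<not> cyl K G H \<lesssim> M)"
    by (rule filter_chain[OF Minf BM big sub lrg])
  then obtain K where K: "K \<subseteq> nbhds ` Z" "K \<noteq> {}" "\<forall>F\<in>K. \<forall>F'\<in>K. F \<subseteq> F' \<or> F' \<subseteq> F"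
    "\<forall>G H. finite G \<longrightarrow> finite H \<longrightarrow> G \<subseteq> B \<longrightarrow> H \<subseteq> B \<longrightarrow> cyl K G H \<noteq> {} \<longrightarrow> \<not> cyl K G H \<lesssim> M"
    by (elim exE conjE) (rule that)
  show ?thesis
  proof (rule large_chain_tree[OF K(2) _ K(3) _ _ mu])
    show "K \<subseteq> Pow B" using K(1) sub by blast
    show "\<forall>F\<in>K. \<forall>G. finite G \<longrightarrow> G \<subseteq> F \<longrightarrow> (\<exists>x\<in>Z. x \<in> \<Inter>G \<and> (\<forall>V\<in>B - F. x \<notin> V))"
    proof (intro ballI allI impI)
      fix F G assume "F \<in> K" "G \<subseteq> F"
      then obtain x where "x \<in> Z" "F = nbhds x" using K(1) by blast
      then show "\<exists>x\<in>Z. x \<in> \<Inter>G \<and> (\<forall>V\<in>B - F. x \<notin> V)"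
        using \<open>G \<subseteq> F\<close> unfolding nbhds_def by (intro bexI[of _ x]) auto
    qed
    show "\<forall>G H. finite G \<longrightarrow> finite H \<longrightarrow> G \<subseteq> B \<longrightarrow> H \<subseteq> B \<longrightarrow> cyl K G H \<noteq> {} \<longrightarrow> \<not> cyl K G H \<lesssim> Lset"
    proof (intro allI impI)
      fix G H assume "finite G" "finite H" "G \<subseteq> B" "H \<subseteq> B" "cyl K G H \<noteq> {}"
      then have "\<not> cyl K G H \<lesssim> M" using K(4) by simp
      then show "\<not> cyl K G H \<lesssim> Lset" using LM lepoll_trans by blast
    qed
  qed
qed

text \<open>One point per neighbourhood filter: points with the same filter lie in the same open
  sets, so conditions on representatives suffice and there are at most \<open>M\<close> of them when
  the filters are few.\<close>

definition rep :: "'a \<Rightarrow> 'a" where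
  "rep z = inv_into Z nbhds (nbhds z)"

lemma rep: assumes "z \<in> Z" shows "rep z \<in> Z" "nbhds (rep z) = nbhds z"
  using inv_into_into[of "nbhds z" nbhds Z] f_inv_into_f[of "nbhds z" nbhds Z] assms unfolding rep_def by simp_all

definition conds :: "('a \<times> 'a set) set" where
  "conds = rep ` Z \<times> B"

lemma conds_lepoll: assumes "nbhds ` Z \<lesssim> M" shows "conds \<lesssim> M"
proof -
  have "rep ` Z = inv_into Z nbhds ` (nbhds ` Z)" unfolding rep_def by (simp add: image_image)
  then have "rep ` Z \<lesssim> nbhds ` Z" by (simp add: image_lepoll)
  then show ?thesis unfolding conds_def using Times_lepoll[OF Minf _ BM] assms lepoll_trans by blast
qed

text \<open>Separation by one pair of a point and a basic set survives the passage to any subspace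
  containing \<open>fst q\<close> and any coarser base containing \<open>snd q\<close>.\<close>

definition separates :: "('a \<times> 'a set) set \<Rightarrow> 'a set set \<Rightarrow> 'a set set \<Rightarrow> bool" where
  "separates E P P' \<longleftrightarrow> (\<exists>q\<in>E. fst q \<in> snd q \<and>
     ((\<forall>W\<in>P. snd q \<subseteq> W) \<and> (\<forall>W\<in>P'. fst q \<notin> W) \<or> (\<forall>W\<in>P'. snd q \<subseteq> W) \<and> (\<forall>W\<in>P. fst q \<notin> W)))"

lemma separates_opens:
  assumes W: "W \<in> gen B" "W' \<in> gen B" "W \<noteq> W'"
  shows "separates conds {W} {W'}"
proof -
  have *: "\<exists>q\<in>conds. fst q \<in> snd q \<and> snd q \<subseteq> U \<and> fst q \<notin> U'"
    if U: "U \<in> gen B" "U' \<in> gen B" "z \<in> U" "z \<notin> U'" for U U' z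
  proof -
    from gen_E[OF U(1,3)] obtain V where V: "V \<in> B" "z \<in> V" "V \<subseteq> U" by blast
    then have z: "z \<in> Z" using BZ by blast
    have "rep z \<in> V" using gen_nbhds[OF rep(2)[OF z, symmetric] gen_base[OF V(1)] V(2)] .
    moreover have "rep z \<notin> U'" using gen_nbhds[OF rep(2)[OF z] U(2)] U(4) by blast
    moreover have "(rep z, V) \<in> conds" unfolding conds_def using V(1) z by blast
    ultimately show ?thesis using V(3) by (intro bexI[of _ "(rep z, V)"]) auto
  qed
  from W(3) consider z where "z \<in> W" "z \<notin> W'" | z where "z \<in> W'" "z \<notin> W" by blast
  then show ?thesis
  proof cases
    case 1
    from *[OF W(1,2) 1] show ?thesis unfolding separates_def by auto
  next
    case 2
    from *[OF W(2,1) 2] show ?thesis unfolding separates_def by auto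
  qed
qed

text \<open>The type of \<open>W\<close> over the set \<open>A\<close> of conditions.\<close>

definition decided :: "('a \<times> 'a set) set \<Rightarrow> 'a set \<Rightarrow> ('a \<times> 'a set) set \<times> ('a \<times> 'a set) set" where
  "decided A W = ({q\<in>A. snd q \<subseteq> W}, {q\<in>A. fst q \<notin> W})"

definition splits :: "nat \<Rightarrow> 'a set set \<Rightarrow> ('a \<times> 'a set) set \<Rightarrow> ('k \<Rightarrow> 'a set set) \<Rightarrow> bool" where
  "splits j P E PP \<longleftrightarrow> E \<subseteq> conds \<and> E \<lesssim> Lset \<and> (\<forall>i\<in>\<Lambda> j. PP i \<subseteq> P \<and> \<not> PP i \<lesssim> M) \<and>
     (\<forall>i\<in>\<Lambda> j. \<forall>i'\<in>\<Lambda> j. i \<noteq> i' \<longrightarrow> separates E (PP i) (PP i'))"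

text \<open>Take \<open>Q\<close> many members of \<open>P\<close> and a separating condition for
  each pair. The covering family traps these conditions in at most \<open>N\<close> of its members,
  a homogeneous subsequence traps those of \<open>N\<close> many open sets in a single member, and
  the types over that member are the wanted classes.\<close>

lemma ex_splits:
  assumes few: "nbhds ` Z \<lesssim> M" and P: "P \<subseteq> gen B" "\<not> P \<lesssim> M"
  shows "\<exists>E PP. splits j P E PP"
proof -
  obtain N Q :: "'k set" and p \<A> where N: "infinite N" "\<Lambda> j \<lesssim> N" and Q: "\<not> Q \<lesssim> Pow (Pow N)" "Pow Q \<lesssim> M" "Q \<lesssim> \<Lambda> p"
    and \<A>: "\<A> \<lesssim> M" "\<forall>A\<in>\<A>. A \<lesssim> Q" and co: "\<forall>a\<subseteq>M. a \<lesssim> Q \<longrightarrow> (\<exists>\<D>\<subseteq>\<A>. \<D> \<lesssim> N \<and> a \<subseteq> \<Union>\<D>)"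
    using cov[of j] by (elim exE conjE) (rule that)
  obtain \<phi> where \<phi>: "inj_on \<phi> conds" "\<phi> ` conds \<subseteq> M" using conds_lepoll[OF few] unfolding lepoll_def by blast
  define cc where "cc A = {q\<in>conds. \<phi> q \<in> A}" for A
  have ccQ: "cc A \<lesssim> Q" if "A \<in> \<A>" for A
  proof -
    have "inj_on \<phi> (cc A)" using \<phi>(1) by (rule inj_on_subset) (auto simp: cc_def)
    moreover have "\<phi> ` cc A \<subseteq> A" unfolding cc_def by blast
    ultimately have "cc A \<lesssim> A" unfolding lepoll_def by blast
    then show ?thesis using \<A>(2) that lepoll_trans by blast
  qed
  define cls where "cls A W = {W'\<in>P. decided (cc A) W' = decided (cc A) W}" for A W
  \<comment> \<open>Each member of \<open>\<A>\<close> has at most \<open>M\<close> types, so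
    removing all sets whose type over some member is small removes at most \<open>M\<close> sets.
    Hence all types are large whichever member is found later.\<close>
  define P' where "P' = {W\<in>P. \<forall>A\<in>\<A>. \<not> cls A W \<lesssim> M}"
  have decM: "decided (cc A) ` P \<lesssim> M" if "A \<in> \<A>" for A
  proof -
    have "decided (cc A) ` P \<subseteq> Pow (cc A) \<times> Pow (cc A)" unfolding decided_def by blast
    then have "decided (cc A) ` P \<lesssim> Pow (cc A) \<times> Pow (cc A)" by (rule subset_imp_lepoll)
    moreover have "Pow (cc A) \<lesssim> M" using Pow_lepoll_mono[OF ccQ[OF that]] Q(2) lepoll_trans by blast
    ultimately show ?thesis using Times_lepoll[OF Minf] lepoll_trans by blast
  qed
  have "\<not> P' \<lesssim> M"
  proof
    assume P'M: "P' \<lesssim> M"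
    let ?bad = "\<lambda>A. {d\<in>decided (cc A) ` P. {W'\<in>P. decided (cc A) W' = d} \<lesssim> M}"
    have "P \<subseteq> P' \<union> (\<Union>A\<in>\<A>. \<Union>d\<in>?bad A. {W'\<in>P. decided (cc A) W' = d})"
    proof
      fix W assume W: "W \<in> P"
      show "W \<in> P' \<union> (\<Union>A\<in>\<A>. \<Union>d\<in>?bad A. {W'\<in>P. decided (cc A) W' = d})"
      proof (cases "W \<in> P'")
        case False
        then obtain A where A: "A \<in> \<A>" "cls A W \<lesssim> M" using W unfolding P'_def by blast
        then have "decided (cc A) W \<in> ?bad A" using W unfolding cls_def by simp
        then show ?thesis using A(1) W by blast
      qed simp
    qed
    moreover have "(\<Union>A\<in>\<A>. \<Union>d\<in>?bad A. {W'\<in>P. decided (cc A) W' = d}) \<lesssim> M"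
    proof (rule UN_lepoll[OF Minf \<A>(1)], rule UN_lepoll[OF Minf])
      fix A assume "A \<in> \<A>"
      then show "?bad A \<lesssim> M" by (intro lepoll_trans[OF subset_imp_lepoll decM]) auto
    qed simp
    ultimately show False using P(2) Un_lepoll[OF Minf P'M] by (meson lepoll_trans subset_imp_lepoll)
  qed
  moreover have QM: "Q \<lesssim> M" using Q(2) lepoll_Pow_self lepoll_trans by blast
  ultimately have "Q \<lesssim> P'" using lepoll_cases[of Q P'] lesspoll_imp_lepoll lepoll_trans by blast
  then obtain s where s: "inj_on s Q" "s ` Q \<subseteq> P'" unfolding lepoll_def by blast
  define S where "S = s ` Q"
  have SP': "S \<subseteq> P'" using s(2) unfolding S_def .
  have SQ: "S \<lesssim> Q" "Q \<lesssim> S" unfolding S_def using s(1) by (simp_all add: image_lepoll)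
  have P'P: "P' \<subseteq> P" unfolding P'_def by blast
  have "\<exists>q\<in>conds. separates {q} {W} {W'}" if "W \<in> S" "W' \<in> S" "W \<noteq> W'" for W W'
  proof -
    have "separates conds {W} {W'}" using that SP' P'P P(1) by (intro separates_opens) auto
    then show ?thesis unfolding separates_def by auto
  qed
  then have "\<forall>W W'. \<exists>q. W \<in> S \<longrightarrow> W' \<in> S \<longrightarrow> W \<noteq> W' \<longrightarrow> q \<in> conds \<and> separates {q} {W} {W'}" by blast
  then obtain q where q: "\<And>W W'. W \<in> S \<Longrightarrow> W' \<in> S \<Longrightarrow> W \<noteq> W' \<Longrightarrow> q W W' \<in> conds \<and> separates {q W W'} {W} {W'}"
    by metis
  define a where "a = {\<phi> (q W W') | W W'. W \<in> S \<and> W' \<in> S \<and> W \<noteq> W'}"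
  have "infinite Q"
  proof
    assume "finite Q"
    then show False using Q(1) finite_lepoll[of "Pow (Pow N)" Q] N(1) by simp
  qed
  then have "S \<times> S \<lesssim> Q" by (intro Times_lepoll SQ)
  moreover have "a \<subseteq> (\<lambda>p. \<phi> (q (fst p) (snd p))) ` (S \<times> S)" unfolding a_def by force
  ultimately have "a \<lesssim> Q" by (rule lepoll_trans[OF subset_image_lepoll, rotated])
  moreover have "a \<subseteq> M" unfolding a_def using q \<phi>(2) by blast
  ultimately have "\<exists>\<D>\<subseteq>\<A>. \<D> \<lesssim> N \<and> a \<subseteq> \<Union>\<D>" using co by simp
  then obtain \<D> where \<D>: "\<D> \<subseteq> \<A>" "\<D> \<lesssim> N" "a \<subseteq> \<Union>\<D>" by (elim exE conjE)
  have Dq: "\<exists>D\<in>\<D>. q W W' \<in> cc D" if "W \<in> S" "W' \<in> S" "W \<noteq> W'" for W W'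
  proof -
    have "\<phi> (q W W') \<in> a" unfolding a_def using that by blast
    then show ?thesis using \<D>(3) q[OF that] unfolding cc_def by blast
  qed
  then have "\<forall>W W'. \<exists>D. W \<in> S \<longrightarrow> W' \<in> S \<longrightarrow> W \<noteq> W' \<longrightarrow> D \<in> \<D> \<and> q W W' \<in> cc D" by blast
  then obtain col where col: "\<And>W W'. W \<in> S \<Longrightarrow> W' \<in> S \<Longrightarrow> W \<noteq> W' \<Longrightarrow> col W W' \<in> \<D> \<and> q W W' \<in> cc (col W W')"
    by metis
  \<comment> \<open>The colour of a pair is a covering member containing its condition;
    \<open>{}\<close> is only a default elsewhere.\<close>
  define f where "f W W' = (if W \<in> S \<and> W' \<in> S \<and> W \<noteq> W' then col W W' else {})" for W W'
  have CN: "insert {} \<D> \<lesssim> N"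
    using Un_lepoll[OF N(1) finite_lepoll[OF N(1), of "{{}}"] \<D>(2)] by simp
  have "insert {} \<D> \<lesssim> Pow N" using CN lepoll_Pow_self lepoll_trans by blast
  then have PP: "Pow N \<times> Pow (Pow N \<times> insert {} \<D>) \<lesssim> Pow (Pow N)" using N(1) by (intro infinite_Pow_times) simp_all
  have big: "\<not> S \<lesssim> Field |Pow N| \<times> Pow (Field |Pow N| \<times> insert {} \<D>)"
  proof
    assume "S \<lesssim> Field |Pow N| \<times> Pow (Field |Pow N| \<times> insert {} \<D>)"
    then have "S \<lesssim> Pow (Pow N)" unfolding Field_card_of by (rule lepoll_trans[OF _ PP])
    from lepoll_trans[OF SQ(2) this] show False using Q(1) by contradiction
  qed
  have wo: "Well_order |Pow N|" by (rule card_of_Well_order)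
  have fC: "f W W' \<in> insert {} \<D>" for W W' using col unfolding f_def by simp
  obtain x g where x: "\<forall>i\<in>Pow N. x i \<in> S \<and> g i \<in> insert {} \<D>"
    and hom: "\<forall>j\<in>Pow N. \<forall>i\<in>underS |Pow N| j. x i \<noteq> x j \<and> f (x i) (x j) = g i"
    using end_homogeneous[OF wo big, of f, OF fC] unfolding Field_card_of by (elim exE conjE) (rule that)
  \<comment> \<open>There are \<open>2^N\<close> indices but at most \<open>N\<close> colours, so
    some colour occurs more than \<open>N\<close> times.\<close>
  have "\<exists>D\<in>insert {} \<D>. \<not> {i\<in>Pow N. g i = D} \<lesssim> N"
  proof (rule ccontr)
    assume "\<not> ?thesis"
    then have "(\<Union>D\<in>insert {} \<D>. {i\<in>Pow N. g i = D}) \<lesssim> N" by (intro UN_lepoll[OF N(1) CN]) blast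
    moreover have "(\<Union>D\<in>insert {} \<D>. {i\<in>Pow N. g i = D}) = Pow N" using x by blast
    ultimately show False using lesspoll_Pow_self[of N] lesspoll_not_lepoll by metis
  qed
  then obtain D where D: "\<not> {i\<in>Pow N. g i = D} \<lesssim> N" by blast
  define H where "H = {i\<in>Pow N. g i = D}"
  have "N \<lesssim> H" using lepoll_cases[of H N] D lesspoll_imp_lepoll unfolding H_def by blast
  then have "\<Lambda> j \<lesssim> H" using N(2) lepoll_trans by blast
  then obtain e where e: "inj_on e (\<Lambda> j)" "e ` \<Lambda> j \<subseteq> H" unfolding lepoll_def by blast
  have sepH: "D \<in> \<D> \<and> separates (cc D) (cls D (x a)) (cls D (x b))"
    if ab: "a \<in> H" "b \<in> H" "a \<in> underS |Pow N| b" for a b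
  proof -
    have xx: "x a \<noteq> x b" "f (x a) (x b) = D" "x a \<in> S" "x b \<in> S" using hom x ab unfolding H_def by auto
    then have c: "col (x a) (x b) = D" unfolding f_def by simp
    have qq: "D \<in> \<D>" "q (x a) (x b) \<in> cc D" using col[OF xx(3,4,1)] unfolding c by auto
    have "separates {q (x a) (x b)} {x a} {x b}" using q[OF xx(3,4,1)] by blast
    then have s: "fst (q (x a) (x b)) \<in> snd (q (x a) (x b))"
      "snd (q (x a) (x b)) \<subseteq> x a \<and> fst (q (x a) (x b)) \<notin> x b \<or> snd (q (x a) (x b)) \<subseteq> x b \<and> fst (q (x a) (x b)) \<notin> x a"
      unfolding separates_def by simp_all
    \<comment> \<open>Sets of one type over \<open>D\<close> answer alike to a condition in
      \<open>D\<close>, so what separates two representatives separates their whole classes.\<close>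
    have "snd (q (x a) (x b)) \<subseteq> W \<longleftrightarrow> snd (q (x a) (x b)) \<subseteq> x c" "fst (q (x a) (x b)) \<in> W \<longleftrightarrow> fst (q (x a) (x b)) \<in> x c"
      if "W \<in> cls D (x c)" for W c
    proof -
      have "decided (cc D) W = decided (cc D) (x c)" using that unfolding cls_def by simp
      then have "{q\<in>cc D. snd q \<subseteq> W} = {q\<in>cc D. snd q \<subseteq> x c}" "{q\<in>cc D. fst q \<notin> W} = {q\<in>cc D. fst q \<notin> x c}"
        unfolding decided_def by simp_all
      then show "snd (q (x a) (x b)) \<subseteq> W \<longleftrightarrow> snd (q (x a) (x b)) \<subseteq> x c" "fst (q (x a) (x b)) \<in> W \<longleftrightarrow> fst (q (x a) (x b)) \<in> x c"
        using qq(2) by blast+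
    qed
    then show ?thesis unfolding separates_def using s qq by (intro conjI bexI[of _ "q (x a) (x b)"]) auto
  qed
  have eH: "e i \<in> H" if "i \<in> \<Lambda> j" for i using e(2) that by blast
  have tot: "a \<in> underS |Pow N| b \<or> b \<in> underS |Pow N| a" if "a \<in> H" "b \<in> H" "a \<noteq> b" for a b
    using underS_total[OF wo, of a b] that unfolding Field_card_of H_def by auto
  have sym: "separates E P1 P2 \<longleftrightarrow> separates E P2 P1" for E P1 P2
    unfolding separates_def by (simp only: disj_commute)
  have "splits j P (cc D) (\<lambda>i. cls D (x (e i)))"
    unfolding splits_def
  proof (intro conjI ballI impI)
    obtain i0 where i0: "i0 \<in> \<Lambda> j" using inf[of j] by (metis ex_in_conv finite.emptyI)
    obtain i1 where "i1 \<in> \<Lambda> j - {i0}" using infinite_remove[OF inf, of j i0] by (metis ex_in_conv finite.emptyI)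
    then have i1: "i1 \<in> \<Lambda> j" "e i0 \<noteq> e i1" using e(1) i0 unfolding inj_on_def by auto
    \<comment> \<open>Two different indices are needed because \<open>D\<close> might a priori be
      the default colour.\<close>
    have DD: "D \<in> \<D>" using tot[OF eH[OF i0] eH[OF i1(1)] i1(2)] sepH eH[OF i0] eH[OF i1(1)] by blast
    show "cc D \<subseteq> conds" unfolding cc_def by blast
    show "cc D \<lesssim> Lset" using ccQ[of D] DD \<D>(1) Q(3) Lam_Lset lepoll_trans by (metis subsetD)
    show "cls D (x (e i)) \<subseteq> P" for i unfolding cls_def by blast
    show "\<not> cls D (x (e i)) \<lesssim> M" if "i \<in> \<Lambda> j" for i
    proof -
      have "x (e i) \<in> S" using x eH[OF that] unfolding H_def by blast
      then show ?thesis using SP' DD \<D>(1) unfolding P'_def by blast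
    qed
    fix i i' assume i: "i \<in> \<Lambda> j" "i' \<in> \<Lambda> j" "i \<noteq> i'"
    then have "e i \<noteq> e i'" using e(1) unfolding inj_on_def by blast
    then show "separates (cc D) (cls D (x (e i))) (cls D (x (e i')))"
      using tot[OF eH[OF i(1)] eH[OF i(2)]] sepH[OF eH[OF i(1)] eH[OF i(2)]] sepH[OF eH[OF i(2)] eH[OF i(1)]] sym by blast
  qed
  then show ?thesis by blast
qed

text \<open>Koenig's theorem by a diagonal: coordinate \<open>Suc n\<close> avoids the values there
  of the sequences coded in level \<open>n\<close> of \<open>Lset\<close>, which are too few to
  exhaust \<open>\<Lambda> (Suc n)\<close>.\<close>

lemma konig: "\<not> {\<eta>. \<forall>l. \<eta> l \<in> \<Lambda> l} \<lesssim> Lset"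
proof
  assume "{\<eta>. \<forall>l. \<eta> l \<in> \<Lambda> l} \<lesssim> Lset"
  then obtain f where f: "inj_on f {\<eta>. \<forall>l. \<eta> l \<in> \<Lambda> l}" "f ` {\<eta>. \<forall>l. \<eta> l \<in> \<Lambda> l} \<subseteq> Lset" unfolding lepoll_def by blast
  define g where "g = inv_into {\<eta>. \<forall>l. \<eta> l \<in> \<Lambda> l} f"
  have "\<exists>a. a \<in> \<Lambda> (Suc n) \<and> a \<notin> (\<lambda>b. g (n, b) (Suc n)) ` \<Lambda> n" for n
  proof (rule ccontr)
    assume "\<not> ?thesis"
    then have "\<Lambda> (Suc n) \<subseteq> (\<lambda>b. g (n, b) (Suc n)) ` \<Lambda> n" by blast
    then have "\<Lambda> (Suc n) \<lesssim> \<Lambda> n" by (rule subset_image_lepoll)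
    then show False using Lam_less[of n "Suc n"] lesspoll_not_lepoll by blast
  qed
  then obtain d where d: "\<And>n. d n \<in> \<Lambda> (Suc n) \<and> d n \<notin> (\<lambda>b. g (n, b) (Suc n)) ` \<Lambda> n" by metis
  obtain a0 where a0: "a0 \<in> \<Lambda> 0" using inf[of 0] by (metis ex_in_conv finite.emptyI)
  define \<eta> where "\<eta> l = (case l of 0 \<Rightarrow> a0 | Suc n \<Rightarrow> d n)" for l
  have \<eta>: "\<forall>l. \<eta> l \<in> \<Lambda> l" using a0 d unfolding \<eta>_def by (simp split: nat.split)
  then have "f \<eta> \<in> Lset" "g (f \<eta>) = \<eta>" using f unfolding g_def by auto
  then obtain n b where "b \<in> \<Lambda> n" "g (n, b) = \<eta>" unfolding Lset_def by auto
  then have "\<eta> (Suc n) \<in> (\<lambda>b. g (n, b) (Suc n)) ` \<Lambda> n" by force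
  then show False using d[of n] unfolding \<eta>_def by simp
qed

text \<open>Iterating \<open>ex_splits\<close> gives a tree with \<open>\<Lambda> n\<close> branches
  at each node of level \<open>n\<close> and at most \<lambda> conditions in all. Branches yield
  distinct traces, and the product of the \<open>\<Lambda> n\<close> exceeds their sum.\<close>

lemma small_subspace:
  assumes few: "nbhds ` Z \<lesssim> M" and big: "\<not> gen B \<lesssim> M"
  shows "\<exists>Z' B'. Z' \<subseteq> Z \<and> B' \<subseteq> B \<and> (\<forall>U\<in>B'. \<forall>V\<in>B'. U \<inter> V \<in> B') \<and> B' \<lesssim> Lset \<and> \<not> traces (gen B') Z' \<lesssim> Lset"
proof -
  have "\<forall>j P. \<exists>X. P \<subseteq> gen B \<and> \<not> P \<lesssim> M \<longrightarrow> splits j P (fst X) (snd X)"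
  proof (intro allI)
    fix j P
    show "\<exists>X. P \<subseteq> gen B \<and> \<not> P \<lesssim> M \<longrightarrow> splits j P (fst X) (snd X)"
    proof (cases "P \<subseteq> gen B \<and> \<not> P \<lesssim> M")
      case True
      then obtain E PP where "splits j P E PP" using ex_splits[OF few] by blast
      then show ?thesis by (intro exI[of _ "(E, PP)"]) simp
    qed blast
  qed
  then obtain X where X: "\<And>j P. P \<subseteq> gen B \<Longrightarrow> \<not> P \<lesssim> M \<Longrightarrow> splits j P (fst (X j P)) (snd (X j P))" by metis
  define node where "node = walk (\<lambda>P j i. snd (X j P) i) (gen B) 0"
  have node_Nil: "node [] = gen B" unfolding node_def by simp
  have node_snoc: "node (\<sigma> @ [i]) = snd (X (length \<sigma>) (node \<sigma>)) i" for \<sigma> i unfolding node_def by (simp add: walk_snoc)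
  have node: "node \<sigma> \<subseteq> gen B \<and> \<not> node \<sigma> \<lesssim> M" if "\<sigma> \<in> fin_seqs ord" for \<sigma>
    using that
  proof (induction \<sigma> rule: rev_induct)
    case (snoc i \<sigma>)
    have \<sigma>: "\<sigma> \<in> fin_seqs ord" using take_fin_seqs[OF snoc.prems, of "length \<sigma>"] by simp
    have i: "i \<in> \<Lambda> (length \<sigma>)" using nth_fin_seqs[OF snoc.prems, of "length \<sigma>"] by simp
    have n: "node \<sigma> \<subseteq> gen B" "\<not> node \<sigma> \<lesssim> M" using snoc.IH[OF \<sigma>] by auto
    show ?case using X[OF n, of "length \<sigma>"] i n unfolding splits_def node_snoc by (meson subset_trans)
  qed (simp add: node_Nil big)
  define ES where "ES = (\<Union>\<sigma>\<in>fin_seqs ord. fst (X (length \<sigma>) (node \<sigma>)))"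
  have sp: "splits (length \<sigma>) (node \<sigma>) (fst (X (length \<sigma>) (node \<sigma>))) (\<lambda>i. node (\<sigma> @ [i]))" if "\<sigma> \<in> fin_seqs ord" for \<sigma>
    using X node[OF that] unfolding node_snoc by simp
  have "fin_seqs ord \<subseteq> lists (\<Union>n. \<Lambda> n)" unfolding fin_seqs_def by (fastforce simp: in_set_conv_nth)
  then have "fin_seqs ord \<lesssim> lists (\<Union>n. \<Lambda> n)" by (rule subset_imp_lepoll)
  also have "\<dots> \<lesssim> Lset" by (intro lists_lepoll UN_lepoll nat_lepoll Lset_inf Lam_Lset)
  finally have "ES \<lesssim> Lset" unfolding ES_def using sp by (intro UN_lepoll[OF Lset_inf]) (auto simp: splits_def)
  have ESc: "ES \<subseteq> conds" unfolding ES_def by (rule UN_least) (use sp in \<open>simp add: splits_def\<close>)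
  define Z' B0 where "Z' = fst ` ES" and "B0 = snd ` ES"
  define B' where "B' = Inter ` {S. (S \<subseteq> B0 \<and> finite S) \<and> S \<noteq> {}}"
  have B0L: "B0 \<lesssim> Lset" unfolding B0_def using \<open>ES \<lesssim> Lset\<close> image_lepoll lepoll_trans by metis
  have B0B: "B0 \<subseteq> B" unfolding B0_def using ESc unfolding conds_def by auto
  have B0B': "B0 \<subseteq> B'" unfolding B'_def by (auto intro!: image_eqI[of _ Inter "{_}"])
  have "B' \<subseteq> B"
  proof
    fix V assume "V \<in> B'"
    then obtain S where S: "finite S" "S \<noteq> {}" "S \<subseteq> B0" "V = \<Inter>S" unfolding B'_def by blast
    have "\<Inter>S \<in> B" using S(1-3) B0B by (induction S rule: finite_ne_induct) (auto intro: B_Int)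
    then show "V \<in> B" using S(4) by simp
  qed
  moreover have "U \<inter> V \<in> B'" if UV: "U \<in> B'" "V \<in> B'" for U V
  proof -
    obtain S S' where "S \<subseteq> B0" "finite S" "S \<noteq> {}" "U = \<Inter>S" "S' \<subseteq> B0" "finite S'" "V = \<Inter>S'"
      using UV unfolding B'_def by blast
    then show ?thesis unfolding B'_def by (intro image_eqI[of _ Inter "S \<union> S'"]) auto
  qed
  moreover have "B' \<lesssim> Lset"
  proof -
    have "B' \<lesssim> {S. (S \<subseteq> B0 \<and> finite S) \<and> S \<noteq> {}}" unfolding B'_def by (rule image_lepoll)
    also have "\<dots> \<lesssim> {S. S \<subseteq> B0 \<and> finite S}" by (rule subset_imp_lepoll) blast
    also have "\<dots> \<lesssim> Lset" by (rule finite_subsets_lepoll[OF Lset_inf B0L])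
    finally show ?thesis .
  qed
  moreover have "Z' \<subseteq> Z"
  proof
    fix z assume "z \<in> Z'"
    then have "z \<in> rep ` Z" unfolding Z'_def using ESc unfolding conds_def by auto
    then show "z \<in> Z" using rep(1) by blast
  qed
  moreover have "\<not> traces (gen B') Z' \<lesssim> Lset"
  proof
    assume small: "traces (gen B') Z' \<lesssim> Lset"
    \<comment> \<open>The nodes along \<open>\<eta>\<close> may have empty intersection, so
      \<open>U \<eta>\<close> collects the basic sets forced at some finite stage.\<close>
    define U where "U \<eta> = \<Union>{V\<in>B0. \<exists>n. \<forall>W\<in>node (restr \<eta> n). V \<subseteq> W}" for \<eta>
    have Ugen: "U \<eta> \<in> gen B'" for \<eta> unfolding U_def by (rule gen_sub) (use B0B' in blast)
    have restr: "restr \<eta> n \<in> fin_seqs ord" if "\<forall>l. \<eta> l \<in> \<Lambda> l" for \<eta> n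
      by (rule restr_fin_seqs) (use that in \<open>simp add: inf_seqs_def\<close>)
    have dec: "node (restr \<eta> m) \<subseteq> node (restr \<eta> n)" if "\<forall>l. \<eta> l \<in> \<Lambda> l" "n \<le> m" for \<eta> n m
    proof (rule lift_Suc_antimono_le[OF _ that(2)])
      fix n
      have "\<eta> n \<in> \<Lambda> n" using that(1) by blast
      then show "node (restr \<eta> (Suc n)) \<subseteq> node (restr \<eta> n)"
        using sp[OF restr[OF that(1), of n]] unfolding splits_def restr_Suc length_restr by blast
    qed
    have dist: "U \<eta> \<inter> Z' \<noteq> U \<eta>' \<inter> Z'"
      if \<eta>: "\<forall>l. \<eta> l \<in> \<Lambda> l" "\<forall>l. \<eta>' l \<in> \<Lambda> l" and n: "restr \<eta> n = restr \<eta>' n"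
        and q: "q \<in> fst (X n (node (restr \<eta> n)))" "fst q \<in> snd q" "\<forall>W\<in>node (restr \<eta> (Suc n)). snd q \<subseteq> W"
        "\<forall>W\<in>node (restr \<eta>' (Suc n)). fst q \<notin> W" for \<eta> \<eta>' n q
    proof -
      have qE: "q \<in> ES" unfolding ES_def using q(1) restr[OF \<eta>(1), of n] by (intro UN_I[of "restr \<eta> n"]) simp_all
      have "fst q \<in> U \<eta>" unfolding U_def B0_def using qE q(2,3) by blast
      moreover have "fst q \<in> Z'" unfolding Z'_def using qE by blast
      moreover have "fst q \<notin> U \<eta>'"
      proof
        assume "fst q \<in> U \<eta>'"
        then obtain V k where V: "fst q \<in> V" "\<forall>W\<in>node (restr \<eta>' k). V \<subseteq> W" unfolding U_def by blast
        \<comment> \<open>A common member of the two stages would contain \<open>fst q\<close>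
          through \<open>V\<close> and also omit it.\<close>
        have "\<not> node (restr \<eta>' (max k (Suc n))) \<lesssim> M" using node[OF restr[OF \<eta>(2)]] by blast
        then have "node (restr \<eta>' (max k (Suc n))) \<noteq> {}" using finite_lepoll[OF Minf, of "{}"] by auto
        then obtain W where "W \<in> node (restr \<eta>' (max k (Suc n)))" by blast
        then have "W \<in> node (restr \<eta>' k)" "W \<in> node (restr \<eta>' (Suc n))"
          using dec[OF \<eta>(2), of k "max k (Suc n)"] dec[OF \<eta>(2), of "Suc n" "max k (Suc n)"] by auto
        then show False using V q(4) by blast
      qed
      ultimately show ?thesis by blast
    qed
    have "inj_on (\<lambda>\<eta>. U \<eta> \<inter> Z') {\<eta>. \<forall>l. \<eta> l \<in> \<Lambda> l}"
    proof (rule inj_onI, rule ccontr)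
      fix \<eta> \<eta>' assume a: "\<eta> \<in> {\<eta>. \<forall>l. \<eta> l \<in> \<Lambda> l}" "\<eta>' \<in> {\<eta>. \<forall>l. \<eta> l \<in> \<Lambda> l}" "U \<eta> \<inter> Z' = U \<eta>' \<inter> Z'" "\<eta> \<noteq> \<eta>'"
      define n where "n = (LEAST n. \<eta> n \<noteq> \<eta>' n)"
      have n: "\<eta> n \<noteq> \<eta>' n" unfolding n_def by (rule LeastI_ex) (use a(4) in \<open>auto simp: fun_eq_iff\<close>)
      have "\<eta> k = \<eta>' k" if "k < n" for k using not_less_Least[of k "\<lambda>n. \<eta> n \<noteq> \<eta>' n"] that unfolding n_def by simp
      then have r: "restr \<eta> n = restr \<eta>' n" unfolding restr_def by simp
      have \<eta>: "\<forall>l. \<eta> l \<in> \<Lambda> l" "\<forall>l. \<eta>' l \<in> \<Lambda> l" using a by auto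
      have "separates (fst (X n (node (restr \<eta> n)))) (node (restr \<eta> n @ [\<eta> n])) (node (restr \<eta> n @ [\<eta>' n]))"
        using sp[OF restr[OF \<eta>(1), of n]] n \<eta> unfolding splits_def length_restr by blast
      then have "separates (fst (X n (node (restr \<eta> n)))) (node (restr \<eta> (Suc n))) (node (restr \<eta>' (Suc n)))"
        unfolding restr_Suc r .
      then obtain q where q: "q \<in> fst (X n (node (restr \<eta> n)))" "fst q \<in> snd q"
        "(\<forall>W\<in>node (restr \<eta> (Suc n)). snd q \<subseteq> W) \<and> (\<forall>W\<in>node (restr \<eta>' (Suc n)). fst q \<notin> W) \<or>
         (\<forall>W\<in>node (restr \<eta>' (Suc n)). snd q \<subseteq> W) \<and> (\<forall>W\<in>node (restr \<eta> (Suc n)). fst q \<notin> W)"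
        unfolding separates_def by (rule bexE) (erule conjE, rule that)
      from q(3) show False
      proof (elim disjE conjE)
        assume "\<forall>W\<in>node (restr \<eta> (Suc n)). snd q \<subseteq> W" "\<forall>W\<in>node (restr \<eta>' (Suc n)). fst q \<notin> W"
        from dist[OF \<eta> r q(1,2) this] show False using a(3) by simp
      next
        assume "\<forall>W\<in>node (restr \<eta>' (Suc n)). snd q \<subseteq> W" "\<forall>W\<in>node (restr \<eta> (Suc n)). fst q \<notin> W"
        from dist[OF \<eta>(2,1) r[symmetric] q(1)[unfolded r] q(2) this] show False using a(3) by simp
      qed
    qed
    moreover have "(\<lambda>\<eta>. U \<eta> \<inter> Z') ` {\<eta>. \<forall>l. \<eta> l \<in> \<Lambda> l} \<subseteq> traces (gen B') Z'"
      using Ugen unfolding traces_def by blast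
    ultimately have "{\<eta>. \<forall>l. \<eta> l \<in> \<Lambda> l} \<lesssim> traces (gen B') Z'" unfolding lepoll_def by blast
    then show False using small konig lepoll_trans by blast
  qed
  ultimately show ?thesis by (intro exI[of _ Z'] exI[of _ B'] conjI ballI)
qed

theorem uncountable_case:
  fixes mu :: "nat \<Rightarrow> 'c rel"
  assumes big: "\<not> gen B \<lesssim> M" and mu: "\<And>n. Well_order (mu n)" "\<And>n. \<exists>m. Field (mu n) \<prec> \<Lambda> m"
  shows "configuration mu B Z"
proof (cases "nbhds ` Z \<lesssim> M")
  case True
  from small_subspace[OF True big] obtain Z' B' where r: "Z' \<subseteq> Z" "B' \<subseteq> B" "\<forall>U\<in>B'. \<forall>V\<in>B'. U \<inter> V \<in> B'"
    "B' \<lesssim> Lset" "\<not> traces (gen B') Z' \<lesssim> Lset" by (elim exE conjE)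
  interpret R: lam_base \<Lambda> B' Z' by unfold_locales (use r in auto)
  have "configuration mu B' Z'"
    using R.strong_limit_case[where mu = mu, OF r(5) mu] prodcfg_configuration[where mu = mu, OF _ mu] tree_config_configuration by blast
  then show ?thesis by (rule configuration_mono[OF _ gen_mono[OF r(2)] r(1)])
next
  case False
  then show ?thesis
    using many_points[where mu = mu, OF False _ mu] prodcfg_configuration[where mu = mu, OF _ mu] tree_config_configuration by blast
qed

end

section \<open>The countable case\<close>

text \<open>Monotone subsequence argument: either every late member of a sequence has a larger one
  after it, or there are infinitely many members above all their successors.\<close>

lemma infinite_chain_has:
  fixes I :: "'a set set set"
  assumes inf: "infinite I" and IB: "\<And>F. F \<in> I \<Longrightarrow> F \<subseteq> B" and chain: "\<And>F F'. F \<in> I \<Longrightarrow> F' \<in> I \<Longrightarrow> F \<subseteq> F' \<or> F' \<subseteq> F"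
  shows "has_chain natLeq True B I \<or> has_chain natLeq False B I"
proof -
  obtain f :: "nat \<Rightarrow> 'a set set" where f: "inj f" "range f \<subseteq> I" using infinite_countable_subset[OF inf] by blast
  have U: "underS natLeq j = {..<j}" for j by (auto simp: underS_def natLeq_def)
  have fI: "f n \<in> I" for n using f(2) by blast
  have cmp: "f n \<subset> f m \<or> f m \<subset> f n" if "n \<noteq> m" for n m
    using chain[OF fI[of n] fI[of m]] f(1) that unfolding inj_def by blast
  have step: "(\<exists>g. strict_mono g \<and> (\<forall>n. f (g n) \<subset> f (g (Suc n)))) \<or> (\<exists>g. strict_mono g \<and> (\<forall>n. f (g (Suc n)) \<subset> f (g n)))"
  proof (cases "\<exists>N. \<forall>n\<ge>N. \<exists>m>n. f n \<subset> f m")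
    case True
    then obtain N where "\<forall>n\<ge>N. \<exists>m>n. f n \<subset> f m" by blast
    then have "\<exists>g. \<forall>n. N \<le> g n \<and> (g n < g (Suc n) \<and> f (g n) \<subset> f (g (Suc n)))"
      by (intro dependent_nat_choice) (auto, meson less_imp_le order_trans)
    then show ?thesis by (meson strict_mono_Suc_iff)
  next
    case False
    then have *: "\<exists>n\<ge>N. \<forall>m>n. f m \<subset> f n" for N using cmp by (metis less_irrefl)
    have "\<exists>g. \<forall>n. (\<forall>m>g n. f m \<subset> f (g n)) \<and> g n < g (Suc n)"
    proof (rule dependent_nat_choice)
      show "\<exists>x. \<forall>m>x. f m \<subset> f x" using * by blast
      show "\<exists>y. (\<forall>m>y. f m \<subset> f y) \<and> x < y" for x using *[of "Suc x"] by (auto simp: Suc_le_eq)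
    qed
    then show ?thesis by (meson strict_mono_Suc_iff)
  qed
  then show ?thesis
  proof (elim disjE exE conjE)
    fix g assume g: "\<forall>n. f (g n) \<subset> f (g (Suc n))"
    have mono: "f (g n) \<subseteq> f (g m)" if "n \<le> m" for n m
      by (rule lift_Suc_mono_le[of "\<lambda>n. f (g n)", OF _ that]) (use g in blast)
    from g have "\<forall>n. \<exists>v. v \<in> f (g (Suc n)) \<and> v \<notin> f (g n)" by blast
    then obtain v where v: "\<And>n. v n \<in> f (g (Suc n)) \<and> v n \<notin> f (g n)" by metis
    have "v i \<in> f (g j) \<longleftrightarrow> i < j" for i j
    proof
      show "i < j" if "v i \<in> f (g j)" using v[of i] mono[of j i] that by (meson not_le subsetD)
      show "v i \<in> f (g j)" if "i < j" using v[of i] mono[of "Suc i" j] that by auto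
    qed
    moreover have "v i \<in> B" for i using v[of i] IB[OF fI, of "g (Suc i)"] by blast
    ultimately have "has_chain natLeq True B I" unfolding has_chain_def U using fI
      by (intro exI[of _ v] exI[of _ "\<lambda>n. f (g n)"]) auto
    then show ?thesis ..
  next
    fix g assume g: "\<forall>n. f (g (Suc n)) \<subset> f (g n)"
    have mono: "f (g m) \<subseteq> f (g n)" if "n \<le> m" for n m
      by (rule lift_Suc_antimono_le[of "\<lambda>n. f (g n)", OF _ that]) (use g in blast)
    from g have "\<forall>n. \<exists>v. v \<in> f (g n) \<and> v \<notin> f (g (Suc n))" by blast
    then obtain v where v: "\<And>n. v n \<in> f (g n) \<and> v n \<notin> f (g (Suc n))" by metis
    \<comment> \<open>The witness \<open>v i\<close> is lost right after stage \<open>i\<close>;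
      pairing it with stage \<open>Suc j\<close> makes the comparison strict.\<close>
    have "v i \<in> f (g (Suc j)) \<longleftrightarrow> j < i" for i j
    proof
      show "j < i" if "v i \<in> f (g (Suc j))" using v[of i] mono[of "Suc i" "Suc j"] that by (metis not_le subsetD Suc_le_mono)
      show "v i \<in> f (g (Suc j))" if "j < i" using v[of i] mono[of "Suc j" i] that by auto
    qed
    moreover have "v i \<in> B" for i using v[of i] IB[OF fI, of "g i"] by blast
    ultimately have "has_chain natLeq False B I" unfolding has_chain_def U using fI
      by (intro exI[of _ v] exI[of _ "\<lambda>n. f (g (Suc n))"]) auto
    then show ?thesis ..
  qed
qed

section \<open>A copy of the rationals in a large chain of filters\<close>

definition real_chain :: "'a set set \<Rightarrow> 'a set \<Rightarrow> bool" where
  "real_chain B Z \<longleftrightarrow> (\<exists>y :: rat \<Rightarrow> 'a. inj y \<and> range y \<subseteq> Z \<and>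
     (\<forall>r :: real. \<exists>U\<in>gen B. \<forall>q. y q \<in> U \<longleftrightarrow> of_rat q < r))"

text \<open>An open interval of the chain, possibly unbounded. Finite sets of end points let the
  recursion over the rationals treat all earlier values alike.\<close>

definition gap :: "'a set set \<Rightarrow> 'a set set \<Rightarrow> 'a set set \<Rightarrow> 'a set set" where
  "gap K L U = {E\<in>K. (\<forall>l\<in>L. l \<subset> E) \<and> (\<forall>u\<in>U. E \<subset> u)}"

lemma chain_max:
  assumes "finite S" "S \<noteq> {}" "\<And>x y. x \<in> S \<Longrightarrow> y \<in> S \<Longrightarrow> x \<subseteq> y \<or> y \<subseteq> x"
  shows "\<exists>m\<in>S. \<forall>s\<in>S. s \<subseteq> (m :: 'a set)"
  using assms
proof (induction S rule: finite_ne_induct)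
  case (insert x S)
  then obtain m where m: "m \<in> S" "\<forall>s\<in>S. s \<subseteq> m" by auto
  have "x \<subseteq> m \<or> m \<subseteq> x" using insert.prems m(1) by simp
  then show ?case
  proof
    assume "x \<subseteq> m"
    then show ?thesis using m by (intro bexI[of _ m]) auto
  next
    assume "m \<subseteq> x"
    then have "\<forall>s\<in>insert x S. s \<subseteq> x" using m(2) by auto
    then show ?thesis by blast
  qed
qed simp

lemma chain_min:
  assumes "finite S" "S \<noteq> {}" "\<And>x y. x \<in> S \<Longrightarrow> y \<in> S \<Longrightarrow> x \<subseteq> y \<or> y \<subseteq> x"
  shows "\<exists>m\<in>S. \<forall>s\<in>S. (m :: 'a set) \<subseteq> s"
  using assms
proof (induction S rule: finite_ne_induct)
  case (insert x S)
  then obtain m where m: "m \<in> S" "\<forall>s\<in>S. m \<subseteq> s" by auto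
  have "x \<subseteq> m \<or> m \<subseteq> x" using insert.prems m(1) by simp
  then show ?case
  proof
    assume "x \<subseteq> m"
    then have "\<forall>s\<in>insert x S. x \<subseteq> s" using m(2) by auto
    then show ?thesis by blast
  next
    assume "m \<subseteq> x"
    then show ?thesis using m by (intro bexI[of _ m]) auto
  qed
qed simp

locale big_chain =
  fixes B :: "'v set" and M :: "'m set" and K :: "'v set set"
  assumes M: "infinite M" and BM: "B \<lesssim> M" and KB: "\<And>F. F \<in> K \<Longrightarrow> F \<subseteq> B"
    and chain: "\<And>F F'. F \<in> K \<Longrightarrow> F' \<in> K \<Longrightarrow> F \<subseteq> F' \<or> F' \<subseteq> F" and big: "\<not> K \<lesssim> M"
begin

text \<open>In a chain only the largest member of \<open>L\<close> and the smallest member of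
  \<open>U\<close> matter.\<close>

lemma gap_reduce:
  assumes LU: "finite L" "finite U" "L \<subseteq> K" "U \<subseteq> K"
    and e: "\<And>l. l \<in> L \<Longrightarrow> \<not> gap K {l} {} \<lesssim> M" "\<And>u. u \<in> U \<Longrightarrow> \<not> gap K {} {u} \<lesssim> M"
      "\<And>l u. l \<in> L \<Longrightarrow> u \<in> U \<Longrightarrow> \<not> gap K {l} {u} \<lesssim> M"
  shows "\<not> gap K L U \<lesssim> M"
proof -
  have 1: "\<exists>L'. (L' = {} \<and> L = {} \<or> (\<exists>l\<in>L. L' = {l})) \<and> (\<forall>E. (\<forall>l\<in>L. l \<subset> E) \<longleftrightarrow> (\<forall>l\<in>L'. l \<subset> E))"
  (is "\<exists>L'. ?P L'") proof (cases "L = {}")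
    case False
    have "x \<subseteq> y \<or> y \<subseteq> x" if "x \<in> L" "y \<in> L" for x y using chain LU(3) that by blast
    then have "\<exists>m\<in>L. \<forall>s\<in>L. s \<subseteq> m" by (rule chain_max[OF LU(1) False])
    then obtain m where m: "m \<in> L" "\<forall>s\<in>L. s \<subseteq> m" by (elim bexE)
    then have "(\<forall>l\<in>L. l \<subset> E) \<longleftrightarrow> m \<subset> E" for E using subset_psubset_trans by meson
    then show ?thesis using m(1) by (intro exI[of _ "{m}"] conjI disjI2 bexI[of _ m] allI) simp_all
  qed auto
  have 2: "\<exists>U'. (U' = {} \<and> U = {} \<or> (\<exists>u\<in>U. U' = {u})) \<and> (\<forall>E. (\<forall>u\<in>U. E \<subset> u) \<longleftrightarrow> (\<forall>u\<in>U'. E \<subset> u))"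
  (is "\<exists>U'. ?Q U'") proof (cases "U = {}")
    case False
    have "x \<subseteq> y \<or> y \<subseteq> x" if "x \<in> U" "y \<in> U" for x y using chain LU(4) that by blast
    then have "\<exists>m\<in>U. \<forall>s\<in>U. m \<subseteq> s" by (rule chain_min[OF LU(2) False])
    then obtain m where m: "m \<in> U" "\<forall>s\<in>U. m \<subseteq> s" by (elim bexE)
    then have "(\<forall>u\<in>U. E \<subset> u) \<longleftrightarrow> E \<subset> m" for E using psubset_subset_trans by meson
    then show ?thesis using m(1) by (intro exI[of _ "{m}"] conjI disjI2 bexI[of _ m] allI) simp_all
  qed auto
  from 1 obtain L' where "?P L'" ..
  then have L': "L' = {} \<or> (\<exists>l\<in>L. L' = {l})" "\<And>E. (\<forall>l\<in>L. l \<subset> E) \<longleftrightarrow> (\<forall>l\<in>L'. l \<subset> E)" by auto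
  from 2 obtain U' where "?Q U'" ..
  then have U': "U' = {} \<or> (\<exists>u\<in>U. U' = {u})" "\<And>E. (\<forall>u\<in>U. E \<subset> u) \<longleftrightarrow> (\<forall>u\<in>U'. E \<subset> u)" by auto
  have eq: "gap K L U = gap K L' U'" unfolding gap_def L'(2) U'(2) ..
  have "gap K {} {} = K" unfolding gap_def by simp
  then show ?thesis unfolding eq using L'(1) U'(1) e big by auto
qed

text \<open>Otherwise, each \<open>V \<in> B\<close> decides all but few members of \<open>I\<close> in the same way.\<close>

lemma splitting:
  assumes "I \<subseteq> K" "\<not> I \<lesssim> M"
  shows "\<exists>V\<in>B. \<not> {E\<in>I. V \<in> E} \<lesssim> M \<and> \<not> {E\<in>I. V \<notin> E} \<lesssim> M"
proof (rule ccontr)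
  assume c: "\<not> ?thesis"
  define F where "F = {V\<in>B. \<not> {E\<in>I. V \<in> E} \<lesssim> M}"
  have "I \<subseteq> insert F (\<Union>V\<in>B. if V \<in> F then {E\<in>I. V \<notin> E} else {E\<in>I. V \<in> E})"
  proof
    fix E assume E: "E \<in> I"
    show "E \<in> insert F (\<Union>V\<in>B. if V \<in> F then {E\<in>I. V \<notin> E} else {E\<in>I. V \<in> E})"
    proof (cases "E = F")
      case False
      then obtain V where "(V \<in> E) \<noteq> (V \<in> F)" by blast
      moreover have "V \<in> B" using calculation E assms(1) KB unfolding F_def by blast
      ultimately show ?thesis using E by (intro insertI2 UN_I[of V]) auto
    qed simp
  qed
  moreover have "(\<Union>V\<in>B. if V \<in> F then {E\<in>I. V \<notin> E} else {E\<in>I. V \<in> E}) \<lesssim> M"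
    using c unfolding F_def by (intro UN_lepoll[OF M BM]) auto
  then have "insert F (\<Union>V\<in>B. if V \<in> F then {E\<in>I. V \<notin> E} else {E\<in>I. V \<in> E}) \<lesssim> M"
    using Un_lepoll[OF M finite_lepoll[OF M, of "{F}"]] by simp
  ultimately show False using assms(2) by (meson lepoll_trans subset_imp_lepoll)
qed

text \<open>Three applications of \<open>splitting\<close> cut the interval into four large
  quarters. \<open>E1\<close> and \<open>E0\<close> are taken from the two middle ones, and the
  outer quarters remain below \<open>E1\<close> and above \<open>E0\<close>.\<close>

lemma gap_split:
  assumes "\<not> gap K L U \<lesssim> M"
  shows "\<exists>E1\<in>gap K L U. \<exists>E0\<in>gap K L U. E1 \<subset> E0 \<and> \<not> gap K L {E1} \<lesssim> M \<and> \<not> gap K {E0} U \<lesssim> M"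
proof -
  have gK: "gap K L U \<subseteq> K" unfolding gap_def by blast
  from splitting[OF gK assms] obtain V where V: "\<not> {E\<in>gap K L U. V \<in> E} \<lesssim> M" "\<not> {E\<in>gap K L U. V \<notin> E} \<lesssim> M" by blast
  have sub: "{E\<in>gap K L U. R E} \<subseteq> K" for R using gK by blast
  from splitting[OF sub V(1)] obtain V1 where V1: "\<not> {E\<in>{E\<in>gap K L U. V \<in> E}. V1 \<in> E} \<lesssim> M"
    "\<not> {E\<in>{E\<in>gap K L U. V \<in> E}. V1 \<notin> E} \<lesssim> M" by blast
  from splitting[OF sub V(2)] obtain V0 where V0: "\<not> {E\<in>{E\<in>gap K L U. V \<notin> E}. V0 \<in> E} \<lesssim> M"
    "\<not> {E\<in>{E\<in>gap K L U. V \<notin> E}. V0 \<notin> E} \<lesssim> M" by blast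
  have ne: "S \<noteq> {}" if "\<not> S \<lesssim> M" for S :: "'v set set" using that finite_lepoll[OF M, of "{}"] by auto
  obtain E0 where E0: "E0 \<in> gap K L U" "V \<in> E0" "V1 \<notin> E0" using ne[OF V1(2)] by blast
  obtain E1 where E1: "E1 \<in> gap K L U" "V \<notin> E1" "V0 \<in> E1" using ne[OF V0(1)] by blast
  have cmp: "E \<subset> F" if "E \<in> K" "F \<in> K" "v \<in> F" "v \<notin> E" for E F v using chain[OF that(1,2)] that(3,4) by blast
  have "{E\<in>{E\<in>gap K L U. V \<in> E}. V1 \<in> E} \<subseteq> gap K {E0} U"
  proof
    fix E assume E: "E \<in> {E\<in>{E\<in>gap K L U. V \<in> E}. V1 \<in> E}"
    then have "E0 \<subset> E" using cmp[of E0 E V1] E0 gK by blast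
    then show "E \<in> gap K {E0} U" using E unfolding gap_def by simp
  qed
  moreover have "{E\<in>{E\<in>gap K L U. V \<notin> E}. V0 \<notin> E} \<subseteq> gap K L {E1}"
  proof
    fix E assume E: "E \<in> {E\<in>{E\<in>gap K L U. V \<notin> E}. V0 \<notin> E}"
    then have "E \<subset> E1" using cmp[of E E1 V0] E1 gK by blast
    then show "E \<in> gap K L {E1}" using E unfolding gap_def by simp
  qed
  moreover have "E1 \<subset> E0" using cmp[of E1 E0 V] E0 E1 gK by blast
  ultimately show ?thesis using E0(1) E1(1) V1(1) V0(2) by (meson lepoll_trans subset_imp_lepoll)
qed

definition valid :: "'v set \<times> 'v set \<Rightarrow> bool" where
  "valid e \<longleftrightarrow> fst e \<in> K \<and> snd e \<in> K \<and> snd e \<subset> fst e \<and> \<not> gap K {} {snd e} \<lesssim> M \<and> \<not> gap K {fst e} {} \<lesssim> M"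

text \<open>The order is reversed: \<open>e\<close> lies below \<open>d\<close> in the chain, with
  room between them. Larger rationals get smaller filters, so that the open sets obtained are cuts
  from below.\<close>

definition prec :: "'v set \<times> 'v set \<Rightarrow> 'v set \<times> 'v set \<Rightarrow> bool" where
  "prec d e \<longleftrightarrow> \<not> gap K {fst e} {snd d} \<lesssim> M"

lemma gap_mono: "\<not> gap K L U \<lesssim> M \<Longrightarrow> L' \<subseteq> L \<Longrightarrow> U' \<subseteq> U \<Longrightarrow> \<not> gap K L' U' \<lesssim> M"
  unfolding gap_def by (erule contrapos_nn, erule lepoll_trans[OF subset_imp_lepoll, rotated]) blast

lemma extend:
  assumes A: "finite A" "\<And>a. a \<in> A \<Longrightarrow> valid a" and C: "finite C" "\<And>c. c \<in> C \<Longrightarrow> valid c"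
    and AC: "\<And>a c. a \<in> A \<Longrightarrow> c \<in> C \<Longrightarrow> prec a c"
  shows "\<exists>e. valid e \<and> (\<forall>a\<in>A. prec a e) \<and> (\<forall>c\<in>C. prec e c)"
proof -
  have "\<not> gap K (fst ` C) (snd ` A) \<lesssim> M"
    by (rule gap_reduce) (use A C AC in \<open>auto simp: valid_def prec_def\<close>)
  from gap_split[OF this] obtain E1 E0 where E: "E1 \<in> gap K (fst ` C) (snd ` A)" "E0 \<in> gap K (fst ` C) (snd ` A)" "E1 \<subset> E0"
    "\<not> gap K (fst ` C) {E1} \<lesssim> M" "\<not> gap K {E0} (snd ` A) \<lesssim> M" by (elim bexE conjE)
  have "valid (E0, E1)" unfolding valid_def using E gap_mono[OF E(4), of "{}" "{E1}"] gap_mono[OF E(5), of "{E0}" "{}"]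
    by (auto simp: gap_def)
  moreover have "prec a (E0, E1)" if "a \<in> A" for a unfolding prec_def using gap_mono[OF E(5)] that by simp
  moreover have "prec (E0, E1) c" if "c \<in> C" for c unfolding prec_def using gap_mono[OF E(4)] that by simp
  ultimately show ?thesis by blast
qed

text \<open>Cantor's embedding argument by recursion along the enumeration \<open>to_nat\<close>:
  only finitely many values precede each step, and \<open>extend\<close> inserts the next
  one.\<close>

lemma rat_chain:
  "\<exists>f :: rat \<Rightarrow> 'v set \<times> 'v set. (\<forall>q. valid (f q)) \<and> (\<forall>p q. p < q \<longrightarrow> prec (f p) (f q))"
proof -
  define R where "R = inv_image less_than (to_nat :: rat \<Rightarrow> nat)"
  define P where "P f q e \<longleftrightarrow> valid e \<and> (\<forall>p. (p, q) \<in> R \<longrightarrow> (p < q \<longrightarrow> prec (f p) e) \<and> (q < p \<longrightarrow> prec e (f p)))"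
    for f :: "rat \<Rightarrow> 'v set \<times> 'v set" and q e
  have "\<exists>f. \<forall>q. P f q (f q)"
  proof (rule dependent_wf_choice)
    show "wf R" unfolding R_def by simp
    show "P f q r = P g q r" if "\<And>z. (z, q) \<in> R \<Longrightarrow> f z = g z" for f g q r unfolding P_def using that by auto
    fix q :: rat and f assume IH: "\<And>p. (p, q) \<in> R \<Longrightarrow> P f p (f p)"
    have fin: "finite {p. (p, q) \<in> R}"
    proof (rule finite_imageD)
      show "finite (to_nat ` {p. (p, q) \<in> R})" by (rule finite_subset[of _ "{..<to_nat q}"]) (auto simp: R_def)
      show "inj_on to_nat {p. (p, q) \<in> R}" by (rule inj_on_subset[OF inj_to_nat]) simp
    qed
    have "\<exists>e. valid e \<and> (\<forall>a\<in>f ` {p. (p, q) \<in> R \<and> p < q}. prec a e) \<and> (\<forall>c\<in>f ` {p. (p, q) \<in> R \<and> q < p}. prec e c)"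
    proof (rule extend)
      show "finite (f ` {p. (p, q) \<in> R \<and> p < q})" "finite (f ` {p. (p, q) \<in> R \<and> q < p})"
        using fin by (auto intro: finite_subset[OF _ fin])
      show "valid a" if "a \<in> f ` {p. (p, q) \<in> R \<and> p < q}" for a using IH that unfolding P_def by blast
      show "valid a" if "a \<in> f ` {p. (p, q) \<in> R \<and> q < p}" for a using IH that unfolding P_def by blast
      fix a c assume "a \<in> f ` {p. (p, q) \<in> R \<and> p < q}" "c \<in> f ` {p. (p, q) \<in> R \<and> q < p}"
      then obtain p s where p: "(p, q) \<in> R" "p < q" "a = f p" and s: "(s, q) \<in> R" "q < s" "c = f s" by blast
      have "p < s" using p(2) s(2) by simp
      then have "to_nat p \<noteq> to_nat s" by simp
      then consider "(p, s) \<in> R" | "(s, p) \<in> R" unfolding R_def by force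
      then show "prec a c" using IH[OF p(1)] IH[OF s(1)] \<open>p < s\<close> p(3) s(3) unfolding P_def by cases auto
    qed
    then obtain e where "valid e" "\<forall>a\<in>f ` {p. (p, q) \<in> R \<and> p < q}. prec a e" "\<forall>c\<in>f ` {p. (p, q) \<in> R \<and> q < p}. prec e c"
      by blast
    then show "\<exists>e. P f q e" unfolding P_def by (intro exI[of _ e]) auto
  qed
  then obtain f where f: "\<And>q. P f q (f q)" by blast
  have "prec (f p) (f q)" if "p < q" for p q
  proof -
    have "to_nat p \<noteq> to_nat q" using that by simp
    then consider "(p, q) \<in> R" | "(q, p) \<in> R" unfolding R_def by force
    then show ?thesis using f[of p] f[of q] that unfolding P_def by cases auto
  qed
  then show ?thesis using f unfolding P_def by blast
qed

end

text \<open>The basic set \<open>v q\<close> tells the two ends of the pair of \<open>q\<close>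
  apart. The point \<open>x q\<close> lies in it and avoids all basic sets outside the upper end, in
  particular \<open>v p\<close> for \<open>p < q\<close>, whose pair lies higher. So the union of
  \<open>v p\<close> over \<open>p < r\<close> realises the cut at \<open>r\<close>.\<close>

lemma big_chain_real_chain:
  assumes "big_chain B M K"
    and P: "\<And>F G. F \<in> K \<Longrightarrow> finite G \<Longrightarrow> G \<subseteq> F \<Longrightarrow> \<exists>x\<in>Z. x \<in> \<Inter>G \<and> (\<forall>V\<in>B - F. x \<notin> V)"
  shows "real_chain B Z"
proof -
  interpret big_chain B M K by fact
  obtain f :: "rat \<Rightarrow> _" where f: "\<And>q. valid (f q)" "\<And>p q. p < q \<Longrightarrow> prec (f p) (f q)" using rat_chain by blast
  have "\<forall>q. \<exists>v. v \<in> fst (f q) \<and> v \<notin> snd (f q)" using f(1) unfolding valid_def by blast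
  then obtain v where v: "\<And>q. v q \<in> fst (f q) \<and> v q \<notin> snd (f q)" by metis
  have FK: "fst (f q) \<in> K" for q using f(1) unfolding valid_def by blast
  have vB: "v q \<in> B" for q using v KB[OF FK] by blast
  have "\<exists>x\<in>Z. x \<in> \<Inter>{v q} \<and> (\<forall>V\<in>B - fst (f q). x \<notin> V)" for q
    by (rule P[OF FK]) (use v in auto)
  then obtain x where x: "\<And>q. x q \<in> Z \<and> x q \<in> v q \<and> (\<forall>V\<in>B - fst (f q). x q \<notin> V)" by auto metis
  have out: "x q \<notin> v p" if "p < q" for p q
  proof -
    have "gap K {fst (f q)} {snd (f p)} \<noteq> {}"
      using f(2)[OF that] finite_lepoll[OF M, of "{}"] unfolding prec_def by auto
    then have "fst (f q) \<subseteq> snd (f p)" unfolding gap_def by auto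
    then show ?thesis using v[of p] x[of q] vB[of p] by blast
  qed
  have "inj x"
  proof (rule injI, rule ccontr)
    fix p q assume "x p = x q" "p \<noteq> q"
    then show False using out[of p q] out[of q p] x[of p] x[of q] by (cases "p < q") auto
  qed
  moreover have "\<exists>U\<in>gen B. \<forall>q. x q \<in> U \<longleftrightarrow> of_rat q < r" for r :: real
  proof (intro bexI allI)
    fix q
    show "x q \<in> (\<Union>p\<in>{p. of_rat p < r}. v p) \<longleftrightarrow> of_rat q < r"
    proof
      assume "x q \<in> (\<Union>p\<in>{p. of_rat p < r}. v p)"
      then obtain p where p: "of_rat p < r" "x q \<in> v p" by blast
      then have "q \<le> p" using out[of p q] by (meson not_le)
      then have "(of_rat q :: real) \<le> of_rat p" by (simp add: of_rat_less_eq)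
      then show "of_rat q < r" using p(1) by simp
    qed (use x in blast)
  qed (rule gen_UN, rule gen_base[OF vB])
  ultimately show ?thesis unfolding real_chain_def using x by (intro exI[of _ x]) auto
qed

text \<open>The chosen points form a discrete subspace: \<open>V n\<close> shuts out the later
  points, and each \<open>U m\<close> with \<open>m < n\<close> shuts out \<open>x m\<close>. All
  subsets are then relatively open, so any countable pattern is realised.\<close>

lemma (in base_space) discrete_case:
  fixes mu :: "nat \<Rightarrow> 'k rel"
  assumes A: "A 0 \<subseteq> Z" and s: "\<And>n::nat. U n \<in> gen B \<and> V n \<in> gen B \<and> A (Suc n) = A n \<inter> U n - V n \<and> A n \<inter> V n - U n \<noteq> {}"
    and mu: "countable (fin_seqs mu)"
  shows "configuration mu B Z \<and> real_chain B Z"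
proof -
  from s have "\<forall>n. \<exists>x. x \<in> A n \<inter> V n - U n" by blast
  then obtain x where x: "\<And>n. x n \<in> A n \<inter> V n - U n" by metis
  have "A (Suc n) \<subseteq> A n" for n using s[of n] by blast
  then have mono: "n \<le> m \<Longrightarrow> A m \<subseteq> A n" for n m by (rule lift_Suc_antimono_le)
  have AZ: "A n \<subseteq> Z" for n using mono[of 0 n] A by simp
  have later: "x m \<in> U n \<and> x m \<notin> V n" if "n < m" for n m
  proof -
    have "x m \<in> A (Suc n)" using mono[of "Suc n" m] that x[of m] by auto
    then show ?thesis using s[of n] by blast
  qed
  define N where "N n = \<Inter>(insert (V n) (U ` {..<n}))" for n
  have NB: "N n \<in> gen B" for n unfolding N_def by (rule gen_INT) (use s in auto)
  have xN: "x m \<in> N n \<longleftrightarrow> m = n" for m n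
  proof
    show "m = n" if a: "x m \<in> N n"
    proof (rule ccontr)
      assume "m \<noteq> n"
      then consider "m < n" | "n < m" by linarith
      then show False
      proof cases
        case 1
        then have "x m \<in> U m" using a unfolding N_def by auto
        then show False using x[of m] by blast
      next
        case 2
        then show False using later[OF 2] a unfolding N_def by auto
      qed
    qed
    show "x m \<in> N n" if "m = n" unfolding N_def that using x[of n] later by auto
  qed
  have open_set: "\<exists>W\<in>gen B. \<forall>m. x m \<in> W \<longleftrightarrow> m \<in> S" for S
    by (rule bexI[of _ "\<Union>n\<in>S. N n"]) (use NB xN in \<open>auto intro: gen_UN\<close>)
  have xinj: "x m = x n \<longleftrightarrow> m = n" for m n using xN[of m m] xN[of n m] by auto
  obtain c :: "'k list \<Rightarrow> nat" where c: "inj_on c (fin_seqs mu)" using mu unfolding countable_def by blast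
  have tr: "\<exists>W\<in>gen B. \<forall>\<nu>\<in>fin_seqs mu. x (c \<nu>) \<in> W \<longleftrightarrow> R \<nu>" for R
  proof -
    obtain W where W: "W \<in> gen B" "\<forall>m. x m \<in> W \<longleftrightarrow> m \<in> c ` {\<nu>\<in>fin_seqs mu. R \<nu>}"
      using open_set[of "c ` {\<nu>\<in>fin_seqs mu. R \<nu>}"] by blast
    then show ?thesis using c by (intro bexI[of _ W]) (auto dest: inj_onD)
  qed
  have xZ: "x m \<in> Z" for m using x[of m] AZ[of m] by blast
  have "configuration mu B Z" unfolding configuration_def
    using c xinj xZ by (intro exI[of _ "x \<circ> c"] conjI disjI1 ballI) (auto simp: inj_on_def intro!: tr)
  moreover have "real_chain B Z" unfolding real_chain_def
  proof (intro exI[of _ "\<lambda>q. x (to_nat q)"] conjI allI)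
    show "inj (\<lambda>q::rat. x (to_nat q))" using xinj by (simp add: inj_def)
    show "range (\<lambda>q::rat. x (to_nat q)) \<subseteq> Z" using x AZ by blast
    fix r :: real
    obtain W where W: "W \<in> gen B" "\<forall>m. x m \<in> W \<longleftrightarrow> m \<in> to_nat ` {q::rat. of_rat q < r}"
      using open_set[of "to_nat ` {q::rat. of_rat q < r}"] by blast
    then show "\<exists>U\<in>gen B. \<forall>q::rat. x (to_nat q) \<in> U \<longleftrightarrow> of_rat q < r"
      by (intro bexI[of _ W]) (auto simp: image_iff)
  qed
  ultimately show ?thesis ..
qed

theorem (in base_space) countable_case:
  fixes mu :: "nat \<Rightarrow> 'k rel" and M :: "'m set"
  assumes BZ: "\<And>V. V \<in> B \<Longrightarrow> V \<subseteq> Z" and M: "infinite M" and BM: "B \<lesssim> M" and big: "\<not> gen B \<lesssim> M"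
    and mu: "\<And>n. Well_order (mu n)" "\<And>n. finite (Field (mu n))"
  shows "configuration mu B Z \<and> real_chain B Z"
proof (cases "\<exists>A U V. A 0 \<subseteq> Z \<and> (\<forall>n::nat. U n \<in> gen B \<and> V n \<in> gen B \<and>
      A (Suc n) = A n \<inter> U n - V n \<and> A n \<inter> V n - U n \<noteq> {})")
  case True
  have "fin_seqs mu \<subseteq> lists (\<Union>n. Field (mu n))" unfolding fin_seqs_def by (fastforce simp: in_set_conv_nth)
  moreover have "countable (\<Union>n. Field (mu n))" using mu(2) by (intro countable_UN) (auto intro: countable_finite)
  ultimately have "countable (fin_seqs mu)" by (meson countable_lists countable_subset)
  then show ?thesis using True discrete_case by blast
next
  case False
  interpret ideal_space B Z "\<lambda>X. X = {}"
    by unfold_locales (use False in auto)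
  \<comment> \<open>For the trivial ideal the saturation of \<open>W\<close> lists the basic sets
    included in \<open>W\<close>, and these determine \<open>W\<close>.\<close>
  have inj: "inj_on (\<lambda>W. {V\<in>B. (Z - W) \<inter> V = {}}) (gen B)"
  proof (rule inj_onI)
    fix W W' assume W: "W \<in> gen B" "W' \<in> gen B" and eq: "{V\<in>B. (Z - W) \<inter> V = {}} = {V\<in>B. (Z - W') \<inter> V = {}}"
    have "V \<subseteq> W \<longleftrightarrow> V \<subseteq> W'" if "V \<in> B" for V using eq BZ[OF that] that by blast
    moreover have "W = \<Union>{V\<in>B. V \<subseteq> W}" if "W \<in> gen B" for W using gen_E[OF that] by blast
    ultimately show "W = W'" using W by (metis (mono_tags, lifting) Collect_cong)
  qed
  have many: "\<not> filt ` {X. irr X} \<lesssim> M"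
    by (rule many_filters[OF M]) (use inj big in simp)
  have sub: "filt ` {X. irr X} \<subseteq> Pow B" unfolding filt_def by blast
  have lrg: "\<not> (Z \<inter> \<Inter>G - \<Union>H) = {}"
    if "finite G" "finite H" "G \<subseteq> B" "H \<subseteq> B" "\<not> cyl (filt ` {X. irr X}) G H \<lesssim> M" for G H
  proof -
    have "cyl (filt ` {X. irr X}) G H \<noteq> {}" using that(5) finite_lepoll[OF M, of "{}"] by auto
    then obtain X where "irr X" "G \<subseteq> filt X" "H \<inter> filt X = {}" unfolding cyl_def by blast
    then show ?thesis using irr_not_small[of X G H] that(1,4) by blast
  qed
  have "\<exists>K\<subseteq>filt ` {X. irr X}. K \<noteq> {} \<and> (\<forall>F\<in>K. \<forall>F'\<in>K. F \<subseteq> F' \<or> F' \<subseteq> F) \<and>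
    (\<forall>G H. finite G \<longrightarrow> finite H \<longrightarrow> G \<subseteq> B \<longrightarrow> H \<subseteq> B \<longrightarrow> cyl K G H \<noteq> {} \<longrightarrow> \<not> cyl K G H \<lesssim> M)"
    by (rule filter_chain[OF M BM many sub lrg])
  then obtain K where K: "K \<subseteq> filt ` {X. irr X}" "K \<noteq> {}" "\<forall>F\<in>K. \<forall>F'\<in>K. F \<subseteq> F' \<or> F' \<subseteq> F"
    "\<forall>G H. finite G \<longrightarrow> finite H \<longrightarrow> G \<subseteq> B \<longrightarrow> H \<subseteq> B \<longrightarrow> cyl K G H \<noteq> {} \<longrightarrow> \<not> cyl K G H \<lesssim> M"
    by (elim exE conjE) (rule that)
  have KB: "F \<subseteq> B" if "F \<in> K" for F using that K(1) sub by blast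
  have chain: "F \<subseteq> F' \<or> F' \<subseteq> F" if "F \<in> K" "F' \<in> K" for F F' using K(3) that by blast
  have P: "\<exists>x\<in>Z. x \<in> \<Inter>G \<and> (\<forall>V\<in>B - F. x \<notin> V)" if "F \<in> K" "finite G" "G \<subseteq> F" for F G
  proof -
    from K(1) that(1) obtain X where "irr X" "F = filt X" by blast
    then show ?thesis using irr_point[of X G] that by simp
  qed
  have "tree_config mu B Z" unfolding tree_config_def
  proof (rule chain_tree[where K = K and r = "\<lambda>_. natLeq", OF K(2) KB chain P mu(1)])
    \<comment> \<open>Branching is finite, so sequences of length \<omega> are long enough at every
      level.\<close>
    show "Field (mu n) \<prec> Field natLeq" for n
      using mu(2)[of n] by (simp add: Field_natLeq finite_lesspoll_infinite)
    show "infinite (Field natLeq)" by (simp add: Field_natLeq)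
    show "Card_order natLeq" by (rule natLeq_Card_order)
    show "Field natLeq \<lesssim> Field natLeq" by (rule lepoll_refl)
    fix G H assume GH: "finite G" "finite H" "G \<subseteq> B" "H \<subseteq> B" "cyl K G H \<noteq> {}"
    have "infinite (cyl K G H)" using K(4) GH finite_lepoll[OF M] by blast
    then show "has_chain natLeq True B (cyl K G H) \<or> has_chain natLeq False B (cyl K G H)"
      by (rule infinite_chain_has) (use KB chain in \<open>auto simp: cyl_def\<close>)
  qed
  moreover have "big_chain B M K"
  proof
    have "cyl K {} {} = K" unfolding cyl_def by simp
    then show "\<not> K \<lesssim> M" using K(2,4) by (metis empty_subsetI finite.emptyI)
  qed (use M BM KB chain in auto)
  ultimately show ?thesis using big_chain_real_chain[OF _ P] tree_config_configuration by blast
qed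

section \<open>The theorem\<close>

lemma Card_order_lepoll: assumes "Card_order r" "Card_order s" shows "r \<le>o s \<longleftrightarrow> Field r \<lesssim> Field s"
  unfolding lepoll_iff_ordLeq
  using card_of_Field_ordIso[OF assms(1)] card_of_Field_ordIso[OF assms(2)]
  by (meson ordIso_ordLeq_trans ordIso_symmetric ordLeq_ordIso_trans)

lemma card_of_lepoll: assumes "Card_order r" shows "|A| \<le>o r \<longleftrightarrow> A \<lesssim> Field r"
  using Card_order_lepoll[OF card_of_Card_order assms] unfolding Field_card_of .

lemma Card_order_lesspoll: assumes "Card_order r" "Card_order s" shows "r <o s \<longleftrightarrow> Field r \<prec> Field s"
proof -
  have "r <o s \<longleftrightarrow> \<not> s \<le>o r"
    using assms unfolding card_order_on_def by (simp add: not_ordLeq_iff_ordLess)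
  then show ?thesis using Card_order_lepoll[OF assms(2,1)] not_lepoll_iff by blast
qed

lemma Pow_lepoll_ctwo: assumes "A \<lesssim> Field r" shows "Pow A \<lesssim> Field (ctwo ^c r)"
proof -
  have "Field (ctwo ^c r) = Func (Field r) (UNIV :: bool set)"
    unfolding cexp_def ctwo_def Field_card_of ..
  moreover have "Pow (Field r) \<lesssim> Func (Field r) (UNIV :: bool set)"
    unfolding lepoll_iff_ordLeq using card_of_Pow_Func[of "Field r"] by (simp add: ordIso_iff_ordLeq)
  ultimately show ?thesis using Pow_lepoll_mono[OF assms] lepoll_trans by metis
qed

lemma configuration_theorem:
  assumes cfg: "configuration mu B Z" and sub: "gen B \<subseteq> T"
  shows "\<exists>x. inj_on x (fin_seqs mu) \<and> x ` fin_seqs mu \<subseteq> Z \<and>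
        (let Z = x ` fin_seqs mu in
          (\<exists>U. \<forall>\<eta>\<in>inf_seqs mu. U \<eta> \<in> T \<and>
             U \<eta> \<inter> Z = {x \<nu> | \<nu>. \<nu> \<in> fin_seqs mu \<and>
               (\<exists>n<length \<nu>. take n \<nu> = restr \<eta> n \<and> \<nu> ! n \<in> underS (mu n) (\<eta> n))}) \<or>
          (\<exists>U. \<forall>\<eta>\<in>inf_seqs mu. U \<eta> \<in> T \<and>
             U \<eta> \<inter> Z = {x \<nu> | \<nu>. \<nu> \<in> fin_seqs mu \<and>
               (\<exists>n<length \<nu>. take n \<nu> = restr \<eta> n \<and> \<eta> n \<in> underS (mu n) (\<nu> ! n))}) \<or>
          (\<exists>U. \<forall>\<eta>\<in>inf_seqs mu. U \<eta> \<in> T \<and>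
             U \<eta> \<inter> Z = {x \<nu> | \<nu>. \<nu> \<in> fin_seqs mu \<and> \<not> initial_seg \<nu> \<eta>}))"
proof -
  obtain x where x: "inj_on x (fin_seqs mu)" "x ` fin_seqs mu \<subseteq> Z" and alt:
    "(\<forall>\<eta>\<in>inf_seqs mu. \<exists>U\<in>gen B. \<forall>\<nu>\<in>fin_seqs mu. x \<nu> \<in> U \<longleftrightarrow>
       (\<exists>n<length \<nu>. take n \<nu> = restr \<eta> n \<and> \<nu> ! n \<in> underS (mu n) (\<eta> n))) \<or>
     (\<forall>\<eta>\<in>inf_seqs mu. \<exists>U\<in>gen B. \<forall>\<nu>\<in>fin_seqs mu. x \<nu> \<in> U \<longleftrightarrow>
       (\<exists>n<length \<nu>. take n \<nu> = restr \<eta> n \<and> \<eta> n \<in> underS (mu n) (\<nu> ! n))) \<or>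
     (\<forall>\<eta>\<in>inf_seqs mu. \<exists>U\<in>gen B. \<forall>\<nu>\<in>fin_seqs mu. x \<nu> \<in> U \<longleftrightarrow> \<not> initial_seg \<nu> \<eta>)"
    using cfg unfolding configuration_def by (elim exE conjE) (rule that)
  have ch: "\<exists>U. \<forall>\<eta>\<in>inf_seqs mu. U \<eta> \<in> T \<and> U \<eta> \<inter> x ` fin_seqs mu = {x \<nu> | \<nu>. \<nu> \<in> fin_seqs mu \<and> R \<nu> \<eta>}"
    if "\<forall>\<eta>\<in>inf_seqs mu. \<exists>U\<in>gen B. \<forall>\<nu>\<in>fin_seqs mu. x \<nu> \<in> U \<longleftrightarrow> R \<nu> \<eta>" for R
  proof -
    from bchoice[OF that[unfolded Bex_def]] obtain U where
      U: "\<forall>\<eta>\<in>inf_seqs mu. U \<eta> \<in> gen B \<and> (\<forall>\<nu>\<in>fin_seqs mu. x \<nu> \<in> U \<eta> \<longleftrightarrow> R \<nu> \<eta>)" ..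
    show ?thesis by (rule exI[of _ U]) (use U sub in fast)
  qed
  show ?thesis unfolding Let_def
  proof (intro exI[of _ x] conjI x)
    from alt show "(\<exists>U. \<forall>\<eta>\<in>inf_seqs mu. U \<eta> \<in> T \<and>
             U \<eta> \<inter> x ` fin_seqs mu = {x \<nu> | \<nu>. \<nu> \<in> fin_seqs mu \<and>
               (\<exists>n<length \<nu>. take n \<nu> = restr \<eta> n \<and> \<nu> ! n \<in> underS (mu n) (\<eta> n))}) \<or>
          (\<exists>U. \<forall>\<eta>\<in>inf_seqs mu. U \<eta> \<in> T \<and>
             U \<eta> \<inter> x ` fin_seqs mu = {x \<nu> | \<nu>. \<nu> \<in> fin_seqs mu \<and>
               (\<exists>n<length \<nu>. take n \<nu> = restr \<eta> n \<and> \<eta> n \<in> underS (mu n) (\<nu> ! n))}) \<or>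
          (\<exists>U. \<forall>\<eta>\<in>inf_seqs mu. U \<eta> \<in> T \<and>
             U \<eta> \<inter> x ` fin_seqs mu = {x \<nu> | \<nu>. \<nu> \<in> fin_seqs mu \<and> \<not> initial_seg \<nu> \<eta>})"
      by (elim disjE) (rule disjI1, erule ch, rule disjI2, rule disjI1, erule ch, rule disjI2, rule disjI2, erule ch)
  qed
qed

lemma real_chain_theorem:
  assumes "real_chain B Z" "gen B \<subseteq> T"
  shows "\<exists>y :: rat \<Rightarrow> 'a. inj y \<and> range y \<subseteq> Z \<and> (\<forall>r :: real. \<exists>U. U \<in> T \<and> U \<inter> range y = y ` {q. of_rat q < r})"
proof -
  obtain y :: "rat \<Rightarrow> 'a" where y: "inj y" "range y \<subseteq> Z" "\<forall>r :: real. \<exists>U\<in>gen B. \<forall>q. y q \<in> U \<longleftrightarrow> of_rat q < r"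
    using assms(1) unfolding real_chain_def by (elim exE conjE) (rule that)
  have "\<exists>U. U \<in> T \<and> U \<inter> range y = y ` {q. of_rat q < r}" for r :: real
  proof -
    obtain U where U: "U \<in> gen B" "\<forall>q. y q \<in> U \<longleftrightarrow> of_rat q < r" using y(3) by blast
    show ?thesis by (rule exI[of _ U]) (use U assms(2) in auto)
  qed
  then show ?thesis using y(1,2) by blast
qed

theorem theorem22:
  fixes lam mu :: "nat \<Rightarrow> 'k rel"
    and L M :: "'k rel"
    and X :: "'a topology"
    and B :: "'a set set"
  assumes lam_card: "\<And>n. Card_order (lam n)"
    and lam_reg: "\<And>n. (cinfinite (lam n) \<and> regularCard (lam n)) \<or> BNF_Cardinal_Arithmetic.cfinite (lam n)"
    and lam_exp: "\<And>n. ctwo ^c lam n <o lam (Suc n)"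
    and L_card: "Card_order L"
    and L_sum: "L =o BNF_Cardinal_Arithmetic.Csum natLeq lam"
    and L_inf: "natLeq \<le>o L"
    and mu_card: "\<And>n. Card_order (mu n)"
    and mu_sum: "L =o BNF_Cardinal_Arithmetic.Csum natLeq mu"
    and mu_lam: "\<And>n. lam n \<le>o mu (Suc n)"
    and mu_beth: "\<And>n. beth3 (mu n) <o lam n"
    and M_card: "Card_order M"
    and M_lower: "L \<le>o M"
    and M_upper: "M <o ctwo ^c L"
    and M_cov: "\<And>n. \<exists>c :: 'k set set rel. is_cov M (lam n) (cardSuc (mu n)) c \<and> c \<le>o M"
    and base: "is_base X B"
    and base_card: "|B| \<le>o M"
    and many_open: "ctwo ^c L \<le>o |{U. openin X U}|"
  shows
    "(\<exists>x :: 'k list \<Rightarrow> 'a.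
        inj_on x (fin_seqs mu) \<and> x ` fin_seqs mu \<subseteq> topspace X \<and>
        (let Z = x ` fin_seqs mu in
          (\<exists>U. \<forall>\<eta>\<in>inf_seqs mu. openin X (U \<eta>) \<and>
             U \<eta> \<inter> Z = {x \<nu> | \<nu>. \<nu> \<in> fin_seqs mu \<and>
               (\<exists>n<length \<nu>. take n \<nu> = restr \<eta> n \<and> \<nu> ! n \<in> underS (mu n) (\<eta> n))}) \<or>
          (\<exists>U. \<forall>\<eta>\<in>inf_seqs mu. openin X (U \<eta>) \<and>
             U \<eta> \<inter> Z = {x \<nu> | \<nu>. \<nu> \<in> fin_seqs mu \<and>
               (\<exists>n<length \<nu>. take n \<nu> = restr \<eta> n \<and> \<eta> n \<in> underS (mu n) (\<nu> ! n))}) \<or>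
          (\<exists>U. \<forall>\<eta>\<in>inf_seqs mu. openin X (U \<eta>) \<and>
             U \<eta> \<inter> Z = {x \<nu> | \<nu>. \<nu> \<in> fin_seqs mu \<and> \<not> initial_seg \<nu> \<eta>})))
     \<and>
     (L =o natLeq \<longrightarrow>
       (\<exists>y :: rat \<Rightarrow> 'a.
          inj y \<and> range y \<subseteq> topspace X \<and>
          (\<forall>r :: real. \<exists>U. openin X U \<and> U \<inter> range y = y ` {q. of_rat q < r})))"
proof -
  define Z where "Z = topspace X"
  define l where "l n = Field (lam n)" for n
  have wo_mu: "Well_order (mu n)" for n using mu_card[of n] unfolding card_order_on_def by simp
  have genB: "gen B = {U. openin X U}"
  proof (intro equalityI subsetI)
    fix W assume "W \<in> gen B"
    then obtain C where "C \<subseteq> B" "W = \<Union>C" unfolding gen_def by blast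
    then show "W \<in> {U. openin X U}" using base unfolding is_base_def by auto
  next
    fix W assume "W \<in> {U. openin X U}"
    then show "W \<in> gen B" using base unfolding is_base_def gen_def by blast
  qed
  interpret base_space B Z by unfold_locales (use base in \<open>simp add: is_base_def\<close>)
  have BZ: "V \<subseteq> Z" if "V \<in> B" for V
    using that base unfolding is_base_def Z_def by (simp add: openin_subset)
  have Pl: "Pow (l n) \<lesssim> l (Suc n)" for n
  proof -
    have "Field (ctwo ^c lam n) \<prec> l (Suc n)" using lam_exp[of n] Card_order_lesspoll[OF Card_order_cexp lam_card] unfolding l_def by blast
    then show ?thesis using Pow_lepoll_ctwo[OF lepoll_refl, of "lam n"] unfolding l_def
      by (meson lepoll_trans lesspoll_imp_lepoll)
  qed
  have l_mono: "n \<le> m \<Longrightarrow> l n \<lesssim> l m" for n m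
  proof (induction m)
    case (Suc m)
    have "l m \<lesssim> l (Suc m)" using Pl lepoll_Pow_self lepoll_trans by blast
    then show ?case using Suc by (metis le_Suc_eq lepoll_refl lepoll_trans)
  qed simp
  have mu3: "Pow (Pow (Pow (Field (mu n)))) \<prec> l n" for n
  proof -
    have "Field (beth3 (mu n)) \<prec> l n" using mu_beth[of n] Card_order_lesspoll[OF Card_order_cexp lam_card]
      unfolding l_def beth3_def by blast
    moreover have "Pow (Pow (Pow (Field (mu n)))) \<lesssim> Field (beth3 (mu n))"
      unfolding beth3_def by (intro Pow_lepoll_ctwo lepoll_refl)
    ultimately show ?thesis using lesspoll_trans1 by blast
  qed
  have mu1: "Field (mu n) \<prec> l n" for n
    by (rule lesspoll_trans1[OF lepoll_trans[OF lepoll_Pow_self lepoll_trans[OF lepoll_Pow_self lepoll_Pow_self]] mu3])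
  have lmu: "l n \<lesssim> Field (mu (Suc n))" for n using mu_lam Card_order_lepoll[OF lam_card mu_card] unfolding l_def by blast
  have SL: "(SIGMA n:UNIV. l n) \<lesssim> Field L" "Field L \<lesssim> (SIGMA n:UNIV. l n)"
  proof -
    have "|Field L| =o |SIGMA n:(UNIV::nat set). l n|"
      using ordIso_transitive[OF card_of_Field_ordIso[OF L_card] L_sum] unfolding Csum_def l_def Field_natLeq .
    then show "(SIGMA n:UNIV. l n) \<lesssim> Field L" "Field L \<lesssim> (SIGMA n:UNIV. l n)"
      unfolding lepoll_iff_ordLeq ordIso_iff_ordLeq by auto
  qed
  have LM: "Field L \<lesssim> Field M" using M_lower Card_order_lepoll[OF L_card M_card] by blast
  have "cinfinite M" using cinfinite_mono[OF ordLeq_transitive[OF L_inf M_lower]] natLeq_cinfinite by blast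
  then have Minf: "infinite (Field M)" unfolding cinfinite_def .
  have BM: "B \<lesssim> Field M"
    using base_card card_of_lepoll[OF M_card] by blast
  have big: "\<not> gen B \<lesssim> Field M"
  proof
    assume "gen B \<lesssim> Field M"
    then have "|{U. openin X U}| \<le>o M"
      unfolding genB using card_of_lepoll[OF M_card] by blast
    then have "ctwo ^c L \<le>o M" using many_open ordLeq_transitive by blast
    then show False using M_upper not_ordLess_ordLeq by blast
  qed
  have "configuration mu B Z \<and> (L =o natLeq \<longrightarrow> real_chain B Z)"
  proof (cases "\<exists>n. infinite (l n)")
    \<comment> \<open>All \<open>lam n\<close> finite: the sum \<lambda> is then \<aleph>_0, and the
      countable argument gives both claims.\<close>
    case False
    then have "finite (Field (mu n))" for n
      using lesspoll_imp_lepoll[OF mu1[of n]] unfolding lepoll_def by (auto intro: inj_on_finite)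
    then show ?thesis using countable_case[where mu = mu, OF BZ Minf BM big wo_mu] by blast
  next
    case True
    then obtain n0 where n0: "infinite (l n0)" ..
    \<comment> \<open>Dropping the first \<open>n0\<close> terms makes all of them infinite.\<close>
    define \<Lambda> where "\<Lambda> n = l (n0 + n)" for n
    have inf: "infinite (\<Lambda> n)" for n using n0 l_mono[of n0 "n0 + n"] unfolding \<Lambda>_def
      by (metis infinite_le_lepoll le_add1 lepoll_trans)
    interpret cov_space \<Lambda> B Z "Field M"
    proof
      show "infinite (\<Lambda> n)" for n by (rule inf)
      show "Pow (\<Lambda> n) \<lesssim> \<Lambda> (Suc n)" for n using Pl[of "n0 + n"] unfolding \<Lambda>_def by simp
      show "lam_sets.Lset \<Lambda> \<lesssim> Field M"
      proof -
        interpret lam_sets \<Lambda> by unfold_locales (use inf Pl in \<open>simp_all add: \<Lambda>_def\<close>)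
        have "Lset \<lesssim> (SIGMA n:UNIV. l n)" unfolding Lset_def \<Lambda>_def lepoll_def
          by (intro exI[of _ "\<lambda>(n, x). (n0 + n, x)"]) (auto simp: inj_on_def)
        from lepoll_trans[OF this lepoll_trans[OF SL(1) LM]] show ?thesis .
      qed
      show "B \<lesssim> Field M" by (rule BM)
      show "V \<subseteq> Z" if "V \<in> B" for V by (rule BZ[OF that])
      fix j
      \<comment> \<open>One step beyond \<open>\<Lambda> j\<close>, so that \<open>lmu\<close> gives
        \<open>\<Lambda> j \<lesssim> Field (mu n)\<close>, while \<open>l n\<close> is
        \<open>\<Lambda> (Suc j)\<close>.\<close>
      define n where "n = Suc (n0 + j)"
      obtain c :: "'k set set rel" and P where P: "covering_family M (lam n) (cardSuc (mu n)) P" "c =o |P|" "c \<le>o M"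
        using M_cov[of n] unfolding is_cov_def by (elim exE conjE) (rule that)
      have "\<exists>\<D>\<subseteq>P. \<D> \<lesssim> Field (mu n) \<and> a \<subseteq> \<Union>\<D>" if a: "a \<subseteq> Field M" "a \<lesssim> l n" for a
      proof -
        have "|a| \<le>o lam n" using a(2) unfolding l_def card_of_lepoll[OF lam_card] .
        then have "\<exists>\<alpha>\<in>Field (cardSuc (mu n)). \<exists>A. (\<forall>i\<in>underS (cardSuc (mu n)) \<alpha>. A i \<in> P) \<and>
          a \<subseteq> (\<Union>i\<in>underS (cardSuc (mu n)) \<alpha>. A i)" using P(1) a(1) unfolding covering_family_def by simp
        then obtain \<alpha> A where A: "\<alpha> \<in> Field (cardSuc (mu n))" "\<forall>i\<in>underS (cardSuc (mu n)) \<alpha>. A i \<in> P"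
          "a \<subseteq> (\<Union>i\<in>underS (cardSuc (mu n)) \<alpha>. A i)" by (elim bexE exE conjE)
        \<comment> \<open>Fewer than \<mu>_n^+ covering sets means at most \<mu>_n of them, because
          the successor is an initial ordinal.\<close>
        have "|underS (cardSuc (mu n)) \<alpha>| <o cardSuc (mu n)"
          by (rule card_of_underS[OF cardSuc_Card_order[OF mu_card] A(1)])
        then have "|underS (cardSuc (mu n)) \<alpha>| \<le>o mu n"
          using cardSuc_ordLeq_ordLess[OF mu_card card_of_Card_order] by blast
        then have "underS (cardSuc (mu n)) \<alpha> \<lesssim> Field (mu n)"
          using card_of_lepoll[OF mu_card] by blast
        then have "A ` underS (cardSuc (mu n)) \<alpha> \<lesssim> Field (mu n)" by (rule lepoll_trans[OF image_lepoll])
        then show ?thesis using A(2,3) by (intro exI[of _ "A ` underS (cardSuc (mu n)) \<alpha>"]) blast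
      qed
      moreover have "A \<lesssim> l n" if "A \<in> P" for A
        using P(1) that unfolding covering_family_def l_def card_of_lepoll[OF lam_card] by blast
      moreover have "P \<lesssim> Field M"
        using card_of_lepoll[OF M_card] ordIso_ordLeq_trans[OF ordIso_symmetric[OF P(2)] P(3)] by blast
      moreover have jN: "\<Lambda> j \<lesssim> Field (mu n)" unfolding \<Lambda>_def n_def by (rule lmu)
      moreover have "infinite (Field (mu n))"
        using jN inf[of j] unfolding infinite_le_lepoll by (rule lepoll_trans[rotated])
      moreover have "\<not> l n \<lesssim> Pow (Pow (Field (mu n)))"
        using lesspoll_trans1[OF lepoll_Pow_self mu3[of n]] lesspoll_not_lepoll by blast
      moreover have "Pow (l n) \<lesssim> Field M"
      proof -
        have "l (Suc n) \<lesssim> (SIGMA n:UNIV. l n)" unfolding lepoll_def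
          by (intro exI[of _ "\<lambda>x. (Suc n, x)"]) (auto simp: inj_on_def)
        from lepoll_trans[OF Pl lepoll_trans[OF this lepoll_trans[OF SL(1) LM]]] show ?thesis .
      qed
      moreover have "l n \<lesssim> \<Lambda> (Suc j)" unfolding n_def \<Lambda>_def by simp
      ultimately show "\<exists>N Q p \<A>. infinite (N :: 'k set) \<and> \<Lambda> j \<lesssim> N \<and> \<not> (Q :: 'k set) \<lesssim> Pow (Pow N) \<and> Pow Q \<lesssim> Field M \<and> Q \<lesssim> \<Lambda> p \<and>
        \<A> \<lesssim> Field M \<and> (\<forall>A\<in>\<A>. A \<lesssim> Q) \<and> (\<forall>a\<subseteq>Field M. a \<lesssim> Q \<longrightarrow> (\<exists>\<D>\<subseteq>\<A>. \<D> \<lesssim> N \<and> a \<subseteq> \<Union>\<D>))"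
        by (intro exI[of _ "Field (mu n)"] exI[of _ "l n"] exI[of _ "Suc j"] exI[of _ P] conjI) simp_all
    qed
    have "\<exists>m. Field (mu n) \<prec> \<Lambda> m" for n
      using mu1[of n] l_mono[of n "n0 + n"] lesspoll_trans2 unfolding \<Lambda>_def by (metis le_add2)
    then have "configuration mu B Z" by (intro uncountable_case big wo_mu)
    \<comment> \<open>\<open>\<Lambda> 0\<close> and \<open>\<Lambda> 1\<close> are infinite of
      different sizes, so \<lambda> is uncountable and the second claim is vacuous.\<close>
    moreover have "\<not> L =o natLeq"
    proof
      assume "L =o natLeq"
      then have "Field L \<lesssim> (UNIV :: nat set)"
        using Card_order_lepoll[OF L_card natLeq_Card_order] unfolding ordIso_iff_ordLeq Field_natLeq by blast
      moreover have "\<Lambda> 1 \<lesssim> (SIGMA n:UNIV. l n)" unfolding lepoll_def \<Lambda>_def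
        by (intro exI[of _ "\<lambda>x. (n0 + 1, x)"]) (auto simp: inj_on_def)
      ultimately have "\<Lambda> 1 \<lesssim> \<Lambda> 0" using SL(1) nat_lepoll[OF inf[of 0], of UNIV] lepoll_trans by metis
      then show False using Lam_less[of 0 1] lesspoll_not_lepoll by auto
    qed
    ultimately show ?thesis by blast
  qed
  moreover have sub: "gen B \<subseteq> {U. openin X U}" unfolding genB ..
  ultimately show ?thesis
    using configuration_theorem[OF _ sub, of mu Z] real_chain_theorem[OF _ sub, of Z]
    unfolding Z_def mem_Collect_eq by blast
qed

end
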